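(* Let $E$ be either $\mathbb{Q}$ or an imaginary quadratic field with class number $1$, and let $\mathcal{O}$ be its ring of integers. Put $k_E=(4+4\sqrt{2})\sqrt{\beta_E}$. Then for every $\varepsilon>0$ there is a constant $C>0$ (depending on $E$ and $\varepsilon$) such that $$g^*_{\mathcal O}(n)\le C\,e^{(k_E+\varepsilon)\sqrt{n}}\quad\text{for all } n\ge 1,$$ i.e. $g^*_{\mathcal O}(n)=O\big(e^{(k_E+\varepsilon)\sqrt n}\big)$.
   Context: Let $*$ be the nontrivial automorphism of $E$ if $E\neq\mathbb{Q}$, and the identity if $E=\mathbb{Q}$. A hermitian form in $x_1,\dots,x_n$ over $E$ is $f=\sum_{i,j}a_{ij}x_ix_j^*$ with $a_{ij}=a_{ji}^*\in E$ (for $E=\mathbb Q$ this is a quadratic form with symmetric Gram matrix $(a_{ij})$); it is integral if all $a_{ij}\in\mathcal O$. For a linear form $\ell=a_1x_1+\dots+a_nx_n$, put $N(\ell)=(a_1x_1+\dots+a_nx_n)(a_1^*x_1^*+\dots+a_n^*x_n^* )$. A hermitian form $f$ in $n$ variables is represented by $I_r$ if $f=\sum_{k=1}^r N(\ell_k)$ for some linear forms $\ell_1,\dots,\ell_r$ in $x_1,\dots,x_n$ with coefficients in $\mathcal O$. Let $\Sigma^*_{\mathcal O}(n)$ be the set of integral hermitian forms in $n$ variables represented by $I_r$ for some $r$, and $g^*_{\mathcal O}(n)$ the least $g$ such that every form in $\Sigma^*_{\mathcal O}(n)$ is represented by $I_g$ (this is finite). Finally $\beta_E:=\sup_{x\in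 E}\inf_{c\in\mathcal O}|N_{E/\mathbb Q}(x-c)|^{1/[E:\mathbb Q]}$ (so $\beta_{\mathbb Q}=1/2$). *)

theory Defs
  imports "HOL-Analysis.Analysis" "HOL-Algebra.Subrings" "HOL-Algebra.QuotRing"
begin

(* Number fields are taken as subfields of the complex numbers; the rationals are \<rat> :: complex set. *)

definition complex_ring :: "complex ring" where
  "complex_ring = \<lparr>carrier = UNIV, mult = (*), one = 1, zero = 0, add = (+)\<rparr>"

definition rat_degree :: "complex set \<Rightarrow> nat" where
  "rat_degree E = vector_space.dim (\<lambda>(q::rat) (z::complex). of_rat q * z) E"

(* A quadratic field is normal over the rationals, so it has no real embedding if and only if
   one (equivalently, each) of its copies inside the complex numbers is not contained in \<real>. *)
definition imaginary_quadratic_field :: "complex set \<Rightarrow> bool" where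
  "imaginary_quadratic_field E \<longleftrightarrow>
     subfield E complex_ring \<and> rat_degree E = 2 \<and> \<not> E \<subseteq> \<real>"

definition ring_of_integers :: "complex set \<Rightarrow> complex set" where
  "ring_of_integers E = {x \<in> E. algebraic_int x}"

definition nonzero_ideals :: "complex set \<Rightarrow> complex set set" where
  "nonzero_ideals E =
     {I. ideal I (complex_ring\<lparr>carrier := ring_of_integers E\<rparr>) \<and> I \<noteq> {0}}"

definition ideal_class_rel :: "complex set \<Rightarrow> (complex set \<times> complex set) set" where
  "ideal_class_rel E =
     {(I, J). I \<in> nonzero_ideals E \<and> J \<in> nonzero_ideals E \<and>
        (\<exists>a \<in> ring_of_integers E - {0}. \<exists>b \<in> ring_of_integers E - {0}.
           (\<lambda>x. a * x) ` I = (\<lambda>x. b * x) ` J)}"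

definition class_number :: "complex set \<Rightarrow> nat" where
  "class_number E = card (nonzero_ideals E // ideal_class_rel E)"

(* Extensionality outside E makes each automorphism of E a single HOL function. *)
definition field_auts :: "complex set \<Rightarrow> (complex \<Rightarrow> complex) set" where
  "field_auts E =
     ring_iso (complex_ring\<lparr>carrier := E\<rparr>) (complex_ring\<lparr>carrier := E\<rparr>) \<inter> extensional E"

definition star :: "complex set \<Rightarrow> complex \<Rightarrow> complex" where
  "star E = (if E = \<rat> then (\<lambda>x\<in>E. x)
             else (THE \<sigma>. \<sigma> \<in> field_auts E \<and> \<sigma> \<noteq> (\<lambda>x\<in>E. x)))"

(* The norm of E over the rationals, for E Galois over the rationals. *)
definition field_norm :: "complex set \<Rightarrow> complex \<Rightarrow> complex" where
  "field_norm E x = (\<Prod>\<sigma>\<in>field_auts E. \<sigma> x)"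

(* For the fields considered here the supremum is over a bounded set of reals. *)
definition beta :: "complex set \<Rightarrow> real" where
  "beta E = (SUP x\<in>E. INF c\<in>ring_of_integers E.
               cmod (field_norm E (x - c)) powr (1 / real (rat_degree E)))"

definition k_const :: "complex set \<Rightarrow> real" where
  "k_const E = (4 + 4 * sqrt 2) * sqrt (beta E)"

(* A form in x_0, ..., x_{n-1} over E is represented by the function on E^n it defines.  As E is
   infinite, this function determines the coefficients of a hermitian form. *)
type_synonym form = "(nat \<Rightarrow> complex) \<Rightarrow> complex"

definition coord_space :: "complex set \<Rightarrow> nat \<Rightarrow> (nat \<Rightarrow> complex) set" where
  "coord_space E n = {..<n} \<rightarrow>\<^sub>E E"

definition gram_form :: "complex set \<Rightarrow> nat \<Rightarrow> (nat \<Rightarrow> nat \<Rightarrow> complex) \<Rightarrow> form" where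
  "gram_form E n a =
     (\<lambda>x\<in>coord_space E n. \<Sum>i<n. \<Sum>j<n. a i j * x i * star E (x j))"

definition integral_hermitian_form :: "complex set \<Rightarrow> nat \<Rightarrow> form \<Rightarrow> bool" where
  "integral_hermitian_form E n f \<longleftrightarrow>
     (\<exists>a. (\<forall>i<n. \<forall>j<n. a i j \<in> ring_of_integers E \<and> a i j = star E (a j i)) \<and>
          f = gram_form E n a)"

definition norm_of_linear_form :: "complex set \<Rightarrow> nat \<Rightarrow> (nat \<Rightarrow> complex) \<Rightarrow> form" where
  "norm_of_linear_form E n l =
     (\<lambda>x\<in>coord_space E n. (\<Sum>i<n. l i * x i) * (\<Sum>i<n. star E (l i) * star E (x i)))"

definition represented_by_I :: "complex set \<Rightarrow> nat \<Rightarrow> nat \<Rightarrow> form \<Rightarrow> bool" where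
  "represented_by_I E n r f \<longleftrightarrow>
     (\<exists>l. (\<forall>k<r. \<forall>i<n. l k i \<in> ring_of_integers E) \<and>
          f = (\<lambda>x\<in>coord_space E n. \<Sum>k<r. norm_of_linear_form E n (l k) x))"

definition Sigma_star :: "complex set \<Rightarrow> nat \<Rightarrow> form set" where
  "Sigma_star E n = {f. integral_hermitian_form E n f \<and> (\<exists>r. represented_by_I E n r f)}"

(* The value would be \<infinity> if no g worked for all forms at once; an upper bound on g_star by a
   finite quantity therefore contains the finiteness of g_star. *)
definition g_star :: "complex set \<Rightarrow> nat \<Rightarrow> enat" where
  "g_star E n = Inf (enat ` {g. \<forall>f\<in>Sigma_star E n. represented_by_I E n g f})"

end

theory Submission
  imports Defs "HOL-Computational_Algebra.Primes" "HOL-Real_Asymp.Real_Asymp"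
begin

text \<open>Let \<open>f\<close> be a sum of norms in \<open>n\<close> variables. If \<open>f\<close> takes a value below \<open>H\<close> at a nonzero
  integral vector, then it does so at a basis vector, fewer than \<open>H\<close> of the norms in \<open>f\<close> involve the
  corresponding variable, and the remaining ones form a sum of norms in \<open>n - 1\<close> variables. Hence
  everything depends on finding an \<open>H\<close> such that a form with minimum at least \<open>H\<close> is a sum of
  polynomially many norms.

  Write such a form as \<open>f = \<Sum>i. h i * |y i|\<^sup>2\<close> with \<open>y i = x i + \<Sum>j<i. u i j * x j\<close>. Let \<open>m\<close> be the last
  index and \<open>s\<close> an integer slightly below the square root of \<open>h m\<close>. Rounding the last row of the
  Gram matrix gives an integral linear form with last coefficient \<open>s\<close> whose norm cancels this row up
  to errors of size \<open>O(s)\<close>; these are sums of norms of forms in two variables with bounded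
  coefficients and multiplicities that are sums of four squares. What is left is a form in the other
  variables that differs from the orthogonal projection of \<open>f\<close> by at most
  \<open>O(sqrt (h m)) * \<Sum>j<m. |x j|\<^sup>2\<close>. So the elimination can be iterated as long as each \<open>h j\<close> with
  \<open>j < m\<close> exceeds \<open>sqrt (h m)\<close> by a suitable factor and the \<open>x j\<close> are bounded in terms of the \<open>y j\<close>.

  Both conditions are met by a Korkine-Zolotarev reduced basis whose dual basis is size-reduced:
  Minkowski's theorem gives \<open>h m \<le> Q * h j\<close> with \<open>Q = exp (O((ln n)\<^sup>2))\<close>, and one can take \<open>H\<close> to be
  polynomial in \<open>n\<close> and \<open>Q\<close>. The resulting bound \<open>exp (O((ln n)\<^sup>2))\<close> is smaller than the one claimed.\<close>

section \<open>Linear forms, hermitian forms and sums of norms\<close>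

text \<open>Each rounding error has to be paid for out of the coefficient of the eliminated
  variable. A cross term \<open>2 * Re (z * cnj (e * x j))\<close> is no sum of norms by itself; it
  is completed to norms of forms \<open>z + \<eta> * x j\<close> at the price of about a constant
  times \<open>cmod e + 1\<close> copies of the square of \<open>cmod z\<close>. As the errors have
  size \<open>s\<close>, the integer \<open>s\<close> must stay below the square root by a multiple
  of \<open>N\<close>. What remains is a nonnegative integer multiple of one norm, which four
  squares absorb whatever its size; so each elimination costs a number of norms linear in
  \<open>N\<close>. The loss is measured in the coordinates \<open>x j\<close>, but the form is
  controlled in the triangular ones. Bounded entries of a unitriangular matrix do not keep its
  inverse from growing exponentially, so it is the inverse that is size-reduced. The gap
  \<open>D * sqrt (h k) \<le> h j\<close> for \<open>j < k\<close> follows from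
  \<open>h k \<le> Q * h j\<close> once \<open>sqrt (h k) \<ge> D * Q\<close>. The minimum bounds
  the last \<open>h\<close> directly and the others only up to another factor \<open>Q\<close>;
  hence the threshold \<open>H = D\<^sup>2 * Q ^ 3\<close>.\<close>

definition conj_ring :: "complex set \<Rightarrow> bool" where
  "conj_ring S \<longleftrightarrow> 0 \<in> S \<and> 1 \<in> S \<and> (\<forall>x\<in>S. \<forall>y\<in>S. x + y \<in> S \<and> x - y \<in> S \<and> x * y \<in> S) \<and> (\<forall>x\<in>S. cnj x \<in> S)"

lemma conj_ringD:
  assumes "conj_ring S"
  shows "0 \<in> S" "1 \<in> S" "x \<in> S \<Longrightarrow> y \<in> S \<Longrightarrow> x + y \<in> S" "x \<in> S \<Longrightarrow> y \<in> S \<Longrightarrow> x - y \<in> S"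
    "x \<in> S \<Longrightarrow> y \<in> S \<Longrightarrow> x * y \<in> S" "x \<in> S \<Longrightarrow> cnj x \<in> S" "x \<in> S \<Longrightarrow> - x \<in> S"
proof -
  show "x \<in> S \<Longrightarrow> - x \<in> S" using assms unfolding conj_ring_def by (metis diff_0)
qed (use assms in \<open>auto simp: conj_ring_def\<close>)

lemma conj_ring_of_nat: "conj_ring S \<Longrightarrow> of_nat k \<in> S"
  by (induction k) (auto intro: conj_ringD)

lemma conj_ring_sum: "conj_ring S \<Longrightarrow> (\<And>i. i \<in> A \<Longrightarrow> f i \<in> S) \<Longrightarrow> sum f A \<in> S"
  by (induction A rule: infinite_finite_induct) (auto intro: conj_ringD)

text \<open>Forms live on all sequences and only the first \<open>m\<close> entries matter, so
  passing between \<open>m\<close> and \<open>Suc m\<close> variables changes neither type nor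
  domain.\<close>

definition linform :: "complex set \<Rightarrow> nat \<Rightarrow> ((nat \<Rightarrow> complex) \<Rightarrow> complex) \<Rightarrow> bool" where
  "linform S m l \<longleftrightarrow> (\<exists>c. (\<forall>j<m. c j \<in> S) \<and> l = (\<lambda>x. \<Sum>j<m. c j * x j))"

lemma linformI: "(\<And>j. j < m \<Longrightarrow> c j \<in> S) \<Longrightarrow> linform S m (\<lambda>x. \<Sum>j<m. c j * x j)"
  unfolding linform_def by auto

lemma linform_zero: "conj_ring S \<Longrightarrow> linform S m (\<lambda>x. 0)"
  using linformI[of m "\<lambda>_. 0" S] by (simp add: conj_ringD)

lemma linform_coord:
  assumes "conj_ring S" "i < m" shows "linform S m (\<lambda>x. x i)"
proof -
  have "(\<lambda>x. x i) = (\<lambda>x::nat \<Rightarrow> complex. \<Sum>j<m. (if j = i then 1 else 0) * x j)"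
    using assms by (auto simp: fun_eq_iff if_distrib[of "\<lambda>a. a * _"] sum.delta cong: if_cong)
  then show ?thesis using linformI[of m "\<lambda>j. if j = i then 1 else 0" S] assms
    by (simp add: conj_ringD)
qed

lemma linform_add:
  assumes "conj_ring S" "linform S m f" "linform S m g" shows "linform S m (\<lambda>x. f x + g x)"
proof -
  obtain c d where "\<forall>j<m. c j \<in> S" "f = (\<lambda>x. \<Sum>j<m. c j * x j)" "\<forall>j<m. d j \<in> S" "g = (\<lambda>x. \<Sum>j<m. d j * x j)"
    using assms unfolding linform_def by blast
  then show ?thesis using linformI[of m "\<lambda>j. c j + d j" S] assms(1)
    by (simp add: conj_ringD sum.distrib ring_distribs)
qed

lemma linform_scale:
  assumes "conj_ring S" "a \<in> S" "linform S m f" shows "linform S m (\<lambda>x. a * f x)"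
proof -
  obtain c where "\<forall>j<m. c j \<in> S" "f = (\<lambda>x. \<Sum>j<m. c j * x j)"
    using assms unfolding linform_def by blast
  then show ?thesis using linformI[of m "\<lambda>j. a * c j" S] assms(1,2)
    by (simp add: conj_ringD sum_distrib_left mult.assoc)
qed

lemma linform_uminus: "conj_ring S \<Longrightarrow> linform S m f \<Longrightarrow> linform S m (\<lambda>x. - f x)"
  using linform_scale[of S "-1" m f] by (simp add: conj_ringD)

lemma linform_diff: "conj_ring S \<Longrightarrow> linform S m f \<Longrightarrow> linform S m g \<Longrightarrow> linform S m (\<lambda>x. f x - g x)"
  using linform_add[of S m f "\<lambda>x. - g x"] linform_uminus[of S m g] by simp

lemma linform_sum:
  "conj_ring S \<Longrightarrow> (\<And>i. i \<in> A \<Longrightarrow> linform S m (f i)) \<Longrightarrow> linform S m (\<lambda>x. \<Sum>i\<in>A. f i x)"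
  by (induction A rule: infinite_finite_induct) (auto intro: linform_add linform_zero)

lemma linform_subst:
  assumes "conj_ring S" "linform S m l" "\<And>i. i < m \<Longrightarrow> linform S k (\<lambda>x. T x i)"
  shows "linform S k (\<lambda>x. l (T x))"
proof -
  obtain c where c: "\<forall>j<m. c j \<in> S" "l = (\<lambda>x. \<Sum>j<m. c j * x j)"
    using assms unfolding linform_def by blast
  show ?thesis unfolding c(2)
    by (intro linform_sum linform_scale assms) (use c assms in auto)
qed

lemma linform_mono:
  assumes "conj_ring S" "linform S m l" "m \<le> k" shows "linform S k l"
  using linform_subst[OF assms(1,2), of k "\<lambda>x. x"] linform_coord[OF assms(1)] assms(3) by simp

lemma linform_cong: "linform S m l \<Longrightarrow> (\<And>i. i < m \<Longrightarrow> x i = y i) \<Longrightarrow> l x = l y"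
  unfolding linform_def by auto

lemma linform_mem:
  "conj_ring S \<Longrightarrow> linform S m l \<Longrightarrow> (\<And>i. i < m \<Longrightarrow> x i \<in> S) \<Longrightarrow> l x \<in> S"
  unfolding linform_def by (auto intro!: conj_ring_sum intro: conj_ringD)

lemma linform_subset: "S \<subseteq> S' \<Longrightarrow> linform S m l \<Longrightarrow> linform S' m l"
  unfolding linform_def by blast

lemma linform_Suc_cases:
  assumes "linform S (Suc m) l"
  obtains a f where "a \<in> S" "linform S m f" "l = (\<lambda>x. a * x m + f x)"
proof -
  obtain c where c: "\<forall>j<Suc m. c j \<in> S" "l = (\<lambda>x. \<Sum>j<Suc m. c j * x j)"
    using assms unfolding linform_def by blast
  show ?thesis
    by (rule that[of "c m" "\<lambda>x. \<Sum>j<m. c j * x j"]) (use c in \<open>auto intro: linformI simp: add.commute\<close>)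
qed

text \<open>Splits off the last row of a hermitian Gram matrix: \<open>\<alpha>\<close> is the
  diagonal entry, \<open>b\<close> the rest of the row up to conjugation, \<open>\<psi>\<close> the
  remaining block. The recursion follows the elimination of the last variable; values are real
  because a hermitian form takes only real ones.\<close>

primrec hform :: "complex set \<Rightarrow> nat \<Rightarrow> ((nat \<Rightarrow> complex) \<Rightarrow> real) \<Rightarrow> bool" where
  "hform S 0 \<phi> \<longleftrightarrow> \<phi> = (\<lambda>x. 0)"
| "hform S (Suc m) \<phi> \<longleftrightarrow> (\<exists>\<alpha> b \<psi>. of_real \<alpha> \<in> S \<and> linform S m b \<and> hform S m \<psi> \<and>
     \<phi> = (\<lambda>x. \<alpha> * (cmod (x m))\<^sup>2 + 2 * Re (x m * cnj (b x)) + \<psi> x))"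

lemma hform_SucI:
  "of_real \<alpha> \<in> S \<Longrightarrow> linform S m b \<Longrightarrow> hform S m \<psi> \<Longrightarrow>
   (\<And>x. \<phi> x = \<alpha> * (cmod (x m))\<^sup>2 + 2 * Re (x m * cnj (b x)) + \<psi> x) \<Longrightarrow> hform S (Suc m) \<phi>"
  by (auto simp: fun_eq_iff)

lemma hform_SucE:
  assumes "hform S (Suc m) \<phi>"
  obtains \<alpha> b \<psi> where "of_real \<alpha> \<in> S" "linform S m b" "hform S m \<psi>"
    "\<phi> = (\<lambda>x. \<alpha> * (cmod (x m))\<^sup>2 + 2 * Re (x m * cnj (b x)) + \<psi> x)"
  using assms by (auto simp: fun_eq_iff)

lemma hform_zero: "conj_ring S \<Longrightarrow> hform S m (\<lambda>x. 0)"
proof (induction m)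
  case (Suc m)
  then show ?case by (intro hform_SucI[of 0 S m "\<lambda>x. 0" "\<lambda>x. 0"]) (auto intro: conj_ringD linform_zero)
qed auto

lemma hform_add: "conj_ring S \<Longrightarrow> hform S m f \<Longrightarrow> hform S m g \<Longrightarrow> hform S m (\<lambda>x. f x + g x)"
proof (induction m arbitrary: f g)
  case (Suc m)
  obtain \<alpha> b \<psi> where 1: "of_real \<alpha> \<in> S" "linform S m b" "hform S m \<psi>"
    "f = (\<lambda>x. \<alpha> * (cmod (x m))\<^sup>2 + 2 * Re (x m * cnj (b x)) + \<psi> x)" using Suc.prems(2) by (rule hform_SucE)
  obtain \<alpha>' b' \<psi>' where 2: "of_real \<alpha>' \<in> S" "linform S m b'" "hform S m \<psi>'"
    "g = (\<lambda>x. \<alpha>' * (cmod (x m))\<^sup>2 + 2 * Re (x m * cnj (b' x)) + \<psi>' x)" using Suc.prems(3) by (rule hform_SucE)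
  show ?case
    by (rule hform_SucI[of "\<alpha> + \<alpha>'" S m "\<lambda>x. b x + b' x" "\<lambda>x. \<psi> x + \<psi>' x"])
      (use 1 2 Suc in \<open>auto simp: algebra_simps intro: conj_ringD linform_add\<close>)
qed auto

lemma hform_scale: "conj_ring S \<Longrightarrow> of_real c \<in> S \<Longrightarrow> hform S m f \<Longrightarrow> hform S m (\<lambda>x. c * f x)"
proof (induction m arbitrary: f)
  case (Suc m)
  obtain \<alpha> b \<psi> where 1: "of_real \<alpha> \<in> S" "linform S m b" "hform S m \<psi>"
    "f = (\<lambda>x. \<alpha> * (cmod (x m))\<^sup>2 + 2 * Re (x m * cnj (b x)) + \<psi> x)" using Suc.prems(3) by (rule hform_SucE)
  show ?case
    by (rule hform_SucI[of "c * \<alpha>" S m "\<lambda>x. of_real c * b x" "\<lambda>x. c * \<psi> x"])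
      (use 1 Suc in \<open>auto simp: algebra_simps intro: conj_ringD linform_scale\<close>)
qed auto

lemma hform_diff:
  assumes "conj_ring S" "hform S m f" "hform S m g" shows "hform S m (\<lambda>x. f x - g x)"
  using hform_add[OF assms(1,2) hform_scale[of S "-1", OF assms(1) _ assms(3)]] assms(1)
  by (simp add: conj_ringD)

lemma hform_sum:
  "conj_ring S \<Longrightarrow> (\<And>i. i \<in> A \<Longrightarrow> hform S m (f i)) \<Longrightarrow> hform S m (\<lambda>x. \<Sum>i\<in>A. f i x)"
  by (induction A rule: infinite_finite_induct) (auto intro: hform_add hform_zero)

lemma cmod_add_square: "(cmod (a + b))\<^sup>2 = (cmod a)\<^sup>2 + 2 * Re (a * cnj b) + (cmod b)\<^sup>2"
  unfolding cmod_power2 by (simp add: power2_eq_square algebra_simps)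

lemma hform_norm: "conj_ring S \<Longrightarrow> linform S m l \<Longrightarrow> hform S m (\<lambda>x. (cmod (l x))\<^sup>2)"
proof (induction m arbitrary: l)
  case 0
  then show ?case by (auto simp: linform_def)
next
  case (Suc m)
  obtain a f where af: "a \<in> S" "linform S m f" "l = (\<lambda>x. a * x m + f x)"
    using Suc.prems(2) by (rule linform_Suc_cases)
  \<comment> \<open>Closure of \<open>S\<close> under \<open>cnj\<close> puts the diagonal entry
    into \<open>S\<close>.\<close>
  have "complex_of_real ((cmod a)\<^sup>2) = a * cnj a"
    by (metis complex_norm_square of_real_power)
  then have "complex_of_real ((cmod a)\<^sup>2) \<in> S" using af Suc.prems(1) by (auto intro: conj_ringD)
  then show ?case
    by (intro hform_SucI[of "(cmod a)\<^sup>2" S m "\<lambda>x. cnj a * f x" "\<lambda>x. (cmod (f x))\<^sup>2"])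
      (use af Suc in \<open>auto intro: conj_ringD linform_scale simp: cmod_add_square norm_mult power_mult_distrib algebra_simps\<close>)
qed

lemma hform_Re:
  assumes "conj_ring S" "linform S m f" "linform S m g"
  shows "hform S m (\<lambda>x. 2 * Re (f x * cnj (g x)))"
proof -
  have "(\<lambda>x. 2 * Re (f x * cnj (g x))) = (\<lambda>x. (cmod (f x + g x))\<^sup>2 - (cmod (f x))\<^sup>2 - (cmod (g x))\<^sup>2)"
    by (simp add: cmod_add_square)
  then show ?thesis using assms by (auto intro!: hform_diff hform_norm linform_add)
qed

lemma hform_cong: "hform S m \<phi> \<Longrightarrow> (\<And>i. i < m \<Longrightarrow> x i = y i) \<Longrightarrow> \<phi> x = \<phi> y"
proof (induction m arbitrary: \<phi>)
  case (Suc m)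
  obtain \<alpha> b \<psi> where 1: "of_real \<alpha> \<in> S" "linform S m b" "hform S m \<psi>"
    "\<phi> = (\<lambda>x. \<alpha> * (cmod (x m))\<^sup>2 + 2 * Re (x m * cnj (b x)) + \<psi> x)" using Suc.prems(1) by (rule hform_SucE)
  have "b x = b y" "\<psi> x = \<psi> y" using 1 Suc linform_cong[of S m b x y] by auto
  then show ?case using 1 Suc.prems(2)[of m] by simp
qed auto

definition unit_vec :: "nat \<Rightarrow> nat \<Rightarrow> complex" where
  "unit_vec m = (\<lambda>i. if i = m then 1 else 0)"

lemma linform_at_zero: "linform S m l \<Longrightarrow> (\<And>i. i < m \<Longrightarrow> x i = 0) \<Longrightarrow> l x = 0"
  unfolding linform_def by auto

lemma hform_at_zero: "hform S m \<phi> \<Longrightarrow> (\<And>i. i < m \<Longrightarrow> x i = 0) \<Longrightarrow> \<phi> x = 0"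
proof (induction m arbitrary: \<phi>)
  case (Suc m)
  then show ?case using linform_at_zero[of S m _ x] by fastforce
qed auto

section \<open>Sums of norms of linear forms\<close>

inductive norm_sum :: "complex set \<Rightarrow> nat \<Rightarrow> nat \<Rightarrow> ((nat \<Rightarrow> complex) \<Rightarrow> real) \<Rightarrow> bool" for S m where
  zero: "norm_sum S m 0 (\<lambda>x. 0)"
| step: "linform S m l \<Longrightarrow> norm_sum S m r \<phi> \<Longrightarrow> norm_sum S m (Suc r) (\<lambda>x. \<phi> x + (cmod (l x))\<^sup>2)"

lemma norm_sum_add:
  assumes "norm_sum S m s \<psi>" "norm_sum S m r \<phi>"
  shows "norm_sum S m (r + s) (\<lambda>x. \<phi> x + \<psi> x)"
  using assms
proof (induction rule: norm_sum.induct)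
  case (step l s \<psi>)
  then show ?case using norm_sum.step[of S m l "r + s" "\<lambda>x. \<phi> x + \<psi> x"] by (simp add: add.assoc)
qed auto

lemma norm_sum_single: "linform S m l \<Longrightarrow> norm_sum S m 1 (\<lambda>x. (cmod (l x))\<^sup>2)"
  using norm_sum.step[OF _ norm_sum.zero] by simp

lemma norm_sum_pad:
  assumes "conj_ring S" "norm_sum S m r \<phi>" "r \<le> s" shows "norm_sum S m s \<phi>"
  using assms(3)
proof (induction s rule: dec_induct)
  case (step n)
  then show ?case using norm_sum.step[OF linform_zero[OF assms(1)], of m n \<phi>] by simp
qed (use assms in auto)

lemma norm_sum_sum:
  assumes "finite A" "\<And>i. i \<in> A \<Longrightarrow> norm_sum S m r (\<phi> i)"
  shows "norm_sum S m (card A * r) (\<lambda>x. \<Sum>i\<in>A. \<phi> i x)"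
  using assms
proof (induction A rule: finite_induct)
  case (insert a A)
  have "norm_sum S m (card A * r + r) (\<lambda>x. (\<Sum>i\<in>A. \<phi> i x) + \<phi> a x)"
    by (rule norm_sum_add) (use insert in auto)
  then show ?case using insert by (simp add: add.commute)
qed (auto intro: norm_sum.zero)

lemma norm_sum_subst:
  assumes "conj_ring S" "norm_sum S m r \<phi>" "\<And>i. i < m \<Longrightarrow> linform S k (\<lambda>x. T x i)"
  shows "norm_sum S k r (\<lambda>x. \<phi> (T x))"
  using assms(2)
  by (induction rule: norm_sum.induct)
    (auto intro: norm_sum.intros linform_subst[OF assms(1) _ assms(3)])

lemma norm_sum_mono: "conj_ring S \<Longrightarrow> norm_sum S m r \<phi> \<Longrightarrow> m \<le> k \<Longrightarrow> norm_sum S k r \<phi>"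
  using norm_sum_subst[of S m r \<phi> k "\<lambda>x. x"] linform_coord[of S] by simp

lemma norm_sum_hform: "norm_sum S m r \<phi> \<Longrightarrow> conj_ring S \<Longrightarrow> hform S m \<phi>"
  by (induction rule: norm_sum.induct) (auto intro: hform_zero hform_add hform_norm)

lemma norm_sum_nonneg: "norm_sum S m r \<phi> \<Longrightarrow> \<phi> x \<ge> 0"
  by (induction rule: norm_sum.induct) auto

section \<open>Triangular forms and unimodular substitutions\<close>

definition tricoord :: "(nat \<Rightarrow> nat \<Rightarrow> complex) \<Rightarrow> nat \<Rightarrow> (nat \<Rightarrow> complex) \<Rightarrow> complex" where
  "tricoord u i x = x i + (\<Sum>j<i. u i j * x j)"

definition triform :: "(nat \<Rightarrow> real) \<Rightarrow> (nat \<Rightarrow> nat \<Rightarrow> complex) \<Rightarrow> nat \<Rightarrow> (nat \<Rightarrow> complex) \<Rightarrow> real" where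
  "triform h u m x = (\<Sum>i<m. h i * (cmod (tricoord u i x))\<^sup>2)"

lemma tricoord_cong: "(\<And>j. j \<le> i \<Longrightarrow> x j = y j) \<Longrightarrow> tricoord u i x = tricoord u i y"
  unfolding tricoord_def by auto

lemma triform_cong: "(\<And>j. j < m \<Longrightarrow> x j = y j) \<Longrightarrow> triform h u m x = triform h u m y"
proof -
  assume "\<And>j. j < m \<Longrightarrow> x j = y j"
  then have "tricoord u i x = tricoord u i y" if "i < m" for i
    by (intro tricoord_cong) (use that in auto)
  then show ?thesis unfolding triform_def by simp
qed

lemma triform_Suc: "triform h u (Suc m) x = triform h u m x + h m * (cmod (tricoord u m x))\<^sup>2"
  unfolding triform_def by simp

text \<open>Fixing the entries from \<open>m\<close> on makes a substitution in \<open>m\<close>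
  variables literally one in \<open>Suc m\<close> variables, and lets inverse substitutions cancel
  on all sequences.\<close>

definition int_subst :: "complex set \<Rightarrow> nat \<Rightarrow> ((nat \<Rightarrow> complex) \<Rightarrow> nat \<Rightarrow> complex) \<Rightarrow> bool" where
  "int_subst S m T \<longleftrightarrow> (\<forall>i<m. linform S m (\<lambda>x. T x i)) \<and> (\<forall>i\<ge>m. \<forall>x. T x i = x i)"

definition unimod :: "complex set \<Rightarrow> nat \<Rightarrow> ((nat \<Rightarrow> complex) \<Rightarrow> nat \<Rightarrow> complex) \<Rightarrow> ((nat \<Rightarrow> complex) \<Rightarrow> nat \<Rightarrow> complex) \<Rightarrow> bool" where
  "unimod S m T T' \<longleftrightarrow> int_subst S m T \<and> int_subst S m T' \<and> (\<forall>x. T (T' x) = x) \<and> (\<forall>x. T' (T x) = x)"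

lemma int_subst_comp:
  assumes "conj_ring S" "int_subst S m T" "int_subst S m T'" shows "int_subst S m (\<lambda>x. T (T' x))"
  using assms linform_subst[OF assms(1), of m _ m T'] unfolding int_subst_def by auto

lemma unimod_comp:
  "conj_ring S \<Longrightarrow> unimod S m T T' \<Longrightarrow> unimod S m U U' \<Longrightarrow> unimod S m (\<lambda>x. T (U x)) (\<lambda>x. U' (T' x))"
  unfolding unimod_def by (auto intro: int_subst_comp)

lemma unimod_id: "conj_ring S \<Longrightarrow> unimod S m (\<lambda>x. x) (\<lambda>x. x)"
  unfolding unimod_def int_subst_def by (auto intro: linform_coord)

lemma int_subst_Suc: "conj_ring S \<Longrightarrow> int_subst S m T \<Longrightarrow> int_subst S (Suc m) T"
  unfolding int_subst_def using linform_mono[of S m _ "Suc m"] linform_coord[of S m "Suc m"]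
  by (auto simp: less_Suc_eq)

lemma unimod_Suc: "conj_ring S \<Longrightarrow> unimod S m T T' \<Longrightarrow> unimod S (Suc m) T T'"
  unfolding unimod_def by (auto intro: int_subst_Suc)

lemma int_subst_mem:
  "conj_ring S \<Longrightarrow> int_subst S m T \<Longrightarrow> (\<And>i. x i \<in> S) \<Longrightarrow> T x i \<in> S"
  unfolding int_subst_def using linform_mem[of S m "\<lambda>x. T x i" x] by (cases "i < m") auto

lemma int_subst_zero:
  "int_subst S m T \<Longrightarrow> (\<And>i. i < m \<Longrightarrow> x i = 0) \<Longrightarrow> i < m \<Longrightarrow> T x i = 0"
  unfolding int_subst_def using linform_at_zero[of S m "\<lambda>x. T x i" x] by auto

lemma unimod_nonzero:
  assumes "unimod S m T T'" "\<exists>i<m. x i \<noteq> 0" shows "\<exists>i<m. T x i \<noteq> 0"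
proof (rule ccontr)
  assume "\<not> ?thesis"
  then have "\<And>i. i < m \<Longrightarrow> T' (T x) i = 0" using assms(1) int_subst_zero[of S m T' "T x"] unfolding unimod_def by auto
  then show False using assms unfolding unimod_def by auto
qed

lemma norm_sum_unimod:
  assumes "conj_ring S" "unimod S m T T'" "norm_sum S m r (\<lambda>x. \<phi> (T x))" shows "norm_sum S m r \<phi>"
  using norm_sum_subst[OF assms(1,3), of m T'] assms(2) unfolding unimod_def int_subst_def by auto

lemma linform_tricoord: "conj_ring S \<Longrightarrow> (\<And>i j. u i j \<in> S) \<Longrightarrow> i < m \<Longrightarrow> linform S m (tricoord u i)"
  unfolding tricoord_def by (auto intro!: linform_add linform_sum linform_scale linform_coord)

lemma hform_triform_subst:
  assumes "conj_ring S" "\<And>i j. u i j \<in> S" "\<And>i. i < m \<Longrightarrow> of_real (h i) \<in> S"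
    "\<And>i. i < m \<Longrightarrow> linform S m (\<lambda>x. T x i)"
  shows "hform S m (\<lambda>x. triform h u m (T x))"
  unfolding triform_def
  by (intro hform_sum hform_scale hform_norm linform_subst[OF assms(1) linform_tricoord] assms) auto

lemma tricoord_mem: "conj_ring S \<Longrightarrow> (\<And>i j. u i j \<in> S) \<Longrightarrow> (\<And>j. j \<le> i \<Longrightarrow> x j \<in> S) \<Longrightarrow> tricoord u i x \<in> S"
  unfolding tricoord_def by (auto intro!: conj_ringD(3) conj_ring_sum conj_ringD(5))

section \<open>Sums of four squares\<close>

definition sum4sq :: "int \<Rightarrow> bool" where
  "sum4sq n \<longleftrightarrow> (\<exists>a b c d. n = a\<^sup>2 + b\<^sup>2 + c\<^sup>2 + d\<^sup>2)"

lemma euler_four_squares: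
  fixes a b c d w x y z :: int
  shows "(a\<^sup>2 + b\<^sup>2 + c\<^sup>2 + d\<^sup>2) * (w\<^sup>2 + x\<^sup>2 + y\<^sup>2 + z\<^sup>2) =
    (a * w + b * x + c * y + d * z)\<^sup>2 + (a * x - b * w + c * z - d * y)\<^sup>2 +
    (a * y - c * w + d * x - b * z)\<^sup>2 + (a * z - d * w + b * y - c * x)\<^sup>2"
  by (simp add: power2_eq_square algebra_simps)

lemma sum4sq_mult: "sum4sq m \<Longrightarrow> sum4sq n \<Longrightarrow> sum4sq (m * n)"
  unfolding sum4sq_def using euler_four_squares by metis

text \<open>Pigeonhole: for \<open>0 \<le> x < p / 2\<close> the squares are distinct modulo
  \<open>p\<close>, giving \<open>(p + 1) / 2\<close> residues, and so do the numbers
  \<open>- 1 - y\<^sup>2\<close>. Together these are more than \<open>p\<close>, so the two sets of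
  residues meet.\<close>

lemma prime_dvd_two_squares_plus_one:
  fixes p :: int
  assumes "prime p" "odd p"
  shows "\<exists>x y. 0 \<le> x \<and> 2 * x < p \<and> 0 \<le> y \<and> 2 * y < p \<and> p dvd x\<^sup>2 + y\<^sup>2 + 1"
proof -
  define A where "A = {x. 0 \<le> x \<and> 2 * x < p}"
  have p: "p > 1" using assms(1) prime_gt_1_int by blast
  obtain k where k: "p = 2 * k + 1" using assms(2) by (elim oddE)
  have A: "A = {0..k}" unfolding A_def k by auto
  then have finA: "finite A" and cardA: "int (card A) = k + 1" using p k by auto
  have inj: "x = y" if "x \<in> A" "y \<in> A" "p dvd x\<^sup>2 - y\<^sup>2" for x y
  proof -
    have "p dvd (x - y) * (x + y)" using that(3) by (simp add: power2_eq_square algebra_simps)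
    then have "p dvd x - y \<or> p dvd x + y" using assms(1) prime_dvd_mult_iff by blast
    moreover have "\<bar>x - y\<bar> < p" "0 \<le> x + y" "x + y < p" using that(1,2) unfolding A_def by auto
    ultimately have "x - y = 0 \<or> x + y = 0" using p
      by (metis dvd_imp_le_int abs_of_nonneg linorder_not_less abs_of_pos dual_order.strict_trans zero_less_one)
    then show ?thesis using that(1,2) unfolding A_def by auto
  qed
  let ?f = "\<lambda>x. x\<^sup>2 mod p" and ?g = "\<lambda>y. (- 1 - y\<^sup>2) mod p"
  have "inj_on ?f A" by (intro inj_onI inj) (auto simp: mod_eq_dvd_iff)
  moreover have "inj_on ?g A"
  proof (intro inj_onI)
    fix x y assume *: "x \<in> A" "y \<in> A" "(- 1 - x\<^sup>2) mod p = (- 1 - y\<^sup>2) mod p"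
    then have "p dvd y\<^sup>2 - x\<^sup>2" by (simp add: mod_eq_dvd_iff)
    then show "x = y" using inj[of y x] * by auto
  qed
  ultimately have card: "card (?f ` A) = card A" "card (?g ` A) = card A" by (auto simp: card_image)
  have sub: "?f ` A \<union> ?g ` A \<subseteq> {0..<p}" using p by auto
  have "?f ` A \<inter> ?g ` A \<noteq> {}"
  proof
    assume "?f ` A \<inter> ?g ` A = {}"
    then have "card (?f ` A \<union> ?g ` A) = card A + card A"
      using card finA by (subst card_Un_disjoint) auto
    moreover have "card (?f ` A \<union> ?g ` A) \<le> card {0..<p}" by (intro card_mono sub) auto
    ultimately show False using cardA k p by simp
  qed
  then obtain x y where xy: "x \<in> A" "y \<in> A" "x\<^sup>2 mod p = (- 1 - y\<^sup>2) mod p" by blast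
  then have "p dvd x\<^sup>2 + y\<^sup>2 + 1" by (simp add: mod_eq_dvd_iff algebra_simps)
  then show ?thesis using xy unfolding A_def by auto
qed

lemma balanced_residue:
  fixes x m :: int
  assumes "m > 0"
  shows "\<exists>a k. x = a + k * m \<and> 2 * \<bar>a\<bar> \<le> m"
proof (cases "2 * (x mod m) \<le> m")
  case True
  then show ?thesis using assms by (intro exI[of _ "x mod m"] exI[of _ "x div m"]) auto
next
  case False
  have "x mod m < m" using assms by simp
  then have "2 * \<bar>x mod m - m\<bar> \<le> m" using False by (simp add: abs_if)
  moreover have "x = (x mod m - m) + (x div m + 1) * m" by (simp add: distrib_right)
  ultimately show ?thesis by blast
qed

text \<open>Lagrange's descent: replace the four roots by their balanced residues modulo
  \<open>m\<close>, whose squares sum to \<open>m * r\<close> with \<open>r \<le> m\<close>. In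
  Euler's product of both sums all four terms are divisible by \<open>m\<close>, and cancelling
  \<open>m\<^sup>2\<close> leaves \<open>r * p\<close>.\<close>

lemma sum4sq_descent:
  fixes m p :: int
  assumes "prime p" "1 < m" "m < p" "sum4sq (m * p)"
  shows "\<exists>r. 0 < r \<and> r < m \<and> sum4sq (r * p)"
proof -
  obtain x1 x2 x3 x4 where x: "m * p = x1\<^sup>2 + x2\<^sup>2 + x3\<^sup>2 + x4\<^sup>2"
    using assms(4) unfolding sum4sq_def by blast
  have m0: "m > 0" using assms(2) by simp
  have nd: "\<not> m dvd p" using assms(1,2,3) by (metis prime_int_iff zdvd_not_zless zero_less_one dual_order.strict_trans order_less_le)
  obtain a1 k1 where a1: "x1 = a1 + k1 * m" "2 * \<bar>a1\<bar> \<le> m" using balanced_residue[OF m0] by blast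
  obtain a2 k2 where a2: "x2 = a2 + k2 * m" "2 * \<bar>a2\<bar> \<le> m" using balanced_residue[OF m0] by blast
  obtain a3 k3 where a3: "x3 = a3 + k3 * m" "2 * \<bar>a3\<bar> \<le> m" using balanced_residue[OF m0] by blast
  obtain a4 k4 where a4: "x4 = a4 + k4 * m" "2 * \<bar>a4\<bar> \<le> m" using balanced_residue[OF m0] by blast
  define A where "A = a1\<^sup>2 + a2\<^sup>2 + a3\<^sup>2 + a4\<^sup>2"
  \<comment> \<open>The quotient of \<open>A\<close> by \<open>m\<close>, written out so that
    \<open>A = m * r\<close> is mere expansion.\<close>
  define r where "r = p - (2 * (a1 * k1 + a2 * k2 + a3 * k3 + a4 * k4) + m * (k1\<^sup>2 + k2\<^sup>2 + k3\<^sup>2 + k4\<^sup>2))"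
  have Ar: "A = m * r" using x unfolding r_def A_def a1(1) a2(1) a3(1) a4(1)
    by (simp add: power2_eq_square algebra_simps)
  have sq: "4 * a\<^sup>2 \<le> m\<^sup>2" if "2 * \<bar>a\<bar> \<le> m" for a :: int
  proof -
    have "(2 * \<bar>a\<bar>)\<^sup>2 \<le> m\<^sup>2" using that by (intro power_mono) auto
    then show ?thesis by (simp add: power_mult_distrib)
  qed
  have le: "4 * A \<le> 4 * m\<^sup>2" unfolding A_def using sq[OF a1(2)] sq[OF a2(2)] sq[OF a3(2)] sq[OF a4(2)] by simp
  have r_le: "r \<le> m" using le Ar assms(2) by (simp add: power2_eq_square)
  have r_ge: "r \<ge> 0"
  proof -
    have "0 \<le> m * r" unfolding Ar[symmetric] A_def by simp
    then show ?thesis using assms(2) by (simp add: zero_le_mult_iff)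
  qed
  have "r \<noteq> 0"
  proof
    assume "r = 0"
    then have "A = 0" using Ar by simp
    then have "a1 = 0 \<and> a2 = 0 \<and> a3 = 0 \<and> a4 = 0" unfolding A_def
      by (smt (verit) zero_le_power2 zero_eq_power2)
    then have "m dvd p" using \<open>r = 0\<close> unfolding r_def by (simp add: dvd_def)
    then show False using nd by simp
  qed
  \<comment> \<open>Equality forces every residue to be \<open>m / 2\<close> in absolute value; then
    \<open>m\<close> divides each \<open>2 * a\<close> and hence \<open>p\<close>.\<close>
  have "r \<noteq> m"
  proof
    assume "r = m"
    then have "A = m\<^sup>2" using Ar by (simp add: power2_eq_square)
    then have "4 * a1\<^sup>2 = m\<^sup>2 \<and> 4 * a2\<^sup>2 = m\<^sup>2 \<and> 4 * a3\<^sup>2 = m\<^sup>2 \<and> 4 * a4\<^sup>2 = m\<^sup>2"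
      unfolding A_def using sq[OF a1(2)] sq[OF a2(2)] sq[OF a3(2)] sq[OF a4(2)] by linarith
    then have "(2 * a1)\<^sup>2 = m\<^sup>2" "(2 * a2)\<^sup>2 = m\<^sup>2" "(2 * a3)\<^sup>2 = m\<^sup>2" "(2 * a4)\<^sup>2 = m\<^sup>2" by auto
    then have "m dvd 2 * a1" "m dvd 2 * a2" "m dvd 2 * a3" "m dvd 2 * a4"
      unfolding power2_eq_iff by auto
    then have "m dvd 2 * a1 * k1 + 2 * a2 * k2 + 2 * a3 * k3 + 2 * a4 * k4 + m * (k1\<^sup>2 + k2\<^sup>2 + k3\<^sup>2 + k4\<^sup>2) + r"
      using \<open>r = m\<close> by auto
    also have "\<dots> = p" unfolding r_def by (simp add: algebra_simps)
    finally show False using nd by simp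
  qed
  \<comment> \<open>The four terms of Euler's identity after division by \<open>m\<close>.\<close>
  define z1 where "z1 = r + a1 * k1 + a2 * k2 + a3 * k3 + a4 * k4"
  define z2 where "z2 = k1 * a2 - k2 * a1 + k3 * a4 - k4 * a3"
  define z3 where "z3 = k1 * a3 - k3 * a1 + k4 * a2 - k2 * a4"
  define z4 where "z4 = k1 * a4 - k4 * a1 + k2 * a3 - k3 * a2"
  have "m\<^sup>2 * (r * p) = (m * p) * A" using Ar by (simp add: power2_eq_square)
  also have "\<dots> = (x1 * a1 + x2 * a2 + x3 * a3 + x4 * a4)\<^sup>2 + (x1 * a2 - x2 * a1 + x3 * a4 - x4 * a3)\<^sup>2 +
    (x1 * a3 - x3 * a1 + x4 * a2 - x2 * a4)\<^sup>2 + (x1 * a4 - x4 * a1 + x2 * a3 - x3 * a2)\<^sup>2"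
    unfolding x A_def by (rule euler_four_squares)
  also have "x1 * a1 + x2 * a2 + x3 * a3 + x4 * a4 = A + m * (a1 * k1 + a2 * k2 + a3 * k3 + a4 * k4)"
    unfolding a1(1) a2(1) a3(1) a4(1) A_def by (simp add: power2_eq_square algebra_simps)
  also have "\<dots> = m * z1" unfolding Ar z1_def by (simp add: algebra_simps)
  also have "x1 * a2 - x2 * a1 + x3 * a4 - x4 * a3 = m * z2"
    unfolding a1(1) a2(1) a3(1) a4(1) z2_def by (simp add: algebra_simps)
  also have "x1 * a3 - x3 * a1 + x4 * a2 - x2 * a4 = m * z3"
    unfolding a1(1) a2(1) a3(1) a4(1) z3_def by (simp add: algebra_simps)
  also have "x1 * a4 - x4 * a1 + x2 * a3 - x3 * a2 = m * z4"
    unfolding a1(1) a2(1) a3(1) a4(1) z4_def by (simp add: algebra_simps)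
  finally have "m\<^sup>2 * (r * p) = m\<^sup>2 * (z1\<^sup>2 + z2\<^sup>2 + z3\<^sup>2 + z4\<^sup>2)" by (simp add: power_mult_distrib distrib_left)
  then have "r * p = z1\<^sup>2 + z2\<^sup>2 + z3\<^sup>2 + z4\<^sup>2" using assms(2) by simp
  then show ?thesis using \<open>r \<noteq> 0\<close> \<open>r \<noteq> m\<close> r_le r_ge unfolding sum4sq_def by (intro exI[of _ r]) auto
qed

lemma sum4sq_prime:
  fixes p :: int
  assumes "prime p" shows "sum4sq p"
proof (cases "odd p")
  case False
  then have "p = 2" using assms by (metis primes_dvd_imp_eq two_is_prime_nat dvd_refl prime_int_numeral_eq)
  then show ?thesis unfolding sum4sq_def by (intro exI[of _ 1] exI[of _ 0]) auto
next
  case True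
  have p: "p > 1" using assms prime_gt_1_int by blast
  obtain x y where xy: "0 \<le> x" "2 * x < p" "0 \<le> y" "2 * y < p" "p dvd x\<^sup>2 + y\<^sup>2 + 1"
    using prime_dvd_two_squares_plus_one[OF assms True] by blast
  obtain k where k: "x\<^sup>2 + y\<^sup>2 + 1 = p * k" using xy(5) by blast
  have "k > 0" using k p by (smt (verit) zero_le_power2 mult_nonneg_nonpos)
  have "(2 * x)\<^sup>2 < p\<^sup>2" "(2 * y)\<^sup>2 < p\<^sup>2"
    by (intro power_strict_mono; use xy in simp)+
  moreover have "2\<^sup>2 \<le> p\<^sup>2" using p by (intro power_mono) auto
  ultimately have "p * k < p * p" using k by (simp add: power2_eq_square)
  then have "k < p" using p by simp
  have *: "sum4sq p" if "0 < m" "m < p" "sum4sq (m * p)" for m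
    using that
  proof (induction "nat m" arbitrary: m rule: less_induct)
    case less
    show ?case
    proof (cases "m = 1")
      case False
      then obtain r where "0 < r" "r < m" "sum4sq (r * p)"
        using sum4sq_descent[OF assms, of m] less.prems by auto
      then show ?thesis using less by auto
    qed (use less in auto)
  qed
  have "sum4sq (k * p)" unfolding sum4sq_def
    by (rule exI[of _ x], rule exI[of _ y], rule exI[of _ 1], rule exI[of _ 0]) (use k in \<open>simp add: mult.commute\<close>)
  then show ?thesis using * \<open>k > 0\<close> \<open>k < p\<close> by auto
qed

theorem sum4sq_nonneg: "n \<ge> 0 \<Longrightarrow> sum4sq n"
proof (induction "nat n" arbitrary: n rule: less_induct)
  case less
  show ?case
  proof (cases "n \<le> 1")
    case True
    then have "n = 0 \<or> n = 1" using less.prems by auto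
    then show ?thesis unfolding sum4sq_def
      by (elim disjE) (rule exI[of _ n], rule exI[of _ 0], rule exI[of _ 0], rule exI[of _ 0], simp)+
  next
    case False
    then obtain p where p: "prime p" "p dvd n" by (metis prime_factor_int abs_of_nonneg less.prems order_refl)
    then obtain k where k: "n = p * k" by blast
    have "p > 1" using p prime_gt_1_int by blast
    have "k > 0" using k False \<open>p > 1\<close> by (smt (verit) mult_nonneg_nonpos)
    then have "k < n" using k \<open>p > 1\<close> by simp
    then have "sum4sq k" using less.hyps[of k] \<open>k > 0\<close> by auto
    then show ?thesis using k sum4sq_mult sum4sq_prime[OF p(1)] by auto
  qed
qed

section \<open>Eliminating one variable\<close>

text \<open>What the elimination and the reduction use of a field and its integers. Class number 1
  enters as \<open>bezout\<close>. One constant \<open>B\<close> bounds both the rounding error in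
  \<open>cover\<close> and the pieces in \<open>decomp\<close>; the latter expresses an error as few
  bounded elements with natural multiplicities, and it is these multiplicities that are paid
  for.\<close>

locale lattice_order =
  fixes E R :: "complex set" and B :: real
  assumes E_ring: "conj_ring E" and E_inverse: "\<And>x. x \<in> E \<Longrightarrow> inverse x \<in> E"
    and R_ring: "conj_ring R" and R_subset: "R \<subseteq> E"
    and R_real: "\<And>x. x \<in> R \<Longrightarrow> x \<in> \<real> \<Longrightarrow> x \<in> \<int>"
    and denominator: "\<And>x. x \<in> E \<Longrightarrow> \<exists>d::nat. d > 0 \<and> of_nat d * x \<in> R"
    and bezout: "\<And>a b. a \<in> R \<Longrightarrow> b \<in> R \<Longrightarrow>
      \<exists>g\<in>R. \<exists>x\<in>R. \<exists>y\<in>R. \<exists>c\<in>R. \<exists>d\<in>R. g = x * a + y * b \<and> a = g * c \<and> b = g * d"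
    and B_ge_1: "B \<ge> 1"
    and cover: "\<And>z. z \<in> E \<Longrightarrow> \<exists>c\<in>R. cmod (z - c) \<le> B"
    and decomp: "\<And>a. a \<in> R \<Longrightarrow> \<exists>(n::nat \<Rightarrow> nat) \<eta>. (\<forall>t<3. \<eta> t \<in> R \<and> cmod (\<eta> t) \<le> B) \<and>
      a = (\<Sum>t<3. of_nat (n t) * \<eta> t) \<and> real (\<Sum>t<3. n t) \<le> B * (cmod a + 1)"
begin

lemma R_of_int: "of_int k \<in> R"
  using conj_ring_of_nat[OF R_ring] conj_ringD(7)[OF R_ring]
  by (cases k) (auto simp del: of_nat_Suc)

lemma E_of_int: "of_int k \<in> E"
  using R_of_int R_subset by auto

lemma E_divide: "x \<in> E \<Longrightarrow> y \<in> E \<Longrightarrow> x / y \<in> E"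
  using E_inverse conj_ringD(5)[OF E_ring] by (simp add: divide_inverse)

lemma R_norm_ge_1:
  assumes "x \<in> R" "x \<noteq> 0" shows "cmod x \<ge> 1"
proof -
  have "x * cnj x \<in> R" using assms R_ring by (auto intro: conj_ringD)
  moreover have "x * cnj x = of_real ((cmod x)\<^sup>2)" by (metis complex_norm_square of_real_power)
  ultimately have "complex_of_real ((cmod x)\<^sup>2) \<in> \<int>" using R_real Reals_of_real by metis
  then obtain k where "complex_of_real ((cmod x)\<^sup>2) = of_int k" by (elim Ints_cases)
  then have k: "(cmod x)\<^sup>2 = of_int k" by (metis of_real_eq_iff of_real_of_int_eq)
  moreover have "(cmod x)\<^sup>2 > 0" using assms by simp
  ultimately have "(cmod x)\<^sup>2 \<ge> 1" by simp
  then show ?thesis by (metis norm_ge_zero one_power2 power2_le_imp_le)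
qed

text \<open>The number of norms does not depend on \<open>r\<close>; this is the purpose of the four
  squares theorem here.\<close>

lemma norm_sum_multiple:
  assumes "linform R m l" "r \<ge> 0"
  shows "norm_sum R m 4 (\<lambda>x. of_int r * (cmod (l x))\<^sup>2)"
proof -
  obtain a b c d where r: "r = a\<^sup>2 + b\<^sup>2 + c\<^sup>2 + d\<^sup>2"
    using sum4sq_nonneg[OF assms(2)] unfolding sum4sq_def by blast
  have 1: "norm_sum R m 1 (\<lambda>x. of_int (k\<^sup>2) * (cmod (l x))\<^sup>2)" for k :: int
    using norm_sum_single[OF linform_scale[OF R_ring R_of_int[of k] assms(1)]]
    by (simp add: norm_mult power_mult_distrib)
  show ?thesis
    using norm_sum_add[OF norm_sum_add[OF 1[of a] 1[of b]] norm_sum_add[OF 1[of c] 1[of d]]]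
    by (simp add: r algebra_simps eval_nat_numeral)
qed

text \<open>Here \<open>\<rho>\<close> collects the norms that use up the last variable, and
  \<open>\<psi>\<close> is what remains. To bound \<open>\<psi>\<close> from below, evaluate
  \<open>\<phi>\<close> at the last coordinate that makes the main norm in \<open>\<rho>\<close>
  vanish; the other norms have total weight \<open>\<alpha> - s\<^sup>2\<close>, which is only of
  order \<open>sqrt \<alpha>\<close>.\<close>

lemma peel_variable:
  assumes \<phi>: "hform R (Suc m) \<phi>" and N: "Suc m \<le> N"
    and \<alpha>: "\<alpha> = \<phi> (unit_vec m)" "sqrt \<alpha> \<ge> 2 * (2 * B\<^sup>2 * N + 2)"
  shows "\<exists>\<psi> \<rho>. hform R m \<psi> \<and> norm_sum R (Suc m) (12 * N + 5) \<rho> \<and> \<phi> = (\<lambda>x. \<rho> x + \<psi> x) \<and>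
    (\<forall>x. \<exists>z. \<psi> x \<ge> \<phi> (x(m := z)) - 312 * (real N)\<^sup>2 * B^4 * sqrt \<alpha> * (\<Sum>j<m. (cmod (x j))\<^sup>2))"
proof -
  obtain \<alpha>' b \<psi>0 where b: "of_real \<alpha>' \<in> R" "linform R m b" "hform R m \<psi>0"
    "\<phi> = (\<lambda>x. \<alpha>' * (cmod (x m))\<^sup>2 + 2 * Re (x m * cnj (b x)) + \<psi>0 x)" using \<phi> by (rule hform_SucE)
  have "b (unit_vec m) = 0" "\<psi>0 (unit_vec m) = 0"
    using linform_at_zero[OF b(2), of "unit_vec m"] hform_at_zero[OF b(3), of "unit_vec m"] by (auto simp: unit_vec_def)
  then have \<alpha>': "\<alpha>' = \<alpha>" using \<alpha>(1) b(4) by (simp add: unit_vec_def)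
  obtain \<beta> where \<beta>: "\<And>j. j < m \<Longrightarrow> \<beta> j \<in> R" "b = (\<lambda>x. \<Sum>j<m. \<beta> j * x j)" using b(2) unfolding linform_def by blast
  have "complex_of_real \<alpha> \<in> \<int>" using b(1) R_real \<alpha>' Reals_of_real by blast
  then obtain k where "complex_of_real \<alpha> = of_int k" by (elim Ints_cases)
  then have k: "\<alpha> = of_int k" by (metis of_real_eq_iff of_real_of_int_eq)
  \<comment> \<open>The total multiplicity \<open>M\<close> of the error terms will be at most
    \<open>\<kappa> * s\<close>.\<close>
  define \<kappa> where "\<kappa> = 2 * B\<^sup>2 * N"
  have B2: "B\<^sup>2 \<ge> 1" using B_ge_1 by simp
  have N1: "real N \<ge> 1" using N by simp
  have BN: "B\<^sup>2 * N \<ge> 1" using B2 N1 by (metis mult_mono' mult.right_neutral zero_le_one)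
  have \<kappa>: "\<kappa> \<ge> 2" using BN unfolding \<kappa>_def by simp
  have sq: "sqrt \<alpha> \<ge> 2 * (\<kappa> + 2)" using \<alpha>(2) unfolding \<kappa>_def by simp
  have sqpos: "sqrt \<alpha> > 0" by (rule less_le_trans[OF _ sq]) (use \<kappa> in simp)
  then have \<alpha>pos: "\<alpha> > 0" using real_sqrt_gt_0_iff by blast
  then have sq2: "(sqrt \<alpha>)\<^sup>2 = \<alpha>" by simp
  \<comment> \<open>Then \<open>s * (s + \<kappa>) \<le> \<alpha>\<close>, so that
    \<open>\<alpha>\<close> covers the weight \<open>s\<^sup>2\<close> of the main norm and the
    weight \<open>M\<close> of the error terms.\<close>
  define s where "s = \<lfloor>sqrt \<alpha> - \<kappa>\<rfloor>"
  have s: "real_of_int s \<le> sqrt \<alpha> - \<kappa>" "real_of_int s \<ge> sqrt \<alpha> - \<kappa> - 1" unfolding s_def by linarith+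
  have s_half: "real_of_int s \<ge> sqrt \<alpha> / 2" using s(2) sq by simp
  have s1: "real_of_int s \<ge> 1" using s_half sq \<kappa> by simp
  have s_sq: "\<alpha> \<le> 4 * (real_of_int s)\<^sup>2"
  proof -
    have "(sqrt \<alpha> / 2)\<^sup>2 \<le> (real_of_int s)\<^sup>2" using s_half sqpos by (intro power_mono) auto
    then show ?thesis using sq2 by (simp add: power_divide)
  qed
  \<comment> \<open>A first rounding, modulo \<open>\<alpha>\<close>: it corresponds to the shift of
    \<open>x m\<close> by \<open>cf\<close> and makes the row of size \<open>B * \<alpha>\<close>,
    so that the later coefficients \<open>w j\<close> are of size \<open>s\<close>.\<close>
  have "\<exists>c. \<forall>j<m. c j \<in> R \<and> cmod (\<beta> j / of_real \<alpha> - c j) \<le> B"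
  proof -
    have "\<exists>c\<in>R. cmod (\<beta> j / of_real \<alpha> - c) \<le> B" if "j < m" for j
      using \<beta>(1)[OF that] R_subset E_of_int[of k] by (intro cover E_divide) (auto simp: k)
    then show ?thesis by metis
  qed
  then obtain c where c: "\<And>j. j < m \<Longrightarrow> c j \<in> R" "\<And>j. j < m \<Longrightarrow> cmod (\<beta> j / of_real \<alpha> - c j) \<le> B" by blast
  define \<beta>' where "\<beta>' j = \<beta> j - of_real \<alpha> * c j" for j
  have \<alpha>R: "complex_of_real \<alpha> \<in> R" using b(1) \<alpha>' by simp
  have \<beta>'R: "\<beta>' j \<in> R" if "j < m" for j using \<beta>(1) c(1) that \<alpha>R R_ring unfolding \<beta>'_def by (auto intro: conj_ringD)
  have \<beta>'B: "cmod (\<beta>' j) \<le> B * \<alpha>" if "j < m" for j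
  proof -
    have "\<beta>' j = of_real \<alpha> * (\<beta> j / of_real \<alpha> - c j)" using \<alpha>pos unfolding \<beta>'_def by (simp add: algebra_simps)
    then have "cmod (\<beta>' j) = \<alpha> * cmod (\<beta> j / of_real \<alpha> - c j)" using \<alpha>pos by (simp add: norm_mult)
    then show ?thesis using c(2)[OF that] \<alpha>pos by (simp add: mult.commute)
  qed
  \<comment> \<open>A second rounding, modulo \<open>s\<close>: the form \<open>s * z + wf\<close>
    reproduces the reduced row up to errors \<open>e j\<close> of size \<open>s * B\<close>.\<close>
  have "\<exists>w. \<forall>j<m. w j \<in> R \<and> cmod (\<beta>' j / of_int s - w j) \<le> B"
  proof -
    have "\<exists>c\<in>R. cmod (\<beta>' j / of_int s - c) \<le> B" if "j < m" for j
      using \<beta>'R[OF that] R_subset E_of_int[of s] by (intro cover E_divide) auto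
    then show ?thesis by metis
  qed
  then obtain w where w: "\<And>j. j < m \<Longrightarrow> w j \<in> R" "\<And>j. j < m \<Longrightarrow> cmod (\<beta>' j / of_int s - w j) \<le> B" by blast
  define e where "e j = \<beta>' j - of_int s * w j" for j
  have eR: "e j \<in> R" if "j < m" for j unfolding e_def
    by (rule conj_ringD(4)[OF R_ring \<beta>'R conj_ringD(5)[OF R_ring R_of_int w(1)]]) (use that in auto)
  have eB: "cmod (e j) \<le> s * B" if "j < m" for j
  proof -
    have "e j = of_int s * (\<beta>' j / of_int s - w j)" using s1 unfolding e_def by (simp add: algebra_simps)
    then have "cmod (e j) = s * cmod (\<beta>' j / of_int s - w j)" using s1 by (simp add: norm_mult)
    then show ?thesis using w(2)[OF that] s1 by simp
  qed
  define good where "good j n \<eta> \<longleftrightarrow> (\<forall>t<3. \<eta> t \<in> R \<and> cmod (\<eta> t) \<le> B) \<and>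
      e j = (\<Sum>t<3. of_nat (n t) * \<eta> t) \<and> real (\<Sum>t<3. n t) \<le> B * (cmod (e j) + 1)" for j and n :: "nat \<Rightarrow> nat" and \<eta>
  have "\<exists>n \<eta>. good j n \<eta>" if "j < m" for j unfolding good_def by (rule decomp[OF eR[OF that]])
  then obtain n :: "nat \<Rightarrow> nat \<Rightarrow> nat" and \<eta> where good: "\<And>j. j < m \<Longrightarrow> good j (n j) (\<eta> j)" by metis
  have n: "j < m \<Longrightarrow> t < 3 \<Longrightarrow> \<eta> j t \<in> R \<and> cmod (\<eta> j t) \<le> B"
    "j < m \<Longrightarrow> e j = (\<Sum>t<3. of_nat (n j t) * \<eta> j t)"
    "j < m \<Longrightarrow> real (\<Sum>t<3. n j t) \<le> B * (cmod (e j) + 1)" for j t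
    using good[of j] unfolding good_def by blast+
  define M where "M = (\<Sum>j<m. \<Sum>t<3. n j t)"
  have M: "real M \<le> \<kappa> * s"
  proof -
    have "real (\<Sum>t<3. n j t) \<le> 2 * B\<^sup>2 * s" if "j < m" for j
    proof -
      have "real (\<Sum>t<3. n j t) \<le> B * (s * B + 1)"
        using n(3)[OF that] eB[OF that] B_ge_1 by (smt (verit) mult_left_mono)
      also have "\<dots> \<le> B * (s * B + s * B)"
        using s1 B_ge_1 mult_mono[of 1 "real_of_int s" 1 B] by (intro mult_left_mono) (auto simp: mult.commute)
      finally show ?thesis by (simp add: power2_eq_square algebra_simps)
    qed
    then have "(\<Sum>j<m. real (\<Sum>t<3. n j t)) \<le> (\<Sum>j<m. 2 * B\<^sup>2 * s)" by (intro sum_mono) auto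
    also have "\<dots> = m * (2 * B\<^sup>2 * s)" by simp
    also have "\<dots> \<le> N * (2 * B\<^sup>2 * s)" using N s1 by (intro mult_right_mono) auto
    finally show ?thesis unfolding M_def \<kappa>_def by (simp add: algebra_simps)
  qed
  define r where "r = k - s\<^sup>2 - int M"
  have r_real: "real_of_int r = \<alpha> - (real_of_int s)\<^sup>2 - M" unfolding r_def k by simp
  have r: "r \<ge> 0"
  proof -
    have "(real_of_int s)\<^sup>2 + M \<le> s * (s + \<kappa>)" using M by (simp add: power2_eq_square algebra_simps)
    also have "\<dots> \<le> sqrt \<alpha> * sqrt \<alpha>" using s s1 \<kappa> \<alpha>pos by (intro mult_mono) auto
    finally have "real_of_int r \<ge> 0" unfolding r_real using \<alpha>pos by simp
    then show ?thesis by simp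
  qed
  define cf where "cf x = (\<Sum>j<m. c j * x j)" for x :: "nat \<Rightarrow> complex"
  define wf where "wf x = (\<Sum>j<m. w j * x j)" for x :: "nat \<Rightarrow> complex"
  define z where "z x = x m + cf x" for x :: "nat \<Rightarrow> complex"
  \<comment> \<open>Each summand expands into a cross term that is part of an error,
    \<open>n j t\<close> copies of the norm of \<open>z\<close>, and a norm not involving
    \<open>x m\<close>, which \<open>rest\<close> compensates.\<close>
  define \<rho>2 where "\<rho>2 x = (\<Sum>j<m. \<Sum>t<3. of_int (int (n j t)) * (cmod (z x + \<eta> j t * x j))\<^sup>2)" for x
  define \<rho> where "\<rho> x = (cmod (of_int s * z x + wf x))\<^sup>2 + \<rho>2 x + of_int r * (cmod (z x))\<^sup>2" for x
  define rest where "rest x = (\<Sum>j<m. \<Sum>t<3. of_int (int (n j t)) * (cmod (\<eta> j t * x j))\<^sup>2)" for x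
  \<comment> \<open>Given explicitly instead of as \<open>\<phi> - \<rho>\<close>, which makes it
    visible that \<open>x m\<close> has dropped out.\<close>
  define \<psi> where "\<psi> x = \<psi>0 x + \<alpha> * (cmod (cf x))\<^sup>2 - 2 * Re (cf x * cnj (b x)) - (cmod (wf x))\<^sup>2 - rest x" for x
  have lf: "linform R m cf" "linform R m wf" "linform R (Suc m) z"
  proof -
    show 1: "linform R m cf" "linform R m wf" unfolding cf_def wf_def using c(1) w(1) by (auto intro: linformI)
    show "linform R (Suc m) z" unfolding z_def
      using linform_add[OF R_ring linform_coord[OF R_ring, of m "Suc m"] linform_mono[OF R_ring 1(1), of "Suc m"]] by simp
  qed
  have "hform R m rest"
    unfolding rest_def using n(1) conj_ring_of_nat[OF R_ring]
    by (intro hform_sum hform_scale hform_norm linform_scale linform_coord R_ring) auto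
  then have h\<psi>: "hform R m \<psi>" unfolding \<psi>_def using lf b(2,3) \<alpha>R R_ring
    by (intro hform_diff hform_add hform_scale hform_norm hform_Re) auto
  have "norm_sum R (Suc m) (12 * m) \<rho>2"
  proof -
    have "norm_sum R (Suc m) 4 (\<lambda>x. of_int (int (n j t)) * (cmod (z x + \<eta> j t * x j))\<^sup>2)" if "j < m" "t < 3" for j t
      using that n lf(3) by (intro norm_sum_multiple linform_add linform_scale linform_coord R_ring) auto
    then have inner: "norm_sum R (Suc m) (card {..<3::nat} * 4) (\<lambda>x. \<Sum>t<3. of_int (int (n j t)) * (cmod (z x + \<eta> j t * x j))\<^sup>2)" if "j < m" for j
      using that by (intro norm_sum_sum) auto
    have "norm_sum R (Suc m) (card {..<m} * (card {..<3::nat} * 4)) \<rho>2"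
      unfolding \<rho>2_def by (intro norm_sum_sum inner) auto
    then show ?thesis by (simp add: mult.commute)
  qed
  moreover have "norm_sum R (Suc m) 1 (\<lambda>x. (cmod (of_int s * z x + wf x))\<^sup>2)"
    by (intro norm_sum_single linform_add linform_scale R_ring R_of_int lf(3) linform_mono[OF R_ring lf(2)]) auto
  \<comment> \<open>One norm for the rounded row, four for each of the \<open>3 * m\<close> error
    terms, four for the remaining multiple of the norm of \<open>z\<close>.\<close>
  ultimately have "norm_sum R (Suc m) (1 + 12 * m + 4) \<rho>"
    unfolding \<rho>_def using norm_sum_multiple[OF lf(3) r] by (intro norm_sum_add) auto
  then have ns\<rho>: "norm_sum R (Suc m) (12 * N + 5) \<rho>" by (rule norm_sum_pad[OF R_ring]) (use N in auto)
  have bf: "b x = of_real \<alpha> * cf x + (of_int s * wf x + (\<Sum>j<m. e j * x j))" for x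
    unfolding \<beta>(2) cf_def wf_def e_def \<beta>'_def by (simp add: sum_distrib_left sum.distrib[symmetric] sum_subtractf[symmetric] algebra_simps)
  have \<rho>2: "\<rho>2 x = M * (cmod (z x))\<^sup>2 + 2 * Re (z x * cnj (\<Sum>j<m. e j * x j)) + rest x" for x
  proof -
    have "\<rho>2 x = (\<Sum>j<m. \<Sum>t<3. real (n j t) * (cmod (z x))\<^sup>2) +
        (\<Sum>j<m. \<Sum>t<3. 2 * Re (z x * cnj (of_nat (n j t) * \<eta> j t * x j))) + rest x"
      unfolding \<rho>2_def rest_def sum.distrib[symmetric] by (intro sum.cong refl) (simp add: cmod_add_square algebra_simps)
    also have "(\<Sum>j<m. \<Sum>t<3. real (n j t) * (cmod (z x))\<^sup>2) = M * (cmod (z x))\<^sup>2"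
      unfolding M_def by (simp add: sum_distrib_right)
    also have "(\<Sum>j<m. \<Sum>t<3. 2 * Re (z x * cnj (of_nat (n j t) * \<eta> j t * x j))) = 2 * Re (z x * cnj (\<Sum>j<m. \<Sum>t<3. of_nat (n j t) * \<eta> j t * x j))"
      by (simp only: cnj_sum sum_distrib_left Re_sum)
    also have "(\<Sum>j<m. \<Sum>t<3. of_nat (n j t) * \<eta> j t * x j) = (\<Sum>j<m. e j * x j)"
      by (intro sum.cong refl) (simp add: n(2) sum_distrib_right)
    finally show ?thesis .
  qed
  have \<phi>eq: "\<phi> x = \<rho> x + \<psi> x" for x
  proof -
    have xm: "x m = z x - cf x" unfolding z_def by simp
    define f where "f = (\<Sum>j<m. e j * x j)"
    show ?thesis
      unfolding \<rho>_def \<psi>_def \<rho>2 b(4) \<alpha>' r_real xm f_def[symmetric] bf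
      unfolding cmod_power2 by (simp add: power2_eq_square algebra_simps)
  qed
  have "\<exists>y. \<psi> x \<ge> \<phi> (x(m := y)) - 312 * (real N)\<^sup>2 * B^4 * sqrt \<alpha> * (\<Sum>j<m. (cmod (x j))\<^sup>2)" for x
  proof -
    define S where "S = (\<Sum>j<m. (cmod (x j))\<^sup>2)"
    have S0: "S \<ge> 0" unfolding S_def by (auto intro: sum_nonneg)
    \<comment> \<open>The value of \<open>z\<close> at which \<open>s * z + wf\<close>
      vanishes.\<close>
    define \<zeta> where "\<zeta> = - wf x / of_int s"
    define y where "y = x(m := \<zeta> - cf x)"
    have wz: "wf y = wf x" "cf y = cf x" "\<psi> y = \<psi> x"
      by (rule linform_cong[OF lf(2)] linform_cong[OF lf(1)] hform_cong[OF h\<psi>]; simp add: y_def)+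
    have zy: "z y = \<zeta>" unfolding z_def wz by (simp add: y_def)
    \<comment> \<open>The 5 is 4 from \<open>\<alpha> \<le> 4 * s\<^sup>2\<close>, applied to the
      reduced row, plus 1 from the rounding.\<close>
    have w5: "cmod (w j) / s \<le> 5 * B" if "j < m" for j
    proof -
      have "w j = \<beta>' j / of_int s - (\<beta>' j / of_int s - w j)" by simp
      then have "cmod (w j) \<le> cmod (\<beta>' j / of_int s) + cmod (\<beta>' j / of_int s - w j)" by (metis norm_triangle_ineq4)
      also have "\<dots> \<le> B * \<alpha> / s + B" using w(2)[OF that] \<beta>'B[OF that] s1
        by (intro add_mono) (auto simp: norm_divide divide_right_mono)
      also have "\<dots> \<le> B * (4 * s\<^sup>2) / s + B * s" using s_sq s1 B_ge_1
        by (intro add_mono divide_right_mono mult_left_mono) auto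
      also have "\<dots> = 5 * B * s" using s1 by (simp add: power2_eq_square)
      finally show ?thesis using s1 by (simp add: divide_le_eq)
    qed
    have "cmod \<zeta> \<le> 5 * B * (\<Sum>j<m. cmod (x j))"
    proof -
      have "cmod \<zeta> = cmod (wf x) / s" using s1 unfolding \<zeta>_def by (simp add: norm_divide)
      also have "\<dots> \<le> (\<Sum>j<m. cmod (w j * x j)) / s" unfolding wf_def using s1
        by (intro divide_right_mono norm_sum) auto
      also have "\<dots> = (\<Sum>j<m. cmod (w j) / s * cmod (x j))" by (simp add: sum_divide_distrib norm_mult)
      also have "\<dots> \<le> (\<Sum>j<m. 5 * B * cmod (x j))" by (intro sum_mono mult_right_mono w5) auto
      finally show ?thesis by (simp add: sum_distrib_left)
    qed
    then have "(cmod \<zeta>)\<^sup>2 \<le> (5 * B * (\<Sum>j<m. cmod (x j)))\<^sup>2" by (intro power_mono) auto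
    also have "\<dots> = 25 * B\<^sup>2 * (\<Sum>j<m. cmod (x j))\<^sup>2" by (simp add: power_mult_distrib)
    also have "\<dots> \<le> 25 * B\<^sup>2 * (S * card {..<m})"
      unfolding S_def by (intro mult_left_mono sum_squared_le_sum_of_squares) auto
    also have "\<dots> \<le> 25 * B\<^sup>2 * (S * N)" using S0 N by (intro mult_left_mono) auto
    finally have \<zeta>: "(cmod \<zeta>)\<^sup>2 \<le> 25 * B\<^sup>2 * (S * N)" .
    \<comment> \<open>The 52 is \<open>2 * 25 + 2\<close>, from
      \<open>(a + b)\<^sup>2 \<le> 2 * a\<^sup>2 + 2 * b\<^sup>2\<close> and the bound 25 for
      \<open>\<zeta>\<close>.\<close>
    define Q where "Q = 52 * N * B\<^sup>2 * S"
    have BSN: "B\<^sup>2 * S \<le> B\<^sup>2 * (S * N)" using S0 N1 by (intro mult_left_mono) (auto simp: mult_le_cancel_left1)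
    have "0 \<le> B\<^sup>2 * (S * N)" "Q = 52 * (B\<^sup>2 * (S * N))" unfolding Q_def using S0 by simp_all
    then have Q1: "(cmod \<zeta>)\<^sup>2 \<le> Q" using \<zeta> by linarith
    have Q2: "(cmod (\<zeta> + \<eta> j t * x j))\<^sup>2 \<le> Q" if "j < m" "t < 3" for j t
    proof -
      have "cmod (\<zeta> + \<eta> j t * x j) \<le> cmod \<zeta> + cmod (\<eta> j t * x j)" by (rule norm_triangle_ineq)
      then have "(cmod (\<zeta> + \<eta> j t * x j))\<^sup>2 \<le> (cmod \<zeta> + cmod (\<eta> j t * x j))\<^sup>2" by (intro power_mono) auto
      also have "\<dots> \<le> 2 * (cmod \<zeta>)\<^sup>2 + 2 * (cmod (\<eta> j t * x j))\<^sup>2"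
        by (smt (verit) sum_squares_bound power2_sum)
      also have "(cmod (\<eta> j t * x j))\<^sup>2 \<le> B\<^sup>2 * S"
      proof -
        have "(cmod (x j))\<^sup>2 \<le> S" unfolding S_def using that by (intro member_le_sum) auto
        moreover have "(cmod (\<eta> j t))\<^sup>2 \<le> B\<^sup>2" using n(1)[OF that] by (intro power_mono) auto
        ultimately show ?thesis unfolding norm_mult power_mult_distrib by (intro mult_mono) auto
      qed
      finally show ?thesis using \<zeta> BSN unfolding Q_def by (simp add: algebra_simps)
    qed
    have "\<rho>2 y \<le> (\<Sum>j<m. \<Sum>t<3. real (n j t) * Q)"
      unfolding \<rho>2_def zy by (intro sum_mono) (auto simp: y_def intro!: mult_left_mono Q2)
    also have "\<dots> = M * Q" unfolding M_def by (simp add: sum_distrib_right)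
    finally have "\<rho>2 y \<le> M * Q" .
    moreover have "of_int r * (cmod (z y))\<^sup>2 \<le> of_int r * Q" using Q1 r unfolding zy by (intro mult_left_mono) auto
    moreover have "of_int s * z y + wf y = 0" unfolding zy wz \<zeta>_def using s1 by simp
    ultimately have "\<rho> y \<le> (M + of_int r) * Q" unfolding \<rho>_def by (simp add: algebra_simps)
    \<comment> \<open>The first factor is at most
      \<open>\<kappa> + 1 \<le> 3 * B\<^sup>2 * N\<close>, the second at most
      \<open>2 * sqrt \<alpha>\<close>; with the 52 in \<open>Q\<close> this gives 312.\<close>
    also have "M + of_int r = (sqrt \<alpha> - s) * (sqrt \<alpha> + s)" using r_real \<alpha>pos by (simp add: power2_eq_square algebra_simps)
    also have "\<dots> * Q \<le> (3 * B\<^sup>2 * N) * (2 * sqrt \<alpha>) * Q"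
    proof -
      have "sqrt \<alpha> - s \<le> 3 * B\<^sup>2 * N" using s(2) BN unfolding \<kappa>_def by simp
      moreover have "sqrt \<alpha> + s \<le> 2 * sqrt \<alpha>" using s(1) \<kappa> by simp
      moreover have "Q \<ge> 0" unfolding Q_def using S0 by simp
      ultimately show ?thesis using s1 sqpos BN by (intro mult_right_mono mult_mono) auto
    qed
    also have "\<dots> = 312 * (real N)\<^sup>2 * B^4 * sqrt \<alpha> * S"
      unfolding Q_def by (simp add: power2_eq_square power4_eq_xxxx algebra_simps)
    finally have "\<rho> y \<le> 312 * (real N)\<^sup>2 * B^4 * sqrt \<alpha> * S" .
    then have "\<psi> x \<ge> \<phi> y - 312 * (real N)\<^sup>2 * B^4 * sqrt \<alpha> * S" using \<phi>eq[of y] wz(3) by simp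
    then show ?thesis unfolding S_def y_def by blast
  qed
  then show ?thesis using h\<psi> ns\<rho> \<phi>eq by (intro exI[of _ \<psi>] exI[of _ \<rho>]) auto
qed

end

section \<open>Reduction of positive forms\<close>

lemma linform_hom: "linform S m l \<Longrightarrow> l (\<lambda>j. c * x j) = c * l x"
  unfolding linform_def by (auto simp: sum_distrib_left algebra_simps)

lemma linform_if:
  "(P \<Longrightarrow> linform S m f) \<Longrightarrow> (\<not> P \<Longrightarrow> linform S m g) \<Longrightarrow> linform S m (\<lambda>x. if P then f x else g x)"
  by (cases P) auto

lemma tricoord_hom: "tricoord u i (\<lambda>j. c * x j) = c * tricoord u i x"
  unfolding tricoord_def by (simp add: sum_distrib_left algebra_simps)

lemma triform_hom: "triform h u m (\<lambda>j. c * x j) = (cmod c)\<^sup>2 * triform h u m x"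
  unfolding triform_def tricoord_hom by (simp add: norm_mult power_mult_distrib sum_distrib_left algebra_simps)

lemma triform_upd: "k \<le> m \<Longrightarrow> triform (h(m := a)) (u(m := r)) k = triform h u k"
  unfolding triform_def tricoord_def by (auto simp: fun_eq_iff intro!: sum.cong)

lemma tricoord_upd: "i \<noteq> m \<Longrightarrow> tricoord (u(m := r)) i = tricoord u i"
  unfolding tricoord_def by auto

lemma tricoord_unit_vec: "i \<le> m \<Longrightarrow> tricoord u i (unit_vec m) = (if i = m then 1 else 0)"
  unfolding tricoord_def unit_vec_def by (auto intro!: sum.neutral)

lemma triform_unit_vec: "triform h u m (unit_vec m) = 0"
  unfolding triform_def by (auto simp: tricoord_unit_vec intro!: sum.neutral)

lemma triform_nonneg: "(\<And>i. i < m \<Longrightarrow> h i \<ge> 0) \<Longrightarrow> triform h u m x \<ge> 0"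
  unfolding triform_def by (auto intro!: sum_nonneg)

lemma triform_fun_upd: "triform h u m (x(m := z)) = triform h u m x"
  by (rule triform_cong) auto

text \<open>Tested at vectors over \<open>S\<close> only: what is available is a lower bound at
  integral vectors, and clearing denominators carries it to the field, not to all complex
  vectors.\<close>

definition positive_on :: "complex set \<Rightarrow> nat \<Rightarrow> ((nat \<Rightarrow> complex) \<Rightarrow> real) \<Rightarrow> bool" where
  "positive_on S m \<phi> \<longleftrightarrow> (\<forall>x. (\<forall>i. x i \<in> S) \<longrightarrow> (\<exists>i<m. x i \<noteq> 0) \<longrightarrow> \<phi> x > 0)"

context lattice_order
begin

text \<open>The invariant keeps the remaining form between \<open>triform h u m\<close> and a
  multiple of it. Each elimination may lower this multiple by \<open>1 / (2 * N)\<close>; as there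
  are at most \<open>N\<close> of them, it never falls below \<open>1 / 2\<close>, and every leading
  coefficient stays comparable to its \<open>h\<close>.\<close>

lemma norm_sum_of_triform_bounds:
  assumes M: "M \<le> N" "0 < N" and P: "P \<ge> 0"
    and h: "\<And>k. k < M \<Longrightarrow> h k \<ge> 2 * (2 * (2 * B\<^sup>2 * N + 2))\<^sup>2"
    and P_bound: "\<And>k x. k \<le> M \<Longrightarrow> (\<Sum>j<k. (cmod (x j))\<^sup>2) \<le> P * (\<Sum>j<k. (cmod (tricoord u j x))\<^sup>2)"
    and D: "\<And>j k. j < k \<Longrightarrow> k < M \<Longrightarrow> 624 * (real N)^3 * B^4 * P * sqrt (h k) \<le> h j"
  shows "m \<le> M \<Longrightarrow> hform R m \<phi> \<Longrightarrow> (\<And>x. \<phi> x \<le> triform h u m x) \<Longrightarrow>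
    (\<And>x. (1/2 + real m / (2 * real N)) * triform h u m x \<le> \<phi> x) \<Longrightarrow> norm_sum R m (m * (12 * N + 5)) \<phi>"
proof (induction m arbitrary: \<phi>)
  case 0
  then show ?case by (auto intro: norm_sum.zero)
next
  case (Suc m)
  define \<alpha> where "\<alpha> = \<phi> (unit_vec m)"
  have tu: "triform h u (Suc m) (unit_vec m) = h m" by (simp add: triform_Suc triform_unit_vec tricoord_unit_vec)
  have hm: "h m \<ge> 2 * (2 * (2 * B\<^sup>2 * N + 2))\<^sup>2" using h Suc.prems by auto
  have hpos: "h m \<ge> 0" by (rule order_trans[OF _ hm]) simp
  have \<alpha>: "\<alpha> \<le> h m" "h m / 2 \<le> \<alpha>"
  proof -
    show "\<alpha> \<le> h m" using Suc.prems(3)[of "unit_vec m"] tu unfolding \<alpha>_def by simp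
    have "(1/2) * h m \<le> (1/2 + real (Suc m) / (2 * real N)) * h m" using hpos by (intro mult_right_mono) auto
    also have "\<dots> \<le> \<alpha>" using Suc.prems(4)[of "unit_vec m"] tu unfolding \<alpha>_def by simp
    finally show "h m / 2 \<le> \<alpha>" by simp
  qed
  \<comment> \<open>The factor 2 in the hypothesis on \<open>h\<close> makes up for
    \<open>\<alpha>\<close> being only at least \<open>h m / 2\<close>.\<close>
  have "2 * (2 * B\<^sup>2 * N + 2) \<le> sqrt \<alpha>" using hm \<alpha> by (intro real_le_rsqrt) simp
  then obtain \<psi> \<rho> where \<psi>: "hform R m \<psi>" "norm_sum R (Suc m) (12 * N + 5) \<rho>" "\<phi> = (\<lambda>x. \<rho> x + \<psi> x)"
    "\<And>x. \<exists>z. \<psi> x \<ge> \<phi> (x(m := z)) - 312 * (real N)\<^sup>2 * B^4 * sqrt \<alpha> * (\<Sum>j<m. (cmod (x j))\<^sup>2)"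
    using peel_variable[OF Suc.prems(2) _ \<alpha>_def, of N] Suc.prems(1) M(1) by fastforce
  have up: "\<psi> x \<le> triform h u m x" for x
  proof -
    \<comment> \<open>This choice makes \<open>tricoord u m\<close> vanish, so the last term of the
      triangular form drops out.\<close>
    define y where "y = x(m := - (\<Sum>j<m. u m j * x j))"
    have "\<psi> x = \<psi> y" by (rule hform_cong[OF \<psi>(1)]) (simp add: y_def)
    also have "\<dots> \<le> \<phi> y" using norm_sum_nonneg[OF \<psi>(2)] \<psi>(3) by simp
    also have "\<dots> \<le> triform h u (Suc m) y" by (rule Suc.prems)
    also have "\<dots> = triform h u m x" by (simp add: triform_Suc y_def triform_fun_upd tricoord_def)
    finally show ?thesis .
  qed
  have tnn: "triform h u m x \<ge> 0" for x
  proof -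
    have "h i \<ge> 0" if "i < m" for i
      by (rule order_trans[OF _ h[of i]]) (use that Suc.prems(1) in auto)
    then show ?thesis by (rule triform_nonneg)
  qed
  have low: "(1/2 + real m / (2 * real N)) * triform h u m x \<le> \<psi> x" for x
  proof -
    obtain z where z: "\<psi> x \<ge> \<phi> (x(m := z)) - 312 * (real N)\<^sup>2 * B^4 * sqrt \<alpha> * (\<Sum>j<m. (cmod (x j))\<^sup>2)"
      using \<psi>(4) by blast
    \<comment> \<open>The share \<open>1 / (2 * N)\<close> set apart here absorbs the loss in
      \<open>peel_variable\<close>.\<close>
    have coef: "1/2 + real (Suc m) / (2 * real N) = (1/2 + real m / (2 * real N)) + 1 / (2 * real N)" by (simp add: add_divide_distrib)
    have "(1/2 + real (Suc m) / (2 * real N)) * triform h u m x \<le> (1/2 + real (Suc m) / (2 * real N)) * triform h u (Suc m) (x(m := z))"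
      using hpos by (intro mult_left_mono) (auto simp: triform_Suc triform_fun_upd)
    also have "\<dots> \<le> \<phi> (x(m := z))" by (rule Suc.prems)
    finally have 1: "(1/2 + real m / (2 * real N)) * triform h u m x + 1 / (2 * real N) * triform h u m x \<le> \<phi> (x(m := z))"
      unfolding coef by (simp add: distrib_right)
    have "312 * (real N)\<^sup>2 * B^4 * sqrt \<alpha> * (\<Sum>j<m. (cmod (x j))\<^sup>2)
      \<le> 312 * (real N)\<^sup>2 * B^4 * sqrt (h m) * (P * (\<Sum>j<m. (cmod (tricoord u j x))\<^sup>2))"
      using \<alpha> hpos B_ge_1 P_bound[of m x] Suc.prems(1) \<alpha>(2)
      by (intro mult_mono mult_left_mono) (auto intro!: sum_nonneg)
    also have "\<dots> = (\<Sum>j<m. (312 * (real N)\<^sup>2 * B^4 * P * sqrt (h m)) * (cmod (tricoord u j x))\<^sup>2)"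
      by (simp add: sum_distrib_left algebra_simps)
    also have "\<dots> \<le> (\<Sum>j<m. h j / (2 * real N) * (cmod (tricoord u j x))\<^sup>2)"
    proof (intro sum_mono mult_right_mono)
      fix j assume "j \<in> {..<m}"
      then have "624 * (real N)^3 * B^4 * P * sqrt (h m) \<le> h j" using D[of j m] Suc.prems(1) by auto
      then show "312 * (real N)\<^sup>2 * B^4 * P * sqrt (h m) \<le> h j / (2 * real N)"
        using M(2) by (simp add: field_simps power2_eq_square power3_eq_cube)
    qed auto
    also have "\<dots> = 1 / (2 * real N) * triform h u m x" unfolding triform_def by (simp add: sum_distrib_left)
    finally show ?thesis using z 1 by linarith
  qed
  have "norm_sum R m (m * (12 * N + 5)) \<psi>" by (rule Suc.IH[OF _ \<psi>(1) up low]) (use Suc.prems in auto)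
  then have "norm_sum R (Suc m) (m * (12 * N + 5)) \<psi>" by (rule norm_sum_mono[OF R_ring]) auto
  then have "norm_sum R (Suc m) ((12 * N + 5) + m * (12 * N + 5)) (\<lambda>x. \<rho> x + \<psi> x)"
    by (rule norm_sum_add[OF _ \<psi>(2)])
  then show ?case unfolding \<psi>(3) by simp
qed

text \<open>Here \<open>g\<close> is a greatest common divisor of the entries, built up by Bezout
  one entry at a time. Each step composes with a two-dimensional substitution of determinant 1, so
  the primitive vector \<open>v / g\<close> becomes the last basis vector.\<close>

lemma unimod_completion:
  assumes "\<And>i. v i \<in> R"
  shows "\<exists>T T' g. unimod R (Suc m) T T' \<and> g \<in> R \<and> (\<forall>i<Suc m. v i = g * T (unit_vec m) i)"
proof (induction m)
  case 0
  show ?case by (rule exI[of _ "\<lambda>x. x"], rule exI[of _ "\<lambda>x. x"], rule exI[of _ "v 0"])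
    (auto simp: unimod_id R_ring assms unit_vec_def)
next
  case (Suc m)
  then obtain T T' g where T: "unimod R (Suc m) T T'" "g \<in> R" "\<And>i. i < Suc m \<Longrightarrow> v i = g * T (unit_vec m) i" by blast
  obtain d x y c c' where d: "d \<in> R" "x \<in> R" "y \<in> R" "c \<in> R" "c' \<in> R"
    "d = x * g + y * v (Suc m)" "g = d * c" "v (Suc m) = d * c'"
    using bezout[OF T(2) assms[of "Suc m"]] by blast
  show ?case
  \<comment> \<open>If \<open>d = 0\<close>, then all entries considered so far vanish, and
    \<open>g = 0\<close> with the identity will do.\<close>
  proof (cases "d = 0")
    case True
    then have "v (Suc m) = 0" "g = 0" using d(7,8) by auto
    then have "\<forall>i<Suc (Suc m). v i = 0" using T(3) by (metis less_antisym mult_zero_left)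
    then show ?thesis using conj_ringD(1)[OF R_ring] unimod_id[OF R_ring, of "Suc (Suc m)"]
      by (intro exI[of _ "\<lambda>x. x"] exI[of _ "0::complex"]) auto
  next
    case False
    have "d = d * (x * c + y * c')" using d(6) unfolding d(7,8) by (simp add: algebra_simps)
    then have det: "x * c + y * c' = 1" using False by simp
    \<comment> \<open>Its determinant is \<open>x * c + y * c' = 1\<close>, and it sends
      \<open>unit_vec (Suc m)\<close> to the vector with entries \<open>c\<close> and
      \<open>c'\<close>.\<close>
    define S where "S z = z(m := y * z m + c * z (Suc m), Suc m := c' * z (Suc m) - x * z m)" for z :: "nat \<Rightarrow> complex"
    define S' where "S' z = z(m := c' * z m - c * z (Suc m), Suc m := x * z m + y * z (Suc m))" for z :: "nat \<Rightarrow> complex"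
    have lin: "int_subst R (Suc (Suc m)) S" "int_subst R (Suc (Suc m)) S'"
      unfolding int_subst_def S_def S'_def using d(2-5)
      by (auto simp: fun_upd_def intro!: linform_if linform_add linform_diff linform_scale linform_coord R_ring)
    have inv: "S (S' z) = z" "S' (S z) = z" for z
    proof -
      have "y * (c' * p - c * q) + c * (x * p + y * q) = p" "c' * (x * p + y * q) - x * (c' * p - c * q) = q"
        "c' * (y * p + c * q) - c * (c' * q - x * p) = p" "x * (y * p + c * q) + y * (c' * q - x * p) = q" for p q
        using arg_cong[OF det, of "\<lambda>t. t * p"] arg_cong[OF det, of "\<lambda>t. t * q"] by (simp_all add: algebra_simps)
      then show "S (S' z) = z" "S' (S z) = z" unfolding S_def S'_def by (auto simp: fun_eq_iff)
    qed
    have S: "unimod R (Suc (Suc m)) S S'" unfolding unimod_def using lin inv by auto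
    have TS: "unimod R (Suc (Suc m)) (\<lambda>z. T (S z)) (\<lambda>z. S' (T' z))"
      by (rule unimod_comp[OF R_ring unimod_Suc[OF R_ring T(1)] S])
    have "v i = d * T (S (unit_vec (Suc m))) i" if i: "i < Suc (Suc m)" for i
    proof (cases "i < Suc m")
      case True
      then have l: "linform R (Suc m) (\<lambda>z. T z i)" using T(1) unfolding unimod_def int_subst_def by auto
      have "T (S (unit_vec (Suc m))) i = T (\<lambda>j. c * unit_vec m j) i"
        by (rule linform_cong[OF l]) (auto simp: S_def unit_vec_def)
      also have "\<dots> = c * T (unit_vec m) i" by (rule linform_hom[OF l])
      finally show ?thesis using T(3)[OF True] d(7) by simp
    next
      case False
      then have "i = Suc m" using i by simp
      then have "T (S (unit_vec (Suc m))) i = S (unit_vec (Suc m)) i" using T(1) unfolding unimod_def int_subst_def by auto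
      then show ?thesis using d(8) \<open>i = Suc m\<close> by (simp add: S_def unit_vec_def)
    qed
    then show ?thesis using TS d(1) by blast
  qed
qed

lemma complete_square:
  assumes "hform E (Suc m) \<phi>" "positive_on E (Suc m) \<phi>"
  shows "\<exists>\<alpha> c \<psi>. \<alpha> > 0 \<and> of_real \<alpha> \<in> E \<and> linform E m c \<and> hform E m \<psi> \<and> positive_on E m \<psi> \<and>
    (\<forall>x. \<phi> x = \<psi> x + \<alpha> * (cmod (x m + c x))\<^sup>2)"
proof -
  obtain \<alpha> b \<psi> where b: "of_real \<alpha> \<in> E" "linform E m b" "hform E m \<psi>"
    "\<phi> = (\<lambda>x. \<alpha> * (cmod (x m))\<^sup>2 + 2 * Re (x m * cnj (b x)) + \<psi> x)" using assms(1) by (rule hform_SucE)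
  have "b (unit_vec m) = 0" "\<psi> (unit_vec m) = 0"
    using linform_at_zero[OF b(2), of "unit_vec m"] hform_at_zero[OF b(3), of "unit_vec m"] by (auto simp: unit_vec_def)
  then have "\<alpha> = \<phi> (unit_vec m)" unfolding b(4) by (simp add: unit_vec_def)
  moreover have "\<phi> (unit_vec m) > 0" using assms(2) conj_ringD(1,2)[OF E_ring] unfolding positive_on_def
    by (metis lessI unit_vec_def zero_neq_one)
  ultimately have \<alpha>: "\<alpha> > 0" by simp
  define c where "c x = of_real (1 / \<alpha>) * b x" for x
  define \<psi>' where "\<psi>' x = \<psi> x - (1 / \<alpha>) * (cmod (b x))\<^sup>2" for x
  have inv: "complex_of_real (1 / \<alpha>) \<in> E" using E_inverse[OF b(1)] by (simp add: divide_inverse)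
  have c: "linform E m c" unfolding c_def by (rule linform_scale[OF E_ring inv b(2)])
  have \<psi>': "hform E m \<psi>'" unfolding \<psi>'_def
    by (intro hform_diff hform_scale hform_norm E_ring b inv)
  have eq: "\<phi> x = \<psi>' x + \<alpha> * (cmod (x m + c x))\<^sup>2" for x
  proof -
    have "(cmod (c x))\<^sup>2 = (1 / \<alpha>)\<^sup>2 * (cmod (b x))\<^sup>2"
      unfolding c_def norm_mult power_mult_distrib by (simp add: norm_divide power_divide)
    then have 1: "(1 / \<alpha>) * (cmod (b x))\<^sup>2 = \<alpha> * (cmod (c x))\<^sup>2" using \<alpha> by (simp add: power2_eq_square)
    have "b x = of_real \<alpha> * c x" using \<alpha> by (simp add: c_def)
    then have 2: "Re (x m * cnj (b x)) = \<alpha> * Re (x m * cnj (c x))" by (simp add: algebra_simps)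
    have "a * X + 2 * (a * Y) + W = W - a * Z + a * (X + 2 * Y + Z)" for a X Y Z W :: real
      by (simp add: algebra_simps)
    then show ?thesis unfolding b(4) \<psi>'_def cmod_add_square 1 2 .
  qed
  have "positive_on E m \<psi>'" unfolding positive_on_def
  proof (intro allI impI)
    fix x :: "nat \<Rightarrow> complex" assume x: "\<forall>i. x i \<in> E" "\<exists>i<m. x i \<noteq> 0"
    \<comment> \<open>The square vanishes at \<open>y\<close>, so positivity of
      \<open>\<phi>\<close> there is positivity of \<open>\<psi>'\<close> at
      \<open>x\<close>.\<close>
    define y where "y = x(m := - c x)"
    have "c x \<in> E" by (rule linform_mem[OF E_ring c]) (use x in auto)
    then have "\<forall>i. y i \<in> E" using x(1) E_ring by (auto simp: y_def conj_ringD)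
    moreover have "\<exists>i<Suc m. y i \<noteq> 0" using x(2) unfolding y_def by (metis fun_upd_other less_SucI less_irrefl)
    ultimately have "\<phi> y > 0" using assms(2) unfolding positive_on_def by blast
    moreover have "\<psi>' y = \<psi>' x" "c y = c x"
      by (rule hform_cong[OF \<psi>'] linform_cong[OF c]; simp add: y_def)+
    ultimately show "\<psi>' x > 0" using eq[of y] by (simp add: y_def)
  qed
  then show ?thesis using \<alpha> b(1) c \<psi>' eq by blast
qed

lemma lagrange_decomposition:
  "hform E m \<phi> \<Longrightarrow> positive_on E m \<phi> \<Longrightarrow>
   \<exists>h u. (\<forall>i j. u i j \<in> E) \<and> (\<forall>i<m. h i > 0 \<and> of_real (h i) \<in> E) \<and> \<phi> = triform h u m"
proof (induction m arbitrary: \<phi>)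
  case 0
  then show ?case using conj_ringD(1)[OF E_ring]
    by (intro exI[of _ "\<lambda>_. 0"] exI[of _ "\<lambda>_ _. 0"]) (auto simp: triform_def fun_eq_iff)
next
  case (Suc m)
  obtain \<alpha> c \<psi> where c: "\<alpha> > 0" "of_real \<alpha> \<in> E" "linform E m c" "hform E m \<psi>" "positive_on E m \<psi>"
    "\<And>x. \<phi> x = \<psi> x + \<alpha> * (cmod (x m + c x))\<^sup>2" using complete_square[OF Suc.prems] by blast
  obtain h u where hu: "\<forall>i j. u i j \<in> E" "\<forall>i<m. h i > 0 \<and> of_real (h i) \<in> E" "\<psi> = triform h u m"
    using Suc.IH[OF c(4,5)] by blast
  obtain \<gamma> where \<gamma>: "\<forall>j<m. \<gamma> j \<in> E" "c = (\<lambda>x. \<Sum>j<m. \<gamma> j * x j)" using c(3) unfolding linform_def by blast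
  define r where "r j = (if j < m then \<gamma> j else 0)" for j
  have "tricoord (u(m := r)) m x = x m + c x" for x unfolding tricoord_def \<gamma>(2) r_def by simp
  then have "\<phi> x = triform (h(m := \<alpha>)) (u(m := r)) (Suc m) x" for x
    unfolding triform_Suc c(6) hu(3) by (simp add: triform_upd)
  moreover have "\<forall>i j. (u(m := r)) i j \<in> E" using hu(1) \<gamma>(1) conj_ringD(1)[OF E_ring] by (auto simp: r_def)
  moreover have "\<forall>i<Suc m. (h(m := \<alpha>)) i > 0 \<and> of_real ((h(m := \<alpha>)) i) \<in> E" using hu(2) c(1,2) by (auto simp: less_Suc_eq)
  ultimately show ?case by blast
qed

text \<open>A vector within a factor 2 of a positive infimum always exists, and this factor merely
  enters the constants of the reduction; attainment of the minimum is thus avoided.\<close>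

lemma near_minimum:
  assumes h: "\<And>i. i < m \<Longrightarrow> h i > 0" and m: "0 < m"
  shows "\<exists>b. (\<forall>i. b i \<in> R) \<and> (\<exists>i<m. b i \<noteq> 0) \<and>
    (\<forall>x. (\<forall>i. x i \<in> R) \<longrightarrow> (\<exists>i<m. x i \<noteq> 0) \<longrightarrow> triform h u m b \<le> 2 * triform h u m x)"
proof -
  define V where "V = {x. (\<forall>i. x i \<in> R) \<and> (\<exists>i<m. x i \<noteq> 0)}"
  define \<mu> where "\<mu> = Min (h ` {..<m})"
  have \<mu>: "\<mu> > 0" unfolding \<mu>_def using h m by (subst Min_gr_iff) auto
  have low: "\<mu> \<le> triform h u m x" if "x \<in> V" for x
  proof -
    \<comment> \<open>At the lowest nonzero entry the triangular coordinate is this entry itself, an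
      integral element of absolute value at least 1.\<close>
    define i where "i = (LEAST i. x i \<noteq> 0)"
    obtain k where k: "k < m" "x k \<noteq> 0" using \<open>x \<in> V\<close> unfolding V_def by blast
    have i: "x i \<noteq> 0" "i \<le> k" "\<And>j. j < i \<Longrightarrow> x j = 0"
      unfolding i_def using LeastI[of "\<lambda>i. x i \<noteq> 0" k] Least_le[of "\<lambda>i. x i \<noteq> 0" k] not_less_Least[of _ "\<lambda>i. x i \<noteq> 0"] k
      by blast+
    have im: "i < m" using i k by simp
    have "tricoord u i x = x i" unfolding tricoord_def using i(3) by simp
    moreover have "cmod (x i) \<ge> 1" using R_norm_ge_1 i(1) that unfolding V_def by blast
    ultimately have "1 \<le> (cmod (tricoord u i x))\<^sup>2" by simp
    then have "h i \<le> h i * (cmod (tricoord u i x))\<^sup>2" using h[OF im] by simp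
    also have "\<dots> \<le> triform h u m x" unfolding triform_def
      by (rule member_le_sum) (use im h in \<open>auto simp: less_imp_le\<close>)
    finally have "h i \<le> triform h u m x" .
    moreover have "\<mu> \<le> h i" unfolding \<mu>_def using im by auto
    ultimately show ?thesis by simp
  qed
  have "unit_vec 0 \<in> V" using m conj_ringD(1,2)[OF R_ring] unfolding V_def unit_vec_def by auto
  then have ne: "triform h u m ` V \<noteq> {}" by auto
  define I where "I = Inf (triform h u m ` V)"
  have "\<mu> \<le> I" unfolding I_def using low by (intro cInf_greatest ne) auto
  then have "I < 2 * I" using \<mu> by simp
  then obtain b where b: "b \<in> V" "triform h u m b < 2 * I"
    using cInf_lessD[OF ne, of "2 * I"] unfolding I_def by auto
  have "I \<le> triform h u m x" if "x \<in> V" for x unfolding I_def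
    using low that by (intro cInf_lower) (auto intro!: bdd_belowI2[of _ \<mu>])
  then have "triform h u m b \<le> 2 * triform h u m x" if "x \<in> V" for x using b(2) that by (smt (verit))
  then show ?thesis using b(1) unfolding V_def by blast
qed

section \<open>Size reduction and Korkine-Zolotarev reduced bases\<close>

lemma linform_in_tricoord:
  assumes v: "\<And>i j. v i j \<in> E" "\<And>i x. i < m \<Longrightarrow> x i = tricoord u i x + (\<Sum>j<i. v i j * tricoord u j x)"
  shows "k \<le> m \<Longrightarrow> linform E k l \<Longrightarrow> \<exists>t. (\<forall>j. t j \<in> E) \<and> (\<forall>x. l x = (\<Sum>j<k. t j * tricoord u j x))"
proof (induction k arbitrary: l)
  case 0
  then show ?case using conj_ringD(1)[OF E_ring] by (intro exI[of _ "\<lambda>_. 0"]) (auto simp: linform_def)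
next
  case (Suc k)
  obtain a f where af: "a \<in> E" "linform E k f" "l = (\<lambda>x. a * x k + f x)"
    using Suc.prems(2) by (rule linform_Suc_cases)
  obtain t where t: "\<forall>j. t j \<in> E" "\<And>x. f x = (\<Sum>j<k. t j * tricoord u j x)" using Suc.IH[OF _ af(2)] Suc.prems(1) by auto
  have "l x = (\<Sum>j<Suc k. (if j = k then a else t j + a * v k j) * tricoord u j x)" for x
  proof -
    have "l x = a * (tricoord u k x + (\<Sum>j<k. v k j * tricoord u j x)) + (\<Sum>j<k. t j * tricoord u j x)"
      unfolding af(3) t(2) using v(2)[of k x] Suc.prems(1) by simp
    then show ?thesis by (simp add: sum_distrib_left sum.distrib algebra_simps)
  qed
  moreover have "\<forall>j. (if j = k then a else t j + a * v k j) \<in> E"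
    using af(1) t(1) conj_ringD(3)[OF E_ring _ conj_ringD(5)[OF E_ring af(1) v(1)]] by simp
  ultimately show ?case by (intro exI[of _ "\<lambda>j. if j = k then a else t j + a * v k j"]) auto
qed

text \<open>The coefficients of a linear form with respect to the \<open>tricoord u j\<close> can be reduced one at a
  time from the top, because adding a multiple of \<open>x k\<close> leaves those above \<open>k\<close> unchanged.\<close>

lemma reduce_in_tricoord:
  assumes v: "\<And>i j. v i j \<in> E" "\<And>i x. i < m \<Longrightarrow> x i = tricoord u i x + (\<Sum>j<i. v i j * tricoord u j x)"
  shows "k \<le> m \<Longrightarrow> (\<And>j. t j \<in> E) \<Longrightarrow> \<exists>c t'. (\<forall>j. c j \<in> R) \<and> (\<forall>j. t' j \<in> E) \<and> (\<forall>j<k. cmod (t' j) \<le> B) \<and>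
    (\<forall>x. (\<Sum>j<k. t j * tricoord u j x) + (\<Sum>j<k. c j * x j) = (\<Sum>j<k. t' j * tricoord u j x))"
proof (induction k arbitrary: t)
  case 0
  then show ?case using conj_ringD(1)[OF E_ring] conj_ringD(1)[OF R_ring] by (intro exI[of _ "\<lambda>_. 0"]) auto
next
  case (Suc k)
  obtain a where a: "a \<in> R" "cmod (t k - a) \<le> B" using cover Suc.prems(2) by blast
  have aE: "a \<in> E" using a R_subset by auto
  have "t j - a * v k j \<in> E" for j
    by (rule conj_ringD(4)[OF E_ring Suc.prems(2) conj_ringD(5)[OF E_ring aE v(1)]])
  then obtain c t' where c: "\<forall>j. c j \<in> R" "\<forall>j. t' j \<in> E" "\<forall>j<k. cmod (t' j) \<le> B"
    "\<And>x. (\<Sum>j<k. (t j - a * v k j) * tricoord u j x) + (\<Sum>j<k. c j * x j) = (\<Sum>j<k. t' j * tricoord u j x)"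
    using Suc.IH[of "\<lambda>j. t j - a * v k j"] Suc.prems(1) by auto
  have "(\<Sum>j<Suc k. t j * tricoord u j x) + (\<Sum>j<Suc k. (c(k := - a)) j * x j) = (\<Sum>j<Suc k. (t'(k := t k - a)) j * tricoord u j x)" for x
  proof -
    have alg: "(A + p * Y) + (C + - a * X) = T' + (p - a) * Y"
      if "X = Y + V" "S + C = T'" "S = A - a * V" for A p Y C X T' V S :: complex
      unfolding that(1) that(2)[symmetric] that(3) by (simp add: algebra_simps)
    have "x k = tricoord u k x + (\<Sum>j<k. v k j * tricoord u j x)" using v(2) Suc.prems(1) by simp
    moreover have "(\<Sum>j<k. (t j - a * v k j) * tricoord u j x) = (\<Sum>j<k. t j * tricoord u j x) - a * (\<Sum>j<k. v k j * tricoord u j x)"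
      by (simp add: sum_subtractf sum_distrib_left left_diff_distrib mult.assoc)
    moreover have "(\<Sum>j<Suc k. (c(k := - a)) j * x j) = (\<Sum>j<k. c j * x j) + - a * x k"
      "(\<Sum>j<Suc k. (t'(k := t k - a)) j * tricoord u j x) = (\<Sum>j<k. t' j * tricoord u j x) + (t k - a) * tricoord u k x"
      by simp_all
    ultimately show ?thesis using alg[OF _ c(4)[of x], of "x k"] by (simp only: sum.lessThan_Suc)
  qed
  moreover have "\<forall>j. (c(k := - a)) j \<in> R" using c(1) conj_ringD(7)[OF R_ring a(1)] by simp
  moreover have "\<forall>j. (t'(k := t k - a)) j \<in> E" using c(2) conj_ringD(4)[OF E_ring Suc.prems(2) aE] by simp
  moreover have "\<forall>j<Suc k. cmod ((t'(k := t k - a)) j) \<le> B" using c(3) a(2) by (auto simp: less_Suc_eq)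
  ultimately show ?case by blast
qed

text \<open>Korkine-Zolotarev reduction with reversed indices: dropping the terms above
  \<open>i\<close> projects away the later basis vectors, and \<open>h i\<close> is the value of the
  projected form at its last basis vector, which is minimal up to the factor 2. The matrix
  \<open>v\<close> is the inverse of the unitriangular \<open>u\<close>, and only its entries are
  bounded.\<close>

definition hkz_reduced :: "nat \<Rightarrow> (nat \<Rightarrow> real) \<Rightarrow> (nat \<Rightarrow> nat \<Rightarrow> complex) \<Rightarrow> (nat \<Rightarrow> nat \<Rightarrow> complex) \<Rightarrow> bool" where
  "hkz_reduced m h u v \<longleftrightarrow> (\<forall>i j. u i j \<in> E) \<and> (\<forall>i j. v i j \<in> E) \<and> (\<forall>i<m. h i > 0) \<and>
     (\<forall>i<m. \<forall>x. (\<forall>j. x j \<in> R) \<longrightarrow> (\<exists>j<Suc i. x j \<noteq> 0) \<longrightarrow> h i \<le> 2 * triform h u (Suc i) x) \<and>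
     (\<forall>i<m. \<forall>x. x i = tricoord u i x + (\<Sum>j<i. v i j * tricoord u j x)) \<and> (\<forall>i<m. \<forall>j<i. cmod (v i j) \<le> B)"

lemma hkz_reduced_Suc:
  assumes "hkz_reduced m h u v" "\<alpha> > 0" "\<And>j. r j \<in> E" "\<And>j. w j \<in> E" "\<And>j. j < m \<Longrightarrow> cmod (w j) \<le> B"
    and "\<And>x. x m + (\<Sum>j<m. r j * x j) = x m - (\<Sum>j<m. w j * tricoord u j x)"
    and "\<And>x. (\<And>j. x j \<in> R) \<Longrightarrow> \<exists>j<Suc m. x j \<noteq> 0 \<Longrightarrow>
      \<alpha> \<le> 2 * triform (h(m := \<alpha>)) (u(m := r)) (Suc m) x"
  shows "hkz_reduced (Suc m) (h(m := \<alpha>)) (u(m := r)) (v(m := w))"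
  unfolding hkz_reduced_def
proof (intro conjI allI impI)
  fix i assume i: "i < Suc m"
  show "0 < (h(m := \<alpha>)) i" using assms(1,2) i unfolding hkz_reduced_def by (auto simp: less_Suc_eq)
  show "(h(m := \<alpha>)) i \<le> 2 * triform (h(m := \<alpha>)) (u(m := r)) (Suc i) x"
    if "\<forall>j. x j \<in> R" "\<exists>j<Suc i. x j \<noteq> 0" for x
  proof (cases "i = m")
    case True
    then show ?thesis using assms(7)[of x] that by simp
  next
    case False
    then have "i < m" using i by simp
    then have "h i \<le> 2 * triform h u (Suc i) x" using assms(1) that unfolding hkz_reduced_def by blast
    then show ?thesis using \<open>i < m\<close> by (simp add: triform_upd)
  qed
  show "x i = tricoord (u(m := r)) i x + (\<Sum>j<i. (v(m := w)) i j * tricoord (u(m := r)) j x)" for x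
  proof (cases "i = m")
    case True
    have "tricoord (u(m := r)) m x = x m + (\<Sum>j<m. r j * x j)" unfolding tricoord_def by simp
    moreover have "(\<Sum>j<m. w j * tricoord (u(m := r)) j x) = (\<Sum>j<m. w j * tricoord u j x)"
      by (intro sum.cong) (auto simp: tricoord_upd)
    ultimately show ?thesis using assms(6)[of x] True by simp
  next
    case False
    then have "i < m" using i by simp
    then have "x i = tricoord u i x + (\<Sum>j<i. v i j * tricoord u j x)" using assms(1) unfolding hkz_reduced_def by blast
    moreover have "(\<Sum>j<i. (v(m := w)) i j * tricoord (u(m := r)) j x) = (\<Sum>j<i. v i j * tricoord u j x)"
      using \<open>i < m\<close> by (intro sum.cong) (auto simp: tricoord_upd)
    moreover have "tricoord (u(m := r)) i x = tricoord u i x" using False by (simp add: tricoord_upd)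
    ultimately show ?thesis by simp
  qed
  show "cmod ((v(m := w)) i j) \<le> B" if "j < i" for j
    using assms(1,5) i that unfolding hkz_reduced_def by (cases "i = m") auto
next
  fix i j
  show "(u(m := r)) i j \<in> E" "(v(m := w)) i j \<in> E"
    using assms(1,3,4) unfolding hkz_reduced_def by auto
qed

lemma unimod_E: "unimod R m T T' \<Longrightarrow> unimod E m T T'"
  unfolding unimod_def int_subst_def using linform_subset[OF R_subset] by blast

lemma hform_subst:
  assumes "hform E m \<phi>" "positive_on E m \<phi>" "unimod R m T T'"
  shows "hform E m (\<lambda>x. \<phi> (T x))" "positive_on E m (\<lambda>x. \<phi> (T x))"
proof -
  obtain h u where hu: "\<forall>i j. u i j \<in> E" "\<forall>i<m. h i > 0 \<and> of_real (h i) \<in> E" "\<phi> = triform h u m"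
    using lagrange_decomposition[OF assms(1,2)] by blast
  have T: "unimod E m T T'" by (rule unimod_E[OF assms(3)])
  show "hform E m (\<lambda>x. \<phi> (T x))" unfolding hu(3)
    by (rule hform_triform_subst[OF E_ring]) (use hu(1,2) T in \<open>auto simp: unimod_def int_subst_def\<close>)
  show "positive_on E m (\<lambda>x. \<phi> (T x))" unfolding positive_on_def
  proof (intro allI impI)
    fix x :: "nat \<Rightarrow> complex" assume x: "\<forall>i. x i \<in> E" "\<exists>i<m. x i \<noteq> 0"
    have "\<forall>i. T x i \<in> E" using T x(1) int_subst_mem[OF E_ring, of m T x] unfolding unimod_def by auto
    then show "\<phi> (T x) > 0" using unimod_nonzero[OF T x(2)] assms(2) unfolding positive_on_def by blast
  qed
qed

text \<open>\<open>T1\<close> moves a near-minimal vector to the last place, \<open>T2\<close>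
  reduces the projected form recursively, and \<open>T3\<close> adds an integral form in the other
  variables to \<open>x m\<close>, which alters only the last row and serves to make that row of the
  inverse small.\<close>

lemma hkz_reduction:
  "hform E m \<phi> \<Longrightarrow> positive_on E m \<phi> \<Longrightarrow>
   \<exists>T T' h u v. unimod R m T T' \<and> hkz_reduced m h u v \<and> (\<forall>x. \<phi> (T x) = triform h u m x)"
proof (induction m arbitrary: \<phi>)
  case 0
  have "hkz_reduced 0 (\<lambda>_. 0) (\<lambda>_ _. 0) (\<lambda>_ _. 0)" using conj_ringD(1)[OF E_ring] unfolding hkz_reduced_def by auto
  moreover have "\<forall>x. \<phi> x = triform (\<lambda>_. 0) (\<lambda>_ _. 0) 0 x" using 0 by (simp add: triform_def)
  ultimately show ?case using unimod_id[OF R_ring, of 0] by blast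
next
  case (Suc m)
  obtain h0 u0 where hu0: "\<forall>i j. u0 i j \<in> E" "\<forall>i<Suc m. h0 i > 0 \<and> of_real (h0 i) \<in> E" "\<phi> = triform h0 u0 (Suc m)"
    using lagrange_decomposition[OF Suc.prems] by blast
  obtain b where b: "\<And>i. b i \<in> R" "\<exists>i<Suc m. b i \<noteq> 0"
    "\<And>x. (\<And>i. x i \<in> R) \<Longrightarrow> \<exists>i<Suc m. x i \<noteq> 0 \<Longrightarrow> \<phi> b \<le> 2 * \<phi> x"
    using near_minimum[of "Suc m" h0 u0] hu0 by auto
  obtain T1 T1' g where T1: "unimod R (Suc m) T1 T1'" "g \<in> R" "\<And>i. i < Suc m \<Longrightarrow> b i = g * T1 (unit_vec m) i"
    using unimod_completion[of b m, OF b(1)] by blast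
  have "g \<noteq> 0" using b(2) T1(3) by auto
  then have g: "cmod g \<ge> 1" using R_norm_ge_1 T1(2) by blast
  \<comment> \<open>Dividing by \<open>g\<close> can only shorten the vector, so the primitive
    vector is near-minimal too.\<close>
  have \<phi>b: "\<phi> (T1 (unit_vec m)) \<le> \<phi> b"
  proof -
    have "\<phi> b = triform h0 u0 (Suc m) (\<lambda>i. g * T1 (unit_vec m) i)" unfolding hu0(3) by (rule triform_cong) (use T1(3) in auto)
    also have "\<dots> = (cmod g)\<^sup>2 * \<phi> (T1 (unit_vec m))" unfolding triform_hom hu0(3) ..
    also have "\<dots> \<ge> 1 * \<phi> (T1 (unit_vec m))"
    proof (rule mult_right_mono)
      show "1 \<le> (cmod g)\<^sup>2" using g by simp
      show "0 \<le> \<phi> (T1 (unit_vec m))" unfolding hu0(3) using hu0(2) by (auto intro!: triform_nonneg simp: less_imp_le)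
    qed
    finally show ?thesis by simp
  qed
  obtain \<alpha> c \<psi> where c: "\<alpha> > 0" "of_real \<alpha> \<in> E" "linform E m c" "hform E m \<psi>" "positive_on E m \<psi>"
    "\<And>x. \<phi> (T1 x) = \<psi> x + \<alpha> * (cmod (x m + c x))\<^sup>2"
    using complete_square[OF hform_subst[OF Suc.prems T1(1)]] by blast
  have "c (unit_vec m) = 0" "\<psi> (unit_vec m) = 0"
    using linform_at_zero[OF c(3), of "unit_vec m"] hform_at_zero[OF c(4), of "unit_vec m"] by (auto simp: unit_vec_def)
  then have \<alpha>: "\<phi> (T1 (unit_vec m)) = \<alpha>" unfolding c(6) by (simp add: unit_vec_def)
  obtain T2 T2' h u v where T2: "unimod R m T2 T2'" "hkz_reduced m h u v" "\<And>x. \<psi> (T2 x) = triform h u m x"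
    using Suc.IH[OF c(4,5)] by blast
  have v: "\<And>i j. v i j \<in> E" "\<And>i x. i < m \<Longrightarrow> x i = tricoord u i x + (\<Sum>j<i. v i j * tricoord u j x)"
    using T2(2) unfolding hkz_reduced_def by auto
  have T2E: "int_subst E m T2" using unimod_E[OF T2(1)] unfolding unimod_def by blast
  define l where "l x = c (T2 x)" for x
  have l: "linform E m l" unfolding l_def by (rule linform_subst[OF E_ring c(3)]) (use T2E in \<open>auto simp: int_subst_def\<close>)
  obtain t where t: "\<forall>j. t j \<in> E" "\<And>x. l x = (\<Sum>j<m. t j * tricoord u j x)"
    using linform_in_tricoord[OF v le_refl l] by blast
  obtain d t' where d: "\<forall>j. d j \<in> R" "\<forall>j. t' j \<in> E" "\<forall>j<m. cmod (t' j) \<le> B"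
    "\<And>x. (\<Sum>j<m. t j * tricoord u j x) + (\<Sum>j<m. d j * x j) = (\<Sum>j<m. t' j * tricoord u j x)"
    using reduce_in_tricoord[where v = v and u = u and k = m and t = t, OF v le_refl] t(1) by blast
  define df where "df x = (\<Sum>j<m. d j * x j)" for x :: "nat \<Rightarrow> complex"
  have df: "linform R m df" unfolding df_def using d(1) by (auto intro: linformI)
  have ldf: "l x + df x = (\<Sum>j<m. t' j * tricoord u j x)" for x using d(4) unfolding t(2) df_def .
  \<comment> \<open>\<open>T2\<close> leaves entry \<open>m\<close> alone, so this shift turns the
    last row \<open>l\<close> into \<open>l + df\<close>, whose triangular coefficients are the
    reduced ones.\<close>
  define T3 where "T3 x = x(m := x m + df x)" for x :: "nat \<Rightarrow> complex"
  define T3' where "T3' x = x(m := x m - df x)" for x :: "nat \<Rightarrow> complex"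
  have dfu: "df (x(m := z)) = df x" "l (x(m := z)) = l x" for x z
    by (rule linform_cong[OF df] linform_cong[OF l]; simp)+
  have T3: "unimod R (Suc m) T3 T3'"
    unfolding unimod_def int_subst_def T3_def T3'_def using dfu(1) linform_mono[OF R_ring df, of "Suc m"]
    by (auto simp: fun_upd_def intro!: linform_if linform_add linform_diff linform_coord R_ring)
  define T where "T x = T1 (T2 (T3 x))" for x
  define T' where "T' x = T3' (T2' (T1' x))" for x
  have T: "unimod R (Suc m) T T'"
    using unimod_comp[OF R_ring T1(1) unimod_comp[OF R_ring unimod_Suc[OF R_ring T2(1)] T3]]
    unfolding T_def T'_def .
  have "linform E m (\<lambda>x. l x + df x)" by (intro linform_add E_ring l linform_subset[OF R_subset df])
  then obtain \<gamma> where \<gamma>: "\<forall>j<m. \<gamma> j \<in> E" "(\<lambda>x. l x + df x) = (\<lambda>x. \<Sum>j<m. \<gamma> j * x j)" unfolding linform_def by blast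
  define r where "r j = (if j < m then \<gamma> j else 0)" for j
  have r: "(\<Sum>j<m. r j * x j) = l x + df x" for x using fun_cong[OF \<gamma>(2), of x] unfolding r_def by simp
  have tr: "tricoord (u(m := r)) m x = x m + (l x + df x)" for x unfolding tricoord_def r[symmetric] by simp
  have \<phi>T: "\<phi> (T x) = triform (h(m := \<alpha>)) (u(m := r)) (Suc m) x" for x
  proof -
    have "T2 (T3 x) m = x m + df x" using T2E by (simp add: int_subst_def T3_def)
    moreover have "c (T2 (T3 x)) = l x" using dfu(2) unfolding l_def[symmetric] T3_def by simp
    ultimately show ?thesis
      unfolding T_def c(6) T2(3) triform_Suc tr by (simp add: triform_upd T3_def triform_fun_upd algebra_simps)
  qed
  have near: "\<alpha> \<le> 2 * triform (h(m := \<alpha>)) (u(m := r)) (Suc m) x" if "\<And>j. x j \<in> R" "\<exists>j<Suc m. x j \<noteq> 0" for x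
  proof -
    have "T x i \<in> R" for i by (rule int_subst_mem[OF R_ring]) (use T that(1) in \<open>auto simp: unimod_def\<close>)
    then have "\<phi> b \<le> 2 * \<phi> (T x)" using b(3) unimod_nonzero[OF T that(2)] by blast
    then show ?thesis using \<phi>b \<alpha> unfolding \<phi>T by simp
  qed
  \<comment> \<open>The sign comes from solving for \<open>x m\<close>: it equals its triangular
    coordinate minus \<open>l x + df x\<close>.\<close>
  have "hkz_reduced (Suc m) (h(m := \<alpha>)) (u(m := r)) (v(m := (\<lambda>j. - t' j)))"
  proof (rule hkz_reduced_Suc[OF T2(2) c(1)])
    show "r j \<in> E" for j using \<gamma>(1) conj_ringD(1)[OF E_ring] by (simp add: r_def)
    show "- t' j \<in> E" for j using d(2) conj_ringD(7)[OF E_ring] by simp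
    show "cmod (- t' j) \<le> B" if "j < m" for j using d(3) that by simp
    show "x m + (\<Sum>j<m. r j * x j) = x m - (\<Sum>j<m. - t' j * tricoord u j x)" for x
      unfolding r ldf by (simp add: sum_negf)
  qed (use near in blast)
  then show ?case using T \<phi>T by blast
qed

end

section \<open>Minkowski's theorem and the decay of reduced forms\<close>

lemma tricoord_diff: "tricoord u i (\<lambda>j. x j - y j) = tricoord u i x - tricoord u i y"
  unfolding tricoord_def by (simp add: sum_subtractf algebra_simps)

lemma tricoord_eq_0: "(\<And>j. j \<le> i \<Longrightarrow> x j = 0) \<Longrightarrow> tricoord u i x = 0"
  unfolding tricoord_def by simp

text \<open>The map \<open>cell s\<close> partitions the plane into cells of diameter at most \<open>B * s\<close>; in any
  translate, a block of \<open>K ^ d\<close> cells contains about \<open>(K * s) ^ d\<close> points of the order.\<close>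

locale lattice_order_cells = lattice_order +
  fixes d :: nat and cell :: "real \<Rightarrow> complex \<Rightarrow> int \<times> int"
  assumes d_pos: "d > 0"
    and cells: "\<And>s K. s > 0 \<Longrightarrow> K > 0 \<Longrightarrow> \<exists>Z. finite Z \<and> card Z = K ^ d \<and>
      (\<forall>t\<in>E. \<exists>X\<subseteq>R. finite X \<and> nat \<lfloor>real K * s\<rfloor> ^ d \<le> card X \<and> (\<forall>x\<in>X. cell s (x + t) \<in> Z))"
    and cell_diameter: "\<And>s a b. s > 0 \<Longrightarrow> a \<in> E \<Longrightarrow> b \<in> E \<Longrightarrow> cell s a = cell s b \<Longrightarrow> cmod (a - b) \<le> B * s"
begin

text \<open>Entries are chosen from \<open>k\<close> upwards. Once the earlier ones are fixed,
  \<open>tricoord u j x\<close> is \<open>x j\<close> plus a constant from the field, so the number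
  of choices for \<open>x j\<close> does not depend on them and the counts multiply.\<close>

lemma lattice_points_in_box:
  assumes u: "\<And>i j. u i j \<in> E"
    and Z: "\<And>j t. t \<in> E \<Longrightarrow> \<exists>X\<subseteq>R. finite X \<and> f j \<le> card X \<and> (\<forall>x\<in>X. cell (s j) (x + t) \<in> Z j)"
  shows "\<exists>X. finite X \<and> (\<Prod>j\<in>{k..<k+r}. f j) \<le> card X \<and>
    (\<forall>x\<in>X. (\<forall>i. x i \<in> R) \<and> (\<forall>i. i < k \<or> k + r \<le> i \<longrightarrow> x i = 0) \<and> (\<forall>j\<in>{k..<k+r}. cell (s j) (tricoord u j x) \<in> Z j))"
proof (induction r)
  case 0
  show ?case by (rule exI[of _ "{\<lambda>_. 0}"]) (auto simp: conj_ringD(1)[OF R_ring])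
next
  case (Suc r)
  then obtain X where X: "finite X" "(\<Prod>j\<in>{k..<k+r}. f j) \<le> card X"
    "\<And>x i. x \<in> X \<Longrightarrow> x i \<in> R" "\<And>x i. x \<in> X \<Longrightarrow> i < k \<or> k + r \<le> i \<Longrightarrow> x i = 0"
    "\<And>x j. x \<in> X \<Longrightarrow> j \<in> {k..<k+r} \<Longrightarrow> cell (s j) (tricoord u j x) \<in> Z j" by blast
  define t where "t x = (\<Sum>j<k+r. u (k + r) j * x j)" for x
  have "t x \<in> E" if "x \<in> X" for x unfolding t_def
    using X(3)[OF that] R_subset u E_ring by (intro conj_ring_sum conj_ringD(5)) auto
  then have "\<forall>x\<in>X. \<exists>Y\<subseteq>R. finite Y \<and> f (k + r) \<le> card Y \<and> (\<forall>y\<in>Y. cell (s (k + r)) (y + t x) \<in> Z (k + r))"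
    using Z by blast
  then obtain Y where Y: "\<And>x. x \<in> X \<Longrightarrow> Y x \<subseteq> R" "\<And>x. x \<in> X \<Longrightarrow> finite (Y x)"
    "\<And>x. x \<in> X \<Longrightarrow> f (k + r) \<le> card (Y x)"
    "\<And>x y. x \<in> X \<Longrightarrow> y \<in> Y x \<Longrightarrow> cell (s (k + r)) (y + t x) \<in> Z (k + r)" by metis
  define G where "G = (\<lambda>(x, y). x(k + r := y) :: nat \<Rightarrow> complex)"
  define X' where "X' = G ` Sigma X Y"
  have "inj_on G (Sigma X Y)"
  proof (rule inj_onI)
    fix p q assume *: "p \<in> Sigma X Y" "q \<in> Sigma X Y" "G p = G q"
    obtain x y x' y' where pq: "p = (x, y)" "q = (x', y')" "x \<in> X" "x' \<in> X" using * by auto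
    have eq: "x(k + r := y) = x'(k + r := y')" using *(3) unfolding pq G_def by simp
    have "y = y'" using fun_cong[OF eq, of "k + r"] by simp
    moreover have "x i = x' i" for i
      using fun_cong[OF eq, of i] X(4)[OF pq(3), of i] X(4)[OF pq(4), of i] by (cases "i = k + r") auto
    ultimately show "p = q" using pq by auto
  qed
  then have "card X' = card (Sigma X Y)" unfolding X'_def by (rule card_image)
  also have "\<dots> = (\<Sum>x\<in>X. card (Y x))" using X(1) Y(2) by (simp add: card_SigmaI)
  also have "\<dots> \<ge> (\<Sum>x\<in>X. f (k + r))" by (rule sum_mono) (rule Y(3))
  finally have "card X * f (k + r) \<le> card X'" by simp
  moreover have "(\<Prod>j\<in>{k..<k+r}. f j) * f (k + r) \<le> card X * f (k + r)" using X(2) by (rule mult_le_mono1)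
  ultimately have "(\<Prod>j\<in>{k..<k+r}. f j) * f (k + r) \<le> card X'" by (rule order_trans[rotated])
  then have "(\<Prod>j\<in>{k..<k+Suc r}. f j) \<le> card X'" by simp
  moreover have "finite X'" unfolding X'_def using X(1) Y(2) by auto
  moreover have "(\<forall>i. z i \<in> R) \<and> (\<forall>i. i < k \<or> k + Suc r \<le> i \<longrightarrow> z i = 0) \<and>
      (\<forall>j\<in>{k..<k+Suc r}. cell (s j) (tricoord u j z) \<in> Z j)" if "z \<in> X'" for z
  proof -
    obtain x y where z: "z = x(k + r := y)" "x \<in> X" "y \<in> Y x" using \<open>z \<in> X'\<close> unfolding X'_def G_def by auto
    have 1: "tricoord u j z = tricoord u j x" if "j < k + r" for j by (rule tricoord_cong) (use that z in auto)
    have 2: "tricoord u (k + r) z = y + t x" unfolding tricoord_def t_def z by simp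
    have "cell (s j) (tricoord u j z) \<in> Z j" if "j \<in> {k..<k+Suc r}" for j
    proof (cases "j = k + r")
      case True
      then show ?thesis using Y(4)[OF z(2,3)] 2 by simp
    next
      case False
      then have "j \<in> {k..<k+r}" using that by auto
      then show ?thesis using X(5)[OF z(2)] 1[of j] by simp
    qed
    moreover have "z i \<in> R" for i using X(3)[OF z(2)] Y(1)[OF z(2)] z(3) unfolding z(1) by auto
    moreover have "z i = 0" if "i < k \<or> k + Suc r \<le> i" for i using X(4)[OF z(2), of i] that unfolding z(1) by auto
    ultimately show ?thesis by blast
  qed
  ultimately show ?case by blast
qed

text \<open>Pigeonhole: a box of \<open>K ^ d\<close> cells per coordinate contains more lattice
  points than cells, so two points share all cells, and their difference is short. Starting at
  \<open>k\<close> keeps the entries below \<open>k\<close> zero.\<close>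

lemma minkowski_linear_forms:
  assumes u: "\<And>i j. u i j \<in> E" and r: "r > 0" and \<rho>: "\<And>j. \<rho> j > 0" "(\<Prod>j\<in>{k..<k+r}. \<rho> j) \<ge> 1"
  shows "\<exists>z. (\<forall>i. z i \<in> R) \<and> (\<exists>j\<in>{k..<k+r}. z j \<noteq> 0) \<and> (\<forall>i. i < k \<longrightarrow> z i = 0) \<and>
    (\<forall>j\<in>{k..<k+r}. cmod (tricoord u j z) \<le> 2 * B * \<rho> j)"
proof -
  let ?I = "{k..<k+r}"
  \<comment> \<open>Large enough for \<open>K * \<rho> j \<ge> 1\<close> at every
    \<open>j\<close>.\<close>
  define K where "K = (\<Sum>j\<in>?I. nat \<lceil>1 / \<rho> j\<rceil>) + 1"
  have K0: "K > 0" unfolding K_def by simp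
  have K: "K * \<rho> j \<ge> 1" if "j \<in> ?I" for j
  proof -
    have "nat \<lceil>1 / \<rho> j\<rceil> \<le> (\<Sum>j\<in>?I. nat \<lceil>1 / \<rho> j\<rceil>)" using that by (intro member_le_sum) auto
    then have "nat \<lceil>1 / \<rho> j\<rceil> \<le> K" unfolding K_def by simp
    then have "1 / \<rho> j \<le> K" by linarith
    then show ?thesis using \<rho>(1)[of j] by (simp add: field_simps)
  qed
  \<comment> \<open>The factor 2 outweighs the rounding: \<open>\<lfloor>2 * t\<rfloor> > t\<close>
    whenever \<open>t \<ge> 1\<close>, here with \<open>t = K * \<rho> j\<close>.\<close>
  define s where "s j = 2 * \<rho> j" for j
  have s: "s j > 0" for j using \<rho>(1)[of j] unfolding s_def by simp
  have "\<forall>j. \<exists>Z. finite Z \<and> card Z = K ^ d \<and>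
      (\<forall>t\<in>E. \<exists>X\<subseteq>R. finite X \<and> nat \<lfloor>real K * s j\<rfloor> ^ d \<le> card X \<and> (\<forall>x\<in>X. cell (s j) (x + t) \<in> Z))"
    using cells[OF s K0] by blast
  then obtain Z where Z: "\<And>j. finite (Z j)" "\<And>j. card (Z j) = K ^ d"
    "\<And>j t. t \<in> E \<Longrightarrow> \<exists>X\<subseteq>R. finite X \<and> nat \<lfloor>real K * s j\<rfloor> ^ d \<le> card X \<and> (\<forall>x\<in>X. cell (s j) (x + t) \<in> Z j)"
    by metis
  have "\<exists>X. finite X \<and> (\<Prod>j\<in>?I. nat \<lfloor>real K * s j\<rfloor> ^ d) \<le> card X \<and>
    (\<forall>x\<in>X. (\<forall>i. x i \<in> R) \<and> (\<forall>i. i < k \<or> k + r \<le> i \<longrightarrow> x i = 0) \<and> (\<forall>j\<in>?I. cell (s j) (tricoord u j x) \<in> Z j))"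
    by (rule lattice_points_in_box[OF u Z(3)])
  then obtain X where X0: "finite X" "(\<Prod>j\<in>?I. nat \<lfloor>real K * s j\<rfloor> ^ d) \<le> card X"
    "\<forall>x\<in>X. (\<forall>i. x i \<in> R) \<and> (\<forall>i. i < k \<or> k + r \<le> i \<longrightarrow> x i = 0) \<and> (\<forall>j\<in>?I. cell (s j) (tricoord u j x) \<in> Z j)"
    by (elim exE conjE)
  have X: "finite X" "(\<Prod>j\<in>?I. nat \<lfloor>real K * s j\<rfloor> ^ d) \<le> card X"
    "\<And>x i. x \<in> X \<Longrightarrow> x i \<in> R" "\<And>x i. x \<in> X \<Longrightarrow> i < k \<or> k + r \<le> i \<Longrightarrow> x i = 0"
    "\<And>x j. x \<in> X \<Longrightarrow> j \<in> ?I \<Longrightarrow> cell (s j) (tricoord u j x) \<in> Z j"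
    using X0 by blast+
  have "real K ^ r \<le> (\<Prod>j\<in>?I. real K * \<rho> j)" using \<rho>(2) K0 by (simp add: prod.distrib)
  also have "\<dots> < (\<Prod>j\<in>?I. real (nat \<lfloor>real K * s j\<rfloor>))"
  proof -
    have "0 \<le> real K * \<rho> j \<and> real K * \<rho> j < real (nat \<lfloor>real K * s j\<rfloor>)" if "j \<in> ?I" for j
      using K[OF that] unfolding s_def by linarith
    then have "0 \<le> real K * \<rho> j" "real K * \<rho> j < real (nat \<lfloor>real K * s j\<rfloor>)" "0 < real (nat \<lfloor>real K * s j\<rfloor>)"
      if "j \<in> ?I" for j using that by (blast intro: le_less_trans)+
    then show ?thesis using r by (intro prod_mono_strict[of k]) (auto simp: less_imp_le simp del: of_nat_0_less_iff zero_less_nat_eq)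
  qed
  finally have "(real K ^ r) ^ d < (\<Prod>j\<in>?I. real (nat \<lfloor>real K * s j\<rfloor>)) ^ d" using d_pos by (intro power_strict_mono) auto
  also have "\<dots> = real (\<Prod>j\<in>?I. nat \<lfloor>real K * s j\<rfloor> ^ d)" by (simp add: prod_power_distrib)
  also have "\<dots> \<le> real (card X)" using X(2) by linarith
  finally have "real ((K ^ d) ^ r) < real (card X)" by (simp add: power_mult[symmetric] mult.commute)
  then have cardX: "(K ^ d) ^ r < card X" by linarith
  define F where "F x = (\<lambda>j\<in>?I. cell (s j) (tricoord u j x))" for x
  have "\<not> inj_on F X"
  proof
    assume "inj_on F X"
    moreover have "F ` X \<subseteq> PiE ?I Z" unfolding F_def using X(5) by auto
    moreover have "finite (PiE ?I Z)" using Z(1) by (intro finite_PiE) auto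
    ultimately have "card X \<le> card (PiE ?I Z)" by (rule card_inj_on_le)
    also have "\<dots> = (K ^ d) ^ r" by (simp add: card_PiE Z(2))
    finally show False using cardX by simp
  qed
  then obtain x y where xy: "x \<in> X" "y \<in> X" "x \<noteq> y" "F x = F y" unfolding inj_on_def by blast
  define z where "z i = x i - y i" for i
  have "z i \<in> R" for i unfolding z_def by (rule conj_ringD(4)[OF R_ring X(3)[OF xy(1)] X(3)[OF xy(2)]])
  moreover have z0: "z i = 0" if "i < k \<or> k + r \<le> i" for i
    unfolding z_def using X(4)[OF xy(1) that] X(4)[OF xy(2) that] by simp
  moreover have "\<exists>j\<in>?I. z j \<noteq> 0"
  proof -
    obtain i where i: "x i \<noteq> y i" using xy(3) by (auto simp: fun_eq_iff)
    then have "i \<in> ?I" using z0[of i] unfolding z_def by force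
    then show ?thesis using i unfolding z_def by auto
  qed
  moreover have "cmod (tricoord u j z) \<le> 2 * B * \<rho> j" if "j \<in> ?I" for j
  proof -
    have "cell (s j) (tricoord u j x) = cell (s j) (tricoord u j y)"
      using fun_cong[OF xy(4), of j] that unfolding F_def by simp
    moreover have "tricoord u j x \<in> E" "tricoord u j y \<in> E"
      by (rule tricoord_mem[OF E_ring u]; use X(3) xy(1,2) R_subset in blast)+
    ultimately have "cmod (tricoord u j x - tricoord u j y) \<le> B * s j" using cell_diameter[OF s] by blast
    then show ?thesis unfolding z_def tricoord_diff s_def by (simp add: algebra_simps)
  qed
  ultimately show ?thesis by blast
qed

text \<open>Minkowski's bound for the block from \<open>k\<close> to \<open>i\<close>: the short
  vector it provides is compared with the near-minimal \<open>h i\<close>. The 8 combines the factor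
  2 of the reduction with the square of the factor 2 in
  \<open>minkowski_linear_forms\<close>.\<close>

lemma hkz_reduced_log_average:
  assumes hkz: "hkz_reduced m h u v" and i: "k \<le> i" "i < m"
  shows "ln (h i) \<le> ln (8 * B\<^sup>2 * real (Suc i - k)) + (\<Sum>j\<in>{k..i}. ln (h j)) / real (Suc i - k)"
proof -
  define r where "r = Suc i - k"
  have r: "r > 0" "k + r = Suc i" unfolding r_def using i by auto
  have h: "h j > 0" if "j < m" for j using hkz that unfolding hkz_reduced_def by blast
  define L where "L = (\<Sum>j\<in>{k..i}. ln (h j)) / r"
  \<comment> \<open>Proportional to the inverse square root of \<open>h j\<close> and normalised to
    product 1, so that all terms of the form get the same bound.\<close>
  define \<rho> where "\<rho> j = exp ((L - ln (h j)) / 2)" for j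
  have I: "{k..<k+r} = {k..i}" using r by auto
  have "(\<Sum>j\<in>{k..i}. (L - ln (h j)) / 2) = (r * L - (\<Sum>j\<in>{k..i}. ln (h j))) / 2"
    unfolding r_def by (simp add: sum_subtractf sum_divide_distrib[symmetric])
  also have "\<dots> = 0" unfolding L_def using r by simp
  finally have prod1: "(\<Prod>j\<in>{k..<k+r}. \<rho> j) \<ge> 1" unfolding \<rho>_def I by (simp add: exp_sum[symmetric])
  obtain z where z: "\<And>i. z i \<in> R" "\<exists>j\<in>{k..i}. z j \<noteq> 0" "\<And>i. i < k \<Longrightarrow> z i = 0"
    "\<And>j. j \<in> {k..i} \<Longrightarrow> cmod (tricoord u j z) \<le> 2 * B * \<rho> j"
  proof -
    have u: "u i j \<in> E" for i j using hkz unfolding hkz_reduced_def by blast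
    have "\<rho> j > 0" for j unfolding \<rho>_def by simp
    from minkowski_linear_forms[of u, OF u r(1) this prod1] show thesis
      unfolding I using that by blast
  qed
  have "\<exists>j<Suc i. z j \<noteq> 0" using z(2) by (metis atLeastAtMost_iff less_Suc_eq_le)
  then have "h i \<le> 2 * triform h u (Suc i) z" using hkz z(1) i unfolding hkz_reduced_def by blast
  also have "triform h u (Suc i) z \<le> (\<Sum>j<Suc i. if k \<le> j then 4 * B\<^sup>2 * exp L else 0)"
    unfolding triform_def
  proof (rule sum_mono)
    fix j assume j: "j \<in> {..<Suc i}"
    show "h j * (cmod (tricoord u j z))\<^sup>2 \<le> (if k \<le> j then 4 * B\<^sup>2 * exp L else 0)"
    proof (cases "k \<le> j")
      case True
      then have "(cmod (tricoord u j z))\<^sup>2 \<le> (2 * B * \<rho> j)\<^sup>2" using j by (intro power_mono z(4)) auto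
      also have "\<dots> = 4 * B\<^sup>2 * exp (L - ln (h j))"
        unfolding \<rho>_def by (simp add: power_mult_distrib exp_double[symmetric])
      also have "\<dots> = 4 * B\<^sup>2 * exp L / h j" using h[of j] j i by (simp add: exp_diff)
      finally show ?thesis using True h[of j] j i by (simp add: field_simps)
    next
      case False
      then have "tricoord u j z = 0" by (intro tricoord_eq_0 z(3)) auto
      then show ?thesis using False by simp
    qed
  qed
  also have "(\<Sum>j<Suc i. if k \<le> j then 4 * B\<^sup>2 * exp L else 0) = (\<Sum>j\<in>{k..i}. 4 * B\<^sup>2 * exp L)"
    by (rule sum.mono_neutral_cong_right) auto
  also have "2 * \<dots> = 8 * B\<^sup>2 * r * exp L" unfolding r_def using i by simp
  finally have "h i \<le> 8 * B\<^sup>2 * r * exp L" by simp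
  moreover have "8 * B\<^sup>2 * r > 0" using B_ge_1 r by simp
  ultimately have "ln (h i) \<le> ln (8 * B\<^sup>2 * r) + L"
    using h[OF i(2)] by (subst ln_exp[of L, symmetric], subst ln_mult_pos[symmetric]) auto
  then show ?thesis unfolding L_def r_def .
qed

section \<open>Decay of reduced forms: from averages to ratios\<close>

lemma harm_le: "n \<ge> 1 \<Longrightarrow> (harm n :: real) \<le> 1 + ln n"
proof -
  assume "n \<ge> 1"
  then obtain k where k: "n = Suc k" by (cases n) auto
  have "(harm (Suc k) - ln (Suc k) :: real) \<le> harm (Suc 0) - ln (Suc 0)"
    using decseq_harm_diff_ln unfolding decseq_def by (meson zero_le)
  then show ?thesis unfolding k by (simp add: harm_expand)
qed

text \<open>Each term exceeds the average of the terms up to it by at most \<open>C\<close>, so passing from \<open>m\<close> to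
  \<open>m + 1\<close> terms increases the average by at most \<open>C / m\<close>; the increments sum up to a harmonic number.\<close>

lemma bounded_over_average:
  fixes b :: "nat \<Rightarrow> real"
  assumes C: "C \<ge> 0" and b: "\<And>l. l \<le> n \<Longrightarrow> b l \<le> C + (\<Sum>j\<le>l. b j) / Suc l"
  shows "b n \<le> b 0 + C * (ln (Suc n) + 3)"
proof -
  define A where "A m = (\<Sum>j\<le>m. b j) / Suc m" for m
  have step: "b (Suc m) \<le> A m + 2 * C" "A (Suc m) \<le> A m + C * inverse (Suc m)" if "Suc m \<le> n" for m
  proof -
    have S: "(\<Sum>j\<le>m. b j) = Suc m * A m" unfolding A_def by simp
    have "b (Suc m) \<le> C + (Suc m * A m + b (Suc m)) / (Suc m + 1)"
      using b[OF that] S by (simp add: add.commute)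
    then have 1: "b (Suc m) * Suc m \<le> C * (Suc m + 1) + Suc m * A m"
      by (simp add: field_simps)
    have "C * (Suc m + 1) \<le> C * (2 * Suc m)" using C by (intro mult_left_mono) auto
    then have "b (Suc m) * Suc m \<le> (A m + 2 * C) * Suc m" using 1 by (simp add: algebra_simps)
    then show "b (Suc m) \<le> A m + 2 * C" by (rule mult_right_le_imp_le) auto
    have "A (Suc m) * (Suc m + 1) = Suc m * A m + b (Suc m)" using S unfolding A_def by simp
    then have "A (Suc m) * (Suc m + 1) * Suc m = Suc m * A m * Suc m + b (Suc m) * Suc m" by (simp add: algebra_simps)
    also have "\<dots> \<le> Suc m * A m * Suc m + (C * (Suc m + 1) + Suc m * A m)" using 1 by simp
    also have "\<dots> = (A m * Suc m + C) * (Suc m + 1)" by (simp add: algebra_simps)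
    finally have "A (Suc m) * Suc m * (Suc m + 1) \<le> (A m * Suc m + C) * (Suc m + 1)" by (simp add: algebra_simps)
    then have "A (Suc m) * Suc m \<le> A m * Suc m + C" by (rule mult_right_le_imp_le) auto
    then show "A (Suc m) \<le> A m + C * inverse (Suc m)" by (simp add: field_simps)
  qed
  have avg: "A m \<le> b 0 + C * harm m" if "m \<le> n" for m
    using that
  proof (induction m)
    case 0
    then show ?case by (simp add: A_def harm_expand)
  next
    case (Suc m)
    then have "A (Suc m) \<le> b 0 + C * harm m + C * inverse (Suc m)" using step(2)[of m] by simp
    then show ?case by (simp add: harm_Suc algebra_simps)
  qed
  show ?thesis
  proof (cases n)
    case 0
    then show ?thesis using C by simp
  next
    case (Suc m)
    have "b n \<le> b 0 + C * harm m + 2 * C" using step(1)[of m] avg[of m] Suc by simp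
    moreover have "(harm m :: real) \<le> 1 + ln (Suc n)"
    proof -
      have "(harm m :: real) \<le> harm (Suc n)" by (rule harm_mono) (use Suc in auto)
      then show ?thesis using harm_le[of "Suc n"] by simp
    qed
    then have "C * harm m \<le> C * (1 + ln (Suc n))" using C by (rule mult_left_mono)
    ultimately show ?thesis by (simp add: algebra_simps)
  qed
qed

text \<open>The factor \<open>Q\<close> of the decay estimate: the constant
  \<open>C = ln (8 * B\<^sup>2 * N)\<close> of the averaging inequality times the logarithmic factor
  of \<open>bounded_over_average\<close>.\<close>

definition hkz_const :: "nat \<Rightarrow> real" where
  "hkz_const N = exp (ln (8 * B\<^sup>2 * N) * (ln N + 3))"

lemma ln_const_nonneg: "N > 0 \<Longrightarrow> ln (8 * B\<^sup>2 * real N) \<ge> 0"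
proof -
  assume "N > 0"
  moreover have "1 \<le> B\<^sup>2" using B_ge_1 by simp
  then have "1 \<le> 8 * B\<^sup>2" by linarith
  ultimately have "1 * 1 \<le> (8 * B\<^sup>2) * real N" by (intro mult_mono) auto
  then show ?thesis by (simp add: ln_ge_zero)
qed

lemma hkz_const_ge_1: "N > 0 \<Longrightarrow> hkz_const N \<ge> 1"
  unfolding hkz_const_def using ln_const_nonneg[of N] by (auto intro!: mult_nonneg_nonneg)

text \<open>All blocks used start at the same \<open>k\<close>, so the averaging argument compares
  \<open>ln (h i)\<close> with its first term \<open>ln (h k)\<close>.\<close>

lemma hkz_reduced_ratio:
  assumes hkz: "hkz_reduced m h u v" and k: "k \<le> i" "i < m" and m: "m \<le> N"
  shows "h i \<le> hkz_const N * h k"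
proof -
  define C where "C = ln (8 * B\<^sup>2 * real N)"
  have N: "N > 0" using k m by simp
  have C: "C \<ge> 0" unfolding C_def using ln_const_nonneg[OF N] .
  have h: "h j > 0" if "j < m" for j using hkz that unfolding hkz_reduced_def by blast
  define b where "b l = ln (h (k + l))" for l
  have "b l \<le> C + (\<Sum>j\<le>l. b j) / Suc l" if "l \<le> i - k" for l
  proof -
    have "b l \<le> ln (8 * B\<^sup>2 * real (Suc (k + l) - k)) + (\<Sum>j\<in>{k..k+l}. ln (h j)) / real (Suc (k + l) - k)"
      unfolding b_def by (rule hkz_reduced_log_average[OF hkz]) (use that k in auto)
    also have "ln (8 * B\<^sup>2 * real (Suc (k + l) - k)) \<le> C" unfolding C_def
      using that k m B_ge_1 by (subst ln_le_cancel_iff) auto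
    also have "(\<Sum>j\<in>{k..k+l}. ln (h j)) = (\<Sum>j\<le>l. b j)" unfolding b_def
      by (rule sum.reindex_bij_witness[of _ "\<lambda>j. k + j" "\<lambda>j. j - k"]) auto
    finally show ?thesis by simp
  qed
  then have "b (i - k) \<le> b 0 + C * (ln (Suc (i - k)) + 3)" by (rule bounded_over_average[OF C])
  also have "\<dots> \<le> b 0 + C * (ln N + 3)" using C k m by (intro add_left_mono mult_left_mono) auto
  finally have "ln (h i) \<le> ln (h k) + C * (ln N + 3)" unfolding b_def using k by simp
  then have "exp (ln (h i)) \<le> exp (ln (h k) + C * (ln N + 3))" by simp
  then show ?thesis using h[of i] h[of k] k unfolding exp_add hkz_const_def C_def by (simp add: mult.commute)
qed

text \<open>Bounded entries of the inverse \<open>v\<close> give \<open>cmod (x i)\<close> at most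
  \<open>B\<close> times the sum of all \<open>cmod (tricoord u j x)\<close>; the rest is
  Cauchy-Schwarz. The factor is polynomial in \<open>N\<close> because it is the inverse that was
  size-reduced.\<close>

lemma hkz_reduced_coordinates:
  assumes hkz: "hkz_reduced m h u v" and k: "k \<le> m" "m \<le> N"
  shows "(\<Sum>j<k. (cmod (x j))\<^sup>2) \<le> (B * N)\<^sup>2 * (\<Sum>j<k. (cmod (tricoord u j x))\<^sup>2)"
proof -
  define S where "S = (\<Sum>j<k. cmod (tricoord u j x))"
  have "cmod (x i) \<le> B * S" if i: "i < k" for i
  proof -
    have "x i = tricoord u i x + (\<Sum>j<i. v i j * tricoord u j x)" using hkz i k unfolding hkz_reduced_def by auto
    then have "cmod (x i) \<le> cmod (tricoord u i x) + cmod (\<Sum>j<i. v i j * tricoord u j x)"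
      by (metis norm_triangle_ineq)
    also have "\<dots> \<le> cmod (tricoord u i x) + (\<Sum>j<i. cmod (v i j * tricoord u j x))"
      by (intro add_left_mono norm_sum)
    also have "\<dots> \<le> B * cmod (tricoord u i x) + (\<Sum>j<i. B * cmod (tricoord u j x))"
      using hkz i k B_ge_1 unfolding hkz_reduced_def norm_mult
      by (intro add_mono sum_mono mult_right_mono) (auto simp: mult_le_cancel_right1)
    also have "\<dots> = B * (\<Sum>j<Suc i. cmod (tricoord u j x))" by (simp add: sum_distrib_left algebra_simps)
    also have "\<dots> \<le> B * S" unfolding S_def using i B_ge_1 by (intro mult_left_mono sum_mono2) auto
    finally show ?thesis .
  qed
  then have "(\<Sum>j<k. (cmod (x j))\<^sup>2) \<le> (\<Sum>j<k. (B * S)\<^sup>2)" by (intro sum_mono power_mono) auto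
  also have "\<dots> = k * B\<^sup>2 * S\<^sup>2" by (simp add: power_mult_distrib)
  also have "S\<^sup>2 \<le> (\<Sum>j<k. (cmod (tricoord u j x))\<^sup>2) * card {..<k}" unfolding S_def by (rule sum_squared_le_sum_of_squares)
  also have "k * B\<^sup>2 * \<dots> = (B * k)\<^sup>2 * (\<Sum>j<k. (cmod (tricoord u j x))\<^sup>2)" by (simp add: power2_eq_square)
  also have "\<dots> \<le> (B * N)\<^sup>2 * (\<Sum>j<k. (cmod (tricoord u j x))\<^sup>2)"
    using k B_ge_1 by (intro mult_right_mono power_mono mult_left_mono sum_nonneg) auto
  finally show ?thesis by (simp add: mult_left_mono)
qed

end

section \<open>Sums of norms over an order\<close>

lemma norm_sum_subset: "norm_sum S m r \<phi> \<Longrightarrow> S \<subseteq> S' \<Longrightarrow> norm_sum S' m r \<phi>"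
  by (induction rule: norm_sum.induct) (auto intro: norm_sum.intros linform_subset)

lemma norm_sum_hom: "norm_sum S m r \<phi> \<Longrightarrow> \<phi> (\<lambda>j. c * x j) = (cmod c)\<^sup>2 * \<phi> x"
  by (induction rule: norm_sum.induct) (auto simp: linform_hom norm_mult power_mult_distrib algebra_simps)

lemma norm_sum_cong: "norm_sum S m r \<phi> \<Longrightarrow> (\<And>i. i < m \<Longrightarrow> x i = y i) \<Longrightarrow> \<phi> x = \<phi> y"
proof (induction rule: norm_sum.induct)
  case (step l r \<phi>)
  then show ?case using linform_cong[OF step(1), of x y] by simp
qed auto

lemma norm_sum_0: "norm_sum S 0 r \<phi> \<Longrightarrow> \<phi> = (\<lambda>x. 0)"
  by (induction rule: norm_sum.induct) (auto simp: linform_def)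

text \<open>Stated for any set closed under natural multiples, since it serves vectors over the
  field as well as the powers of one algebraic integer.\<close>

lemma common_denominator:
  fixes x :: "nat \<Rightarrow> complex"
  assumes "\<And>i. \<exists>k::nat. k > 0 \<and> of_nat k * x i \<in> M" "\<And>k z. z \<in> M \<Longrightarrow> of_nat k * z \<in> M"
  shows "\<exists>D::nat. D > 0 \<and> (\<forall>i<m. of_nat D * x i \<in> M)"
proof (induction m)
  case (Suc m)
  then obtain D where D: "D > 0" "\<forall>i<m. of_nat D * x i \<in> M" by blast
  obtain k :: nat where k: "k > 0" "of_nat k * x m \<in> M" using assms(1) by blast
  have "of_nat (D * k) * x i \<in> M" if "i < Suc m" for i
  proof (cases "i = m")
    case True
    then show ?thesis using assms(2)[OF k(2), of D] by (simp add: mult.assoc)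
  next
    case False
    then show ?thesis using assms(2)[of "of_nat D * x i" k] D(2) that by (simp add: mult_ac)
  qed
  then show ?case using D(1) k(1) by (intro exI[of _ "D * k"]) auto
qed auto

context lattice_order_cells
begin

text \<open>A nonzero integral coefficient has absolute value at least 1, so every linear form
  involving the last variable adds at least 1 to the value at \<open>unit_vec m\<close>.\<close>

lemma norm_sum_split:
  "norm_sum R (Suc m) r \<phi> \<Longrightarrow> \<exists>r1 \<phi>1 r2 \<phi>2. norm_sum R (Suc m) r1 \<phi>1 \<and> real r1 \<le> \<phi> (unit_vec m) \<and>
     norm_sum R m r2 \<phi>2 \<and> \<phi> = (\<lambda>x. \<phi>1 x + \<phi>2 x)"
proof (induction rule: norm_sum.induct)
  case zero
  have "norm_sum R (Suc m) 0 (\<lambda>x. 0)" "norm_sum R m 0 (\<lambda>x. 0)" by (rule norm_sum.zero)+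
  then show ?case by fastforce
next
  case (step l r \<phi>)
  then obtain r1 \<phi>1 r2 \<phi>2 where IH: "norm_sum R (Suc m) r1 \<phi>1" "real r1 \<le> \<phi> (unit_vec m)"
    "norm_sum R m r2 \<phi>2" "\<phi> = (\<lambda>x. \<phi>1 x + \<phi>2 x)" by blast
  obtain a f where af: "a \<in> R" "linform R m f" "l = (\<lambda>x. a * x m + f x)"
    using step(1) by (rule linform_Suc_cases)
  show ?case
  proof (cases "a = 0")
    case True
    then have "norm_sum R m (Suc r2) (\<lambda>x. \<phi>2 x + (cmod (l x))\<^sup>2)" using norm_sum.step[OF af(2) IH(3)] af(3) by simp
    moreover have "real r1 \<le> \<phi> (unit_vec m) + (cmod (l (unit_vec m)))\<^sup>2" using IH(2) by (simp add: add_increasing2)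
    ultimately show ?thesis using IH(1,4) by (intro exI[of _ r1] exI[of _ \<phi>1] exI[of _ "Suc r2"] exI) (auto simp: add.assoc)
  next
    case False
    have "l (unit_vec m) = a" using linform_at_zero[OF af(2), of "unit_vec m"] unfolding af(3) by (simp add: unit_vec_def)
    moreover have "1 \<le> (cmod a)\<^sup>2" using R_norm_ge_1[OF af(1) False] by simp
    ultimately have "real (Suc r1) \<le> \<phi> (unit_vec m) + (cmod (l (unit_vec m)))\<^sup>2" using IH(2) by simp
    moreover have "norm_sum R (Suc m) (Suc r1) (\<lambda>x. \<phi>1 x + (cmod (l x))\<^sup>2)" by (rule norm_sum.step[OF step(1) IH(1)])
    ultimately show ?thesis using IH(3,4)
      by (intro exI[of _ "Suc r1"] exI[of _ "\<lambda>x. \<phi>1 x + (cmod (l x))\<^sup>2"] exI[of _ r2] exI[of _ \<phi>2]) (auto simp: algebra_simps)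
  qed
qed

text \<open>The factor \<open>624 * N ^ 3 * B ^ 4 * P\<close> of
  \<open>norm_sum_of_triform_bounds\<close> at \<open>P = (B * N)\<^sup>2\<close>, the bound from
  \<open>hkz_reduced_coordinates\<close>.\<close>

definition gap :: "nat \<Rightarrow> real" where
  "gap N = 624 * real N ^ 5 * B ^ 6"

text \<open>One factor \<open>hkz_const N\<close> pays for passing from the last \<open>h\<close> to
  the others; the remaining two make \<open>sqrt (h k)\<close> at least
  \<open>gap N * hkz_const N\<close>.\<close>

definition min_bound :: "nat \<Rightarrow> real" where
  "min_bound N = (gap N)\<^sup>2 * hkz_const N ^ 3"

lemma gap_ge: "N > 0 \<Longrightarrow> gap N \<ge> 624 * (B\<^sup>2 * N)"
proof -
  assume "N > 0"
  then have "real N ^ 1 \<le> real N ^ 5" "B\<^sup>2 \<le> B ^ 6" using B_ge_1 by (intro power_increasing; simp)+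
  then have "real N * B\<^sup>2 \<le> real N ^ 5 * B ^ 6" by (intro mult_mono) auto
  then show ?thesis unfolding gap_def by (simp add: mult.commute mult.left_commute)
qed

lemma B2N_ge_1: "N > 0 \<Longrightarrow> B\<^sup>2 * real N \<ge> 1"
proof -
  assume "N > 0"
  moreover have "1 \<le> B\<^sup>2" using B_ge_1 by simp
  ultimately have "1 * 1 \<le> B\<^sup>2 * real N" by (intro mult_mono) auto
  then show ?thesis by simp
qed

lemma min_bound_ge_1: "N > 0 \<Longrightarrow> min_bound N \<ge> 1"
proof -
  assume N: "N > 0"
  have "1 \<le> gap N" using gap_ge[OF N] B2N_ge_1[OF N] by linarith
  then have "1 * 1 \<le> (gap N)\<^sup>2 * hkz_const N ^ 3" using hkz_const_ge_1[OF N] by (intro mult_mono one_le_power) auto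
  then show ?thesis unfolding min_bound_def by simp
qed

lemma norm_sum_of_large_minimum:
  assumes \<phi>: "norm_sum R m r \<phi>" and m: "m \<le> N" "0 < N"
    and large: "\<And>x. (\<And>i. x i \<in> R) \<Longrightarrow> \<exists>i<m. x i \<noteq> 0 \<Longrightarrow> min_bound N \<le> \<phi> x"
  shows "norm_sum R m (m * (12 * N + 5)) \<phi>"
proof -
  define D where "D = gap N"
  define Q where "Q = hkz_const N"
  have Q: "Q \<ge> 1" unfolding Q_def using hkz_const_ge_1[OF m(2)] .
  have D: "D \<ge> 624 * (B\<^sup>2 * N)" unfolding D_def by (rule gap_ge[OF m(2)])
  have BN: "B\<^sup>2 * N \<ge> 1" by (rule B2N_ge_1[OF m(2)])
  have D0: "D > 0" using D BN by linarith
  have hE: "hform E m \<phi>" by (rule norm_sum_hform[OF norm_sum_subset[OF \<phi> R_subset] E_ring])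
  have pos: "positive_on E m \<phi>" unfolding positive_on_def
  proof (intro allI impI)
    fix x :: "nat \<Rightarrow> complex" assume x: "\<forall>i. x i \<in> E" "\<exists>i<m. x i \<noteq> 0"
    \<comment> \<open>Scaling to an integral vector multiplies the value by a positive square, so a
      positive minimum on integral vectors gives positivity on the field.\<close>
    obtain k :: nat where k: "k > 0" "\<forall>i<m. of_nat k * x i \<in> R" 
      using common_denominator[of x R m] denominator x(1) conj_ringD(5)[OF R_ring conj_ring_of_nat[OF R_ring]] by blast
    define y where "y i = (if i < m then of_nat k * x i else 0)" for i
    have "\<And>i. y i \<in> R" using k(2) conj_ringD(1)[OF R_ring] unfolding y_def by simp
    moreover have "\<exists>i<m. y i \<noteq> 0" using x(2) k(1) unfolding y_def by auto
    ultimately have "1 \<le> \<phi> y" using large min_bound_ge_1[OF m(2)] by (meson order_trans)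
    also have "\<phi> y = \<phi> (\<lambda>i. of_nat k * x i)" by (rule norm_sum_cong[OF \<phi>]) (simp add: y_def)
    also have "\<dots> = (cmod (of_nat k))\<^sup>2 * \<phi> x" by (rule norm_sum_hom[OF \<phi>])
    finally show "\<phi> x > 0" by (smt (verit) mult_nonneg_nonpos zero_le_power2)
  qed
  obtain T T' h u v where T: "unimod R m T T'" "hkz_reduced m h u v" "\<And>x. \<phi> (T x) = triform h u m x"
    using hkz_reduction[OF hE pos] by blast
  have hpos: "h k > 0" if "k < m" for k using T(2) that unfolding hkz_reduced_def by blast
  \<comment> \<open>The last basis vector has value \<open>h m'\<close>, which the minimum bounds;
    the decay estimate carries this to every \<open>h k\<close>.\<close>
  have h_low: "D\<^sup>2 * Q\<^sup>2 \<le> h k" if k: "k < m" for k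
  proof -
    obtain m' where m': "m = Suc m'" using k by (cases m) auto
    have "T (unit_vec m') i \<in> R" for i
      by (rule int_subst_mem[OF R_ring]) (use T(1) conj_ringD(1,2)[OF R_ring] in \<open>auto simp: unimod_def unit_vec_def\<close>)
    moreover have "\<exists>i<m. unit_vec m' i \<noteq> 0" unfolding m' unit_vec_def by auto
    then have "\<exists>i<m. T (unit_vec m') i \<noteq> 0" by (rule unimod_nonzero[OF T(1)])
    ultimately have "min_bound N \<le> \<phi> (T (unit_vec m'))" using large by blast
    also have "\<dots> = h m'" unfolding T(3) m' triform_Suc by (simp add: triform_unit_vec tricoord_unit_vec)
    also have "\<dots> \<le> Q * h k" unfolding Q_def by (rule hkz_reduced_ratio[OF T(2)]) (use k m m' in auto)
    finally have "Q * (D\<^sup>2 * Q\<^sup>2) \<le> Q * h k" unfolding min_bound_def D_def Q_def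
      by (simp add: power2_eq_square power3_eq_cube algebra_simps)
    then show ?thesis using Q by simp
  qed
  have "norm_sum R m r (\<lambda>x. \<phi> (T x))"
    by (rule norm_sum_subst[OF R_ring \<phi>]) (use T(1) in \<open>auto simp: unimod_def int_subst_def\<close>)
  then have hR: "hform R m (\<lambda>x. \<phi> (T x))" by (rule norm_sum_hform[OF _ R_ring])
  have "norm_sum R m (m * (12 * N + 5)) (\<lambda>x. \<phi> (T x))"
  proof (rule norm_sum_of_triform_bounds[OF m, where P = "(B * N)\<^sup>2" and h = h and u = u, OF _ _ _ _ le_refl hR])
    fix k assume k: "k < m"
    have "2 * (2 * (2 * B\<^sup>2 * N + 2))\<^sup>2 \<le> 2 * (8 * (B\<^sup>2 * N))\<^sup>2" using BN by (intro mult_left_mono power_mono) (auto simp: mult.commute)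
    also have "\<dots> \<le> (624 * (B\<^sup>2 * N))\<^sup>2" by (simp add: power_mult_distrib)
    also have "\<dots> \<le> D\<^sup>2" using D BN by (intro power_mono) auto
    also have "\<dots> \<le> D\<^sup>2 * Q\<^sup>2" using Q by (simp add: mult_le_cancel_left1)
    finally show "2 * (2 * (2 * B\<^sup>2 * N + 2))\<^sup>2 \<le> h k" using h_low[OF k] by simp
  next
    fix k x assume "k \<le> m"
    then show "(\<Sum>j<k. (cmod (x j))\<^sup>2) \<le> (B * real N)\<^sup>2 * (\<Sum>j<k. (cmod (tricoord u j x))\<^sup>2)"
      by (rule hkz_reduced_coordinates[OF T(2) _ m(1)])
  next
    fix j k assume jk: "j < k" "k < m"
    \<comment> \<open>Hence \<open>D * Q * sqrt (h k) \<le> h k \<le> Q * h j\<close>, and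
      \<open>Q\<close> cancels.\<close>
    have "(D * Q)\<^sup>2 \<le> h k" using h_low[OF jk(2)] by (simp add: power_mult_distrib)
    then have "D * Q \<le> sqrt (h k)" by (rule real_le_rsqrt)
    then have "D * Q * sqrt (h k) \<le> sqrt (h k) * sqrt (h k)" using hpos[OF jk(2)] by (intro mult_right_mono) auto
    also have "\<dots> = h k" using hpos[OF jk(2)] by simp
    also have "\<dots> \<le> Q * h j" unfolding Q_def by (rule hkz_reduced_ratio[OF T(2)]) (use jk m in auto)
    finally have "Q * (D * sqrt (h k)) \<le> Q * h j" by (simp add: algebra_simps)
    then have "D * sqrt (h k) \<le> h j" using Q by simp
    moreover have "624 * (real N)^3 * B^4 * (B * real N)\<^sup>2 = D" unfolding D_def gap_def by (simp add: eval_nat_numeral)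
    ultimately show "624 * (real N)^3 * B^4 * (B * real N)\<^sup>2 * sqrt (h k) \<le> h j" by simp
  next
    fix x
    have nn: "triform h u m x \<ge> 0" by (rule triform_nonneg) (use hpos in \<open>auto simp: less_imp_le\<close>)
    have "1/2 + real m / (2 * real N) \<le> 1" using m by (simp add: field_simps)
    then show "(1/2 + real m / (2 * real N)) * triform h u m x \<le> \<phi> (T x)"
      unfolding T(3) using mult_right_mono[OF _ nn, of _ 1] by simp
  qed (simp_all add: T(3))
  then show ?thesis by (rule norm_sum_unimod[OF R_ring T(1)])
qed

text \<open>Norms per variable in either case: fewer than \<open>min_bound N\<close> are spent when
  a small value removes a variable, and \<open>12 * N + 5\<close> when the minimum is large. The sum
  covers both.\<close>

definition bound_const :: "nat \<Rightarrow> nat" where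
  "bound_const N = nat \<lceil>min_bound N\<rceil> + 12 * N + 5"

text \<open>\<open>N\<close> stays fixed while \<open>m\<close> decreases, so one threshold serves
  all stages. A small value removes one variable and leaves the rest to the induction; a large
  minimum settles all remaining variables at once.\<close>

theorem norm_sum_bounded:
  "m \<le> N \<Longrightarrow> norm_sum R m r \<phi> \<Longrightarrow> norm_sum R m (m * bound_const N) \<phi>"
proof (induction m arbitrary: r \<phi>)
  case 0
  then have "\<phi> = (\<lambda>x. 0)" by (auto dest: norm_sum_0)
  then show ?case by (simp add: norm_sum.zero)
next
  case (Suc m)
  have N: "0 < N" using Suc.prems by simp
  show ?case
  proof (cases "\<forall>x. (\<forall>i. x i \<in> R) \<longrightarrow> (\<exists>i<Suc m. x i \<noteq> 0) \<longrightarrow> min_bound N \<le> \<phi> x")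
    case True
    then have "norm_sum R (Suc m) (Suc m * (12 * N + 5)) \<phi>"
      by (intro norm_sum_of_large_minimum[OF Suc.prems(2,1) N]) blast
    then show ?thesis by (rule norm_sum_pad[OF R_ring]) (intro mult_le_mono2, simp add: bound_const_def)
  next
    case False
    then obtain x where x: "\<And>i. x i \<in> R" "\<exists>i<Suc m. x i \<noteq> 0" "\<phi> x < min_bound N" by force
    obtain T T' g where T: "unimod R (Suc m) T T'" "g \<in> R" "\<And>i. i < Suc m \<Longrightarrow> x i = g * T (unit_vec m) i"
      using unimod_completion[of x m, OF x(1)] by blast
    have "g \<noteq> 0" using x(2) T(3) by auto
    then have g: "1 \<le> (cmod g)\<^sup>2" using R_norm_ge_1[OF T(2)] by simp
    have "\<phi> x = \<phi> (\<lambda>i. g * T (unit_vec m) i)" by (rule norm_sum_cong[OF Suc.prems(2) T(3)])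
    also have "\<dots> = (cmod g)\<^sup>2 * \<phi> (T (unit_vec m))" by (rule norm_sum_hom[OF Suc.prems(2)])
    also have "\<dots> \<ge> 1 * \<phi> (T (unit_vec m))" by (rule mult_right_mono[OF g norm_sum_nonneg[OF Suc.prems(2)]])
    finally have small: "\<phi> (T (unit_vec m)) < min_bound N" using x(3) by simp
    have "norm_sum R (Suc m) r (\<lambda>x. \<phi> (T x))"
      by (rule norm_sum_subst[OF R_ring Suc.prems(2)]) (use T(1) in \<open>auto simp: unimod_def int_subst_def\<close>)
    then obtain r1 \<phi>1 r2 \<phi>2 where s: "norm_sum R (Suc m) r1 \<phi>1" "real r1 \<le> \<phi> (T (unit_vec m))"
      "norm_sum R m r2 \<phi>2" "(\<lambda>x. \<phi> (T x)) = (\<lambda>x. \<phi>1 x + \<phi>2 x)" using norm_sum_split by blast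
    have "norm_sum R m (m * bound_const N) \<phi>2" by (rule Suc.IH[OF _ s(3)]) (use Suc.prems in simp)
    then have "norm_sum R (Suc m) (m * bound_const N) \<phi>2" by (rule norm_sum_mono[OF R_ring]) simp
    then have "norm_sum R (Suc m) (r1 + m * bound_const N) (\<lambda>x. \<phi>1 x + \<phi>2 x)" by (rule norm_sum_add[OF _ s(1)])
    then have 1: "norm_sum R (Suc m) (r1 + m * bound_const N) (\<lambda>x. \<phi> (T x))" unfolding s(4) .
    have "real r1 \<le> min_bound N" using s(2) small by simp
    then have "r1 \<le> bound_const N" unfolding bound_const_def by linarith
    then have "r1 + m * bound_const N \<le> Suc m * bound_const N" by simp
    then have "norm_sum R (Suc m) (Suc m * bound_const N) (\<lambda>x. \<phi> (T x))" by (rule norm_sum_pad[OF R_ring 1])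
    then show ?thesis by (rule norm_sum_unimod[OF R_ring T(1)])
  qed
qed

end

section \<open>Imaginary quadratic fields\<close>

lemma cring_complex_ring: "cring complex_ring"
proof (rule cringI)
  show "abelian_group complex_ring"
    by (rule abelian_groupI) (auto simp: complex_ring_def add.assoc intro: exI[of _ "- _"] ab_left_minus)
  show "comm_monoid complex_ring"
    by (rule comm_monoidI) (auto simp: complex_ring_def)
qed (auto simp: complex_ring_def algebra_simps)

lemma ring_complex_ring: "ring complex_ring"
  using cring_complex_ring by (rule cring.axioms)

lemma complex_ring_minus: "a_inv complex_ring x = - x"
  using abelian_group.minus_equality[OF ring.is_abelian_group[OF ring_complex_ring], of "- x" x] by (simp add: complex_ring_def)

lemma subfield_complex_ring:
  assumes "subfield E complex_ring"
  shows "0 \<in> E" "1 \<in> E" "x \<in> E \<Longrightarrow> y \<in> E \<Longrightarrow> x + y \<in> E" "x \<in> E \<Longrightarrow> y \<in> E \<Longrightarrow> x * y \<in> E"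
    "x \<in> E \<Longrightarrow> - x \<in> E" "x \<in> E \<Longrightarrow> y \<in> E \<Longrightarrow> x - y \<in> E" "x \<in> E \<Longrightarrow> inverse x \<in> E"
proof -
  have "subring E complex_ring" using assms by (simp add: subfield_def subdomain_def subcring_def)
  note E = subringE[OF this]
  show 0: "0 \<in> E" and "1 \<in> E" and add: "x \<in> E \<Longrightarrow> y \<in> E \<Longrightarrow> x + y \<in> E" and "x \<in> E \<Longrightarrow> y \<in> E \<Longrightarrow> x * y \<in> E" for x y
    using E(2,3) E(7)[of x y] E(6)[of x y] by (simp_all add: complex_ring_def)
  show minus: "x \<in> E \<Longrightarrow> - x \<in> E" for x using E(5)[of x] by (simp add: complex_ring_minus)
  show "x \<in> E \<Longrightarrow> y \<in> E \<Longrightarrow> x - y \<in> E" using add[of x "- y"] minus[of y] by simp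
  show "inverse x \<in> E" if "x \<in> E"
  proof (cases "x = 0")
    case False
    then have "x \<in> Units (complex_ring\<lparr>carrier := E\<rparr>)"
      using subfield.subfield_Units[OF assms] that by (simp add: complex_ring_def)
    then obtain y where "y \<in> E" "x * y = 1" unfolding Units_def by (auto simp: complex_ring_def)
    then show ?thesis by (metis inverse_unique)
  qed (use 0 in simp)
qed

lemma subfield_Rats:
  assumes "subfield E complex_ring" "x \<in> \<rat>" shows "x \<in> E"
proof -
  note EI = subfield_complex_ring[OF assms(1)]
  have n: "of_nat n \<in> E" for n by (induction n) (use EI in auto)
  then have z: "of_int k \<in> E" for k by (cases k) (use EI(5)[OF n[of "Suc _"]] in \<open>auto simp del: of_nat_Suc\<close>)
  obtain a b :: int where "x = of_int a / of_int b" using assms(2) by (cases rule: Rats_cases') auto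
  then show ?thesis using EI(4)[OF z[of a] EI(7)[OF z[of b]]] by (simp add: divide_inverse)
qed

lemma ring_hom_fixes_rat:
  assumes add: "\<And>x y. x \<in> E \<Longrightarrow> y \<in> E \<Longrightarrow> \<sigma> (x + y) = \<sigma> x + \<sigma> y"
    and mult: "\<And>x y. x \<in> E \<Longrightarrow> y \<in> E \<Longrightarrow> \<sigma> (x * y) = \<sigma> x * \<sigma> y" and one: "\<sigma> 1 = (1::complex)"
    and E: "\<rat> \<subseteq> E" and x: "x \<in> \<rat>"
  shows "\<sigma> x = x"
proof -
  have Q: "y \<in> \<rat> \<Longrightarrow> y \<in> E" for y using E by blast
  have zero: "\<sigma> 0 = 0" using add[of 0 0] Q by simp
  have nat: "\<sigma> (of_nat n) = of_nat n" for n
    by (induction n) (use zero one add Q in auto)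
  have minus: "\<sigma> (- of_nat n) = - of_nat n" for n
  proof -
    have "\<sigma> (of_nat n + - of_nat n) = \<sigma> (of_nat n) + \<sigma> (- of_nat n)" by (rule add) (use Q in auto)
    then show ?thesis using zero nat by (simp add: eq_neg_iff_add_eq_0 add.commute)
  qed
  have int: "\<sigma> (of_int k) = of_int k" for k
    by (cases k) (use nat minus[of "Suc _"] in \<open>auto simp del: of_nat_Suc\<close>)
  obtain a b :: int where ab: "b > 0" "x = of_int a / of_int b" using x by (cases rule: Rats_cases') auto
  have "\<sigma> (of_int b * x) = \<sigma> (of_int b) * \<sigma> x" by (rule mult) (use Q x in auto)
  moreover have "of_int b * x = of_int a" using ab by simp
  ultimately have "of_int b * \<sigma> x = of_int b * x" using int by metis
  then show ?thesis using ab(1) by simp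
qed

lemma field_autsD:
  assumes "\<sigma> \<in> field_auts E"
  shows "x \<in> E \<Longrightarrow> y \<in> E \<Longrightarrow> \<sigma> (x + y) = \<sigma> x + \<sigma> y" "x \<in> E \<Longrightarrow> y \<in> E \<Longrightarrow> \<sigma> (x * y) = \<sigma> x * \<sigma> y" "\<sigma> 1 = 1"
    "\<sigma> \<in> extensional E"
proof -
  have h: "\<sigma> \<in> ring_hom (complex_ring\<lparr>carrier := E\<rparr>) (complex_ring\<lparr>carrier := E\<rparr>)" "\<sigma> \<in> extensional E"
    using assms unfolding field_auts_def ring_iso_def by auto
  show "x \<in> E \<Longrightarrow> y \<in> E \<Longrightarrow> \<sigma> (x + y) = \<sigma> x + \<sigma> y" "\<sigma> 1 = 1" "\<sigma> \<in> extensional E"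
    "x \<in> E \<Longrightarrow> y \<in> E \<Longrightarrow> \<sigma> (x * y) = \<sigma> x * \<sigma> y"
    using ring_hom_add[OF h(1), of x y] ring_hom_mult[OF h(1), of x y] ring_hom_one[OF h(1)] h(2)
    by (simp_all add: complex_ring_def)
qed

text \<open>Every power of the denominator \<open>b\<close> divides the fixed \<open>m\<close>;
  since \<open>2 ^ m > m\<close>, this forces \<open>b = 1\<close>.\<close>

lemma rational_of_bounded_denominators:
  assumes "(q::real) \<in> \<rat>" "(m::int) > 0" "\<And>k::nat. of_int m * q ^ k \<in> \<int>"
  shows "q \<in> \<int>"
proof -
  obtain a b :: int where ab: "b > 0" "coprime a b" "q = of_int a / of_int b" using assms(1) by (cases rule: Rats_cases') auto
  have "b ^ k dvd m" for k
  proof -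
    obtain z where "of_int m * q ^ k = of_int z" using assms(3) by (auto elim: Ints_cases)
    then have "real_of_int (m * a ^ k) = real_of_int (z * b ^ k)" using ab(1,3) by (simp add: power_divide field_simps)
    then have "m * a ^ k = z * b ^ k" by linarith
    then have "b ^ k dvd m * a ^ k" by simp
    moreover have "coprime (b ^ k) (a ^ k)" using ab(2) by (simp add: coprime_commute)
    ultimately show ?thesis by (simp add: coprime_dvd_mult_left_iff)
  qed
  then have le: "b ^ nat m \<le> m" using assms(2) zdvd_imp_le by blast
  have "b = 1"
  proof (rule ccontr)
    assume "b \<noteq> 1"
    then have "2 ^ nat m \<le> b ^ nat m" using ab(1) by (intro power_mono) auto
    moreover have "int (nat m) < 2 ^ nat m" using less_exp[of "nat m"] by (metis of_nat_less_iff of_nat_numeral of_nat_power)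
    ultimately show False using le assms(2) by simp
  qed
  then show ?thesis using ab(3) by simp
qed

text \<open>A purely imaginary generator with integral square. \<open>D\<close> may have square
  factors, so \<open>\<delta>\<close> need not generate the ring of integers.\<close>

locale imaginary_quadratic =
  fixes E :: "complex set" and \<delta> :: complex and D :: int
  assumes subfield: "subfield E complex_ring"
    and \<delta>: "\<delta> \<in> E" "\<delta> \<notin> \<real>" "cnj \<delta> = - \<delta>" "\<delta>\<^sup>2 = of_int D"
    and E_eq: "\<And>z. z \<in> E \<Longrightarrow> \<exists>p\<in>\<rat>. \<exists>q\<in>\<rat>. z = p + q * \<delta>"
begin

lemmas EI = subfield_complex_ring[OF subfield]

lemma Rats_E: "x \<in> \<rat> \<Longrightarrow> x \<in> E"
  by (rule subfield_Rats[OF subfield])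

lemma cnj_Rats: "x \<in> \<rat> \<Longrightarrow> cnj x = x"
  by (auto elim!: Rats_cases')

lemma E_cnj: "z \<in> E \<Longrightarrow> cnj z \<in> E"
proof -
  assume "z \<in> E"
  then obtain p q where pq: "p \<in> \<rat>" "q \<in> \<rat>" "z = p + q * \<delta>" using E_eq by blast
  then have "cnj z = p - q * \<delta>" by (simp add: cnj_Rats \<delta>(3))
  then show ?thesis using pq Rats_E EI \<delta>(1) by simp
qed

lemma E_conj_ring: "conj_ring E"
  unfolding conj_ring_def by (intro conjI ballI EI(1-4) EI(6) E_cnj)

lemma Im_\<delta>: "Im \<delta> \<noteq> 0" "Re \<delta> = 0"
  using \<delta>(2,3) by (auto simp: complex_is_Real_iff complex_eq_iff)

lemma E_real: "z \<in> E \<Longrightarrow> z \<in> \<real> \<Longrightarrow> z \<in> \<rat>"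
proof -
  assume z: "z \<in> E" "z \<in> \<real>"
  then obtain p q where pq: "p \<in> \<rat>" "q \<in> \<rat>" "z = p + q * \<delta>" using E_eq by blast
  have "Im p = 0" "Im q = 0" using pq(1,2) by (auto elim!: Rats_cases')
  then have "Re q * Im \<delta> = 0" using z(2) pq(3) by (auto simp: complex_is_Real_iff)
  then have "q = 0" using Im_\<delta> \<open>Im q = 0\<close> by (auto simp: complex_eq_iff)
  then show ?thesis using pq by simp
qed

text \<open>The order generated by \<open>\<delta>\<close>. It can be smaller than the ring of
  integers and is the reference for bounded denominators.\<close>

definition M :: "complex set" where
  "M = {z. \<exists>a\<in>\<int>. \<exists>b\<in>\<int>. z = a + b * \<delta>}"

lemma M_I: "a \<in> \<int> \<Longrightarrow> b \<in> \<int> \<Longrightarrow> a + b * \<delta> \<in> M"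
  unfolding M_def by auto

lemma M_Ints: "a \<in> \<int> \<Longrightarrow> a \<in> M" using M_I[of a 0] by simp

lemma M_add: "x \<in> M \<Longrightarrow> y \<in> M \<Longrightarrow> x + y \<in> M"
proof -
  assume "x \<in> M" "y \<in> M"
  then obtain a b a' b' where ab: "a \<in> \<int>" "b \<in> \<int>" "x = a + b * \<delta>" "a' \<in> \<int>" "b' \<in> \<int>" "y = a' + b' * \<delta>" unfolding M_def by blast
  then show ?thesis using M_I[of "a + a'" "b + b'"] by (simp add: algebra_simps)
qed

lemma M_mult: "x \<in> M \<Longrightarrow> y \<in> M \<Longrightarrow> x * y \<in> M"
proof -
  assume "x \<in> M" "y \<in> M"
  then obtain a b a' b' where ab: "a \<in> \<int>" "b \<in> \<int>" "x = a + b * \<delta>" "a' \<in> \<int>" "b' \<in> \<int>" "y = a' + b' * \<delta>" unfolding M_def by blast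
  have "x * y = a * a' + b * b' * \<delta>\<^sup>2 + (a * b' + a' * b) * \<delta>" unfolding ab by (simp add: algebra_simps power2_eq_square)
  also have "\<dots> = (a * a' + b * b' * of_int D) + (a * b' + a' * b) * \<delta>" unfolding \<delta>(4) ..
  finally show ?thesis using ab M_I[of "a * a' + b * b' * of_int D" "a * b' + a' * b"] by simp
qed

lemma M_sum: "(\<And>i. i \<in> A \<Longrightarrow> f i \<in> M) \<Longrightarrow> sum f A \<in> M"
  by (induction A rule: infinite_finite_induct) (auto intro: M_add M_Ints)

lemma M_denominator: "z \<in> E \<Longrightarrow> \<exists>k::nat. k > 0 \<and> of_nat k * z \<in> M"
proof -
  assume "z \<in> E"
  then obtain p q where pq: "p \<in> \<rat>" "q \<in> \<rat>" "z = p + q * \<delta>" using E_eq by blast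
  obtain a b :: int where ab: "b > 0" "p = of_int a / of_int b" using pq(1) by (cases rule: Rats_cases') auto
  obtain c d :: int where cd: "d > 0" "q = of_int c / of_int d" using pq(2) by (cases rule: Rats_cases') auto
  have "of_nat (nat (b * d)) = (of_int (b * d) :: complex)" using ab(1) cd(1) by simp
  then have "of_nat (nat (b * d)) * z = of_int (a * d) + of_int (c * b) * \<delta>" unfolding pq(3) ab(2) cd(2)
    using ab(1) cd(1) by (simp add: field_simps)
  then have "of_nat (nat (b * d)) * z \<in> M" using M_I by simp
  then show ?thesis using ab(1) cd(1) by (intro exI[of _ "nat (b * d)"]) auto
qed

text \<open>Almost integrality is equivalent to being an algebraic integer here, and unlike the latter it is
  evidently closed under sums and products.\<close>

definition alm_int :: "complex \<Rightarrow> bool" where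
  "alm_int x \<longleftrightarrow> x \<in> E \<and> (\<exists>d::nat. d > 0 \<and> (\<forall>k. of_nat d * x ^ k \<in> M))"

text \<open>Let \<open>d\<close> clear the denominators of all powers below the degree of a monic
  equation; the equation then expresses each higher power by lower ones with integer coefficients,
  so \<open>d\<close> clears them all.\<close>

lemma alm_int_of_algebraic_int:
  assumes "x \<in> E" "algebraic_int x" shows "alm_int x"
proof -
  obtain p where p: "lead_coeff p = 1" "\<forall>i. Polynomial.coeff p i \<in> \<int>" "poly p x = 0"
    using assms(2) by (auto elim: algebraic_int.cases)
  define n where "n = degree p"
  have E: "x ^ k \<in> E" for k by (induction k) (use assms(1) EI in auto)
  obtain d :: nat where d: "d > 0" "\<forall>i<n. of_nat d * x ^ i \<in> M"
    using common_denominator[of "\<lambda>i. x ^ i" M n] M_denominator[OF E] M_mult[OF M_Ints] by auto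
  have "of_nat d * x ^ k \<in> M" for k
  proof (induction k rule: less_induct)
    case (less k)
    show ?case
    proof (cases "k < n")
      case False
      have "0 = (\<Sum>i\<le>n. Polynomial.coeff p i * x ^ i)" using p(3) unfolding n_def by (simp add: poly_altdef)
      also have "\<dots> = (\<Sum>i<n. Polynomial.coeff p i * x ^ i) + x ^ n" using p(1) unfolding n_def lessThan_Suc_atMost[symmetric] by simp
      finally have xn: "x ^ n = - (\<Sum>i<n. Polynomial.coeff p i * x ^ i)" by (simp add: eq_neg_iff_add_eq_0 add.commute)
      have "x ^ k = x ^ (k - n) * x ^ n" using False by (simp add: power_add[symmetric])
      then have "of_nat d * x ^ k = (\<Sum>i<n. - Polynomial.coeff p i * (of_nat d * x ^ (i + (k - n))))"
        unfolding xn by (simp add: sum_distrib_left sum_negf power_add algebra_simps)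
      also have "\<dots> \<in> M"
      proof (rule M_sum)
        fix i assume i: "i \<in> {..<n}"
        have "- Polynomial.coeff p i \<in> M" using p(2) by (auto intro: M_Ints)
        moreover have "of_nat d * x ^ (i + (k - n)) \<in> M" by (rule less) (use False i in auto)
        ultimately show "- Polynomial.coeff p i * (of_nat d * x ^ (i + (k - n))) \<in> M" by (rule M_mult)
      qed
      finally show ?thesis .
    qed (use d in blast)
  qed
  then show ?thesis using assms(1) d(1) unfolding alm_int_def by blast
qed

lemma alm_int_add: assumes "alm_int x" "alm_int y" shows "alm_int (x + y)"
proof -
  obtain d e where d: "d > 0" "\<And>k. of_nat d * x ^ k \<in> M" and e: "e > 0" "\<And>k. of_nat e * y ^ k \<in> M"
    using assms unfolding alm_int_def by blast
  have "of_nat (d * e) * (x + y) ^ k \<in> M" for k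
  proof -
    have "of_nat (d * e) * (x + y) ^ k = (\<Sum>i\<le>k. of_nat (k choose i) * ((of_nat d * x ^ i) * (of_nat e * y ^ (k - i))))"
      unfolding binomial_ring by (simp add: sum_distrib_left algebra_simps)
    also have "\<dots> \<in> M" by (intro M_sum M_mult d e M_Ints) auto
    finally show ?thesis .
  qed
  then show ?thesis using assms d(1) e(1) EI(3) unfolding alm_int_def by (metis nat_0_less_mult_iff)
qed

lemma alm_int_mult: assumes "alm_int x" "alm_int y" shows "alm_int (x * y)"
proof -
  obtain d e where d: "d > 0" "\<And>k. of_nat d * x ^ k \<in> M" and e: "e > 0" "\<And>k. of_nat e * y ^ k \<in> M"
    using assms unfolding alm_int_def by blast
  have "of_nat (d * e) * (x * y) ^ k \<in> M" for k
    using M_mult[OF d(2)[of k] e(2)[of k]] by (simp add: power_mult_distrib algebra_simps)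
  then show ?thesis using assms d(1) e(1) EI(4) unfolding alm_int_def by (metis nat_0_less_mult_iff)
qed

lemma cnj_M: "x \<in> M \<Longrightarrow> cnj x \<in> M"
proof -
  assume "x \<in> M"
  then obtain a b where ab: "a \<in> \<int>" "b \<in> \<int>" "x = a + b * \<delta>" unfolding M_def by blast
  then have "cnj x = a + (- b) * \<delta>" using \<delta>(3) by (auto elim!: Ints_cases)
  then show ?thesis using M_I[of a "- b"] ab by simp
qed

lemma M_real: "x \<in> M \<Longrightarrow> x \<in> \<real> \<Longrightarrow> x \<in> \<int>"
proof -
  assume x: "x \<in> M" "x \<in> \<real>"
  then obtain a b where ab: "a \<in> \<int>" "b \<in> \<int>" "x = a + b * \<delta>" unfolding M_def by blast
  have "Im a = 0" "Im b = 0" using ab(1,2) by (auto elim!: Ints_cases)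
  then have "Re b * Im \<delta> = 0" using x(2) ab(3) by (auto simp: complex_is_Real_iff)
  then have "b = 0" using Im_\<delta> \<open>Im b = 0\<close> by (auto simp: complex_eq_iff)
  then show ?thesis using ab by simp
qed

lemma alm_int_real:
  assumes "alm_int x" "x \<in> \<real>" shows "x \<in> \<int>"
proof -
  obtain d :: nat where d: "d > 0" "\<And>k. of_nat d * x ^ k \<in> M" and xE: "x \<in> E" using assms unfolding alm_int_def by blast
  obtain r where r: "x = of_real r" using assms(2) by (auto elim: Reals_cases)
  have "x \<in> \<rat>" by (rule E_real[OF xE assms(2)])
  then have "r \<in> \<rat>" unfolding r by (auto elim!: Rats_cases' simp: complex_eq_iff)
  moreover have "of_int (int d) * r ^ k \<in> \<int>" for k
  proof -
    have "of_nat d * x ^ k \<in> \<int>" by (rule M_real[OF d(2)]) (auto simp: r)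
    then obtain z where "of_nat d * x ^ k = of_int z" by (auto elim: Ints_cases)
    then have "complex_of_real (of_nat d * r ^ k) = complex_of_real (of_int z)" unfolding r by simp
    then have "of_nat d * r ^ k = of_int z" using of_real_eq_iff by blast
    then show ?thesis by simp
  qed
  ultimately have "r \<in> \<int>" using rational_of_bounded_denominators[of r "int d"] d(1) by simp
  then show ?thesis unfolding r by (auto elim!: Ints_cases)
qed

lemma alm_int_cnj: "alm_int x \<Longrightarrow> alm_int (cnj x)"
  unfolding alm_int_def using E_cnj cnj_M by (metis complex_cnj_mult complex_cnj_of_nat complex_cnj_power)

lemma alm_int_M: "x \<in> M \<Longrightarrow> alm_int x"
proof -
  assume x: "x \<in> M"
  then obtain a b where ab: "a \<in> \<int>" "b \<in> \<int>" "x = a + b * \<delta>" unfolding M_def by blast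
  have "a \<in> E" "b \<in> E" using ab(1,2) Ints_subset_Rats by (auto intro!: Rats_E)
  then have "x \<in> E" unfolding ab(3) by (intro EI(3,4) \<delta>(1))
  moreover have "x ^ k \<in> M" for k by (induction k) (simp_all add: x M_mult M_Ints)
  ultimately show ?thesis unfolding alm_int_def by (intro conjI exI[of _ 1]) auto
qed

lemma alm_int_minus: "alm_int x \<Longrightarrow> alm_int (- x)"
  using alm_int_mult[OF alm_int_M[OF M_Ints[of "-1"]], of x] by simp

lemma alm_int_diff: "alm_int x \<Longrightarrow> alm_int y \<Longrightarrow> alm_int (x - y)"
  using alm_int_add[OF _ alm_int_minus, of x y] by simp

text \<open>Trace and norm of \<open>x\<close> are almost integral and real, hence integers, and
  they are the coefficients of a monic quadratic equation for \<open>x\<close>.\<close>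

lemma algebraic_int_of_alm_int:
  assumes "alm_int x" shows "algebraic_int x"
proof (rule algebraic_int.intros)
  let ?p = "[:x * cnj x, - (x + cnj x), 1:]"
  have "x + cnj x \<in> \<int>" by (rule alm_int_real[OF alm_int_add[OF assms alm_int_cnj[OF assms]]]) (simp add: complex_is_Real_iff)
  moreover have "x * cnj x \<in> \<int>" by (rule alm_int_real[OF alm_int_mult[OF assms alm_int_cnj[OF assms]]]) (simp add: complex_is_Real_iff)
  moreover have "- (x + cnj x) \<in> \<int>" by (rule Ints_minus) fact
  ultimately show "\<forall>i. Polynomial.coeff ?p i \<in> \<int>" by (auto simp: coeff_pCons split: nat.splits)
  show "lead_coeff ?p = 1" by simp
  show "poly ?p x = 0" by (simp add: algebra_simps)
qed

section \<open>The ring of integers, its ideals, and the automorphisms of the field\<close>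

abbreviation OE :: "complex set" where "OE \<equiv> ring_of_integers E"

lemma OE_iff: "x \<in> OE \<longleftrightarrow> alm_int x"
  using alm_int_of_algebraic_int algebraic_int_of_alm_int unfolding ring_of_integers_def alm_int_def by blast

lemma OE_conj_ring: "conj_ring OE"
  unfolding conj_ring_def
  by (intro conjI ballI) (simp_all add: OE_iff alm_int_add alm_int_mult alm_int_cnj alm_int_diff alm_int_M M_Ints)

lemma OE_ring: "ring (complex_ring\<lparr>carrier := OE\<rparr>)"
proof (rule ringI)
  have "\<exists>y\<in>OE. y + x = 0" if "x \<in> OE" for x
    using conj_ringD(7)[OF OE_conj_ring that] by (intro bexI[of _ "- x"]) auto
  then show "abelian_group (complex_ring\<lparr>carrier := OE\<rparr>)"
    by (intro abelian_groupI) (auto simp: complex_ring_def add.assoc conj_ringD[OF OE_conj_ring])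
  show "Group.monoid (complex_ring\<lparr>carrier := OE\<rparr>)"
    by (rule monoidI) (auto simp: complex_ring_def conj_ringD[OF OE_conj_ring])
qed (auto simp: complex_ring_def algebra_simps)

lemma ideal_OE_I:
  assumes "I \<subseteq> OE" "0 \<in> I" "\<And>x y. x \<in> I \<Longrightarrow> y \<in> I \<Longrightarrow> x + y \<in> I" "\<And>x y. x \<in> I \<Longrightarrow> y \<in> OE \<Longrightarrow> y * x \<in> I"
  shows "ideal I (complex_ring\<lparr>carrier := OE\<rparr>)"
proof (rule idealI[OF OE_ring])
  let ?Z = "complex_ring\<lparr>carrier := OE\<rparr>"
  have inv: "a_inv ?Z x = - x" if "x \<in> OE" for x
    using abelian_group.minus_equality[OF ring.is_abelian_group[OF OE_ring], of "- x" x] that conj_ringD(7)[OF OE_conj_ring that]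
    by (simp add: complex_ring_def)
  have minus: "- x \<in> I" if "x \<in> I" for x
    using assms(4)[OF that, of "- 1"] conj_ringD(2,7)[OF OE_conj_ring] by simp
  show "subgroup I (add_monoid ?Z)"
  proof (rule group.subgroupI)
    show "Group.group (add_monoid ?Z)" using ring.is_abelian_group[OF OE_ring] by (rule abelian_group.a_group)
    show "I \<subseteq> carrier (add_monoid ?Z)" using assms(1) by simp
    show "I \<noteq> {}" using assms(2) by blast
    show "inv\<^bsub>add_monoid ?Z\<^esub> a \<in> I" if "a \<in> I" for a
      using inv[of a] minus[OF that] that assms(1) unfolding a_inv_def by auto
    show "a \<otimes>\<^bsub>add_monoid ?Z\<^esub> b \<in> I" if "a \<in> I" "b \<in> I" for a b
      using assms(3)[OF that] by (simp add: complex_ring_def)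
  qed
  show "x \<otimes>\<^bsub>?Z\<^esub> a \<in> I" "a \<otimes>\<^bsub>?Z\<^esub> x \<in> I" if "a \<in> I" "x \<in> carrier ?Z" for a x
    using assms(4)[of a x] that by (simp_all add: complex_ring_def mult.commute)
qed

text \<open>\<open>I\<close> and \<open>OE\<close> have the same image, the only class. As
  \<open>OE\<close> lies in its own image, it is related to \<open>I\<close>, say
  \<open>a * I = b * OE\<close>; the generator is then \<open>b / a\<close>.\<close>

lemma principal_ideal:
  assumes "class_number E = 1" "I \<in> nonzero_ideals E"
  shows "\<exists>g\<in>I. \<forall>i\<in>I. \<exists>c\<in>OE. i = g * c"
proof -
  let ?A = "nonzero_ideals E" and ?r = "ideal_class_rel E"
  have one: "1 \<in> OE" and zero: "0 \<in> OE" using conj_ringD[OF OE_conj_ring] by auto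
  have "ideal OE (complex_ring\<lparr>carrier := OE\<rparr>)"
    by (rule ideal_OE_I) (auto intro: conj_ringD[OF OE_conj_ring])
  moreover have "OE \<noteq> {0}" using one by (metis singletonD zero_neq_one)
  ultimately have A: "OE \<in> ?A" unfolding nonzero_ideals_def by auto
  obtain X where X: "?A // ?r = {X}" using assms(1) unfolding class_number_def by (auto simp: card_1_singleton_iff)
  have "?r `` {I} = X" "?r `` {OE} = X" using quotientI[OF assms(2), of ?r] quotientI[OF A, of ?r] X by auto
  moreover have "(OE, OE) \<in> ?r" 
    unfolding ideal_class_rel_def using A one by (auto intro!: bexI[of _ 1])
  ultimately have "(I, OE) \<in> ?r" by blast
  then obtain a b where ab: "a \<in> OE - {0}" "b \<in> OE - {0}" "(\<lambda>x. a * x) ` I = (\<lambda>x. b * x) ` OE"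
    unfolding ideal_class_rel_def by blast
  have "b * 1 \<in> (\<lambda>x. a * x) ` I" unfolding ab(3) using one by blast
  then obtain g where g: "g \<in> I" "b = a * g" by auto
  have "\<exists>c\<in>OE. i = g * c" if "i \<in> I" for i
  proof -
    have "a * i \<in> (\<lambda>x. b * x) ` OE" unfolding ab(3)[symmetric] using that by blast
    then obtain c where "c \<in> OE" "a * i = b * c" by auto
    then show ?thesis using g(2) ab(1) by auto
  qed
  then show ?thesis using g(1) by blast
qed

lemma OE_bezout:
  assumes "class_number E = 1" "a \<in> OE" "b \<in> OE"
  shows "\<exists>g\<in>OE. \<exists>x\<in>OE. \<exists>y\<in>OE. \<exists>c\<in>OE. \<exists>d\<in>OE. g = x * a + y * b \<and> a = g * c \<and> b = g * d"
proof -
  note O = conj_ringD[OF OE_conj_ring]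
  define I where "I = {x * a + y * b |x y. x \<in> OE \<and> y \<in> OE}"
  have I: "x * a + y * b \<in> I" if "x \<in> OE" "y \<in> OE" for x y using that unfolding I_def by blast
  have aI: "a \<in> I" and bI: "b \<in> I" using I[of 1 0] I[of 0 1] O(1,2) by auto
  have "ideal I (complex_ring\<lparr>carrier := OE\<rparr>)"
  proof (rule ideal_OE_I)
    show "I \<subseteq> OE" unfolding I_def using O assms by auto
    show "0 \<in> I" using I[OF O(1) O(1)] by simp
    show "p + q \<in> I" if pq: "p \<in> I" "q \<in> I" for p q
    proof -
      obtain x y x' y' where xy: "x \<in> OE" "y \<in> OE" "p = x * a + y * b" "x' \<in> OE" "y' \<in> OE" "q = x' * a + y' * b"
        using pq unfolding I_def by blast
      have "p + q = (x + x') * a + (y + y') * b" unfolding xy by (simp add: algebra_simps)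
      then show ?thesis using I[OF O(3)[OF xy(1,4)] O(3)[OF xy(2,5)]] by simp
    qed
    show "r * p \<in> I" if pq: "p \<in> I" "r \<in> OE" for p r
    proof -
      obtain x y where xy: "x \<in> OE" "y \<in> OE" "p = x * a + y * b" using pq unfolding I_def by blast
      have "r * p = (r * x) * a + (r * y) * b" unfolding xy by (simp add: algebra_simps)
      then show ?thesis using I[OF O(5)[OF pq(2) xy(1)] O(5)[OF pq(2) xy(2)]] by simp
    qed
  qed
  \<comment> \<open>For \<open>a = b = 0\<close> the ideal is zero and has no class; then 0
    generates it.\<close>
  then have I_ideal: "I = {0} \<or> I \<in> nonzero_ideals E" unfolding nonzero_ideals_def by auto
  have "\<exists>g\<in>I. \<forall>i\<in>I. \<exists>c\<in>OE. i = g * c"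
    using I_ideal principal_ideal[OF assms(1)] O(1) by force
  then obtain g where g: "g \<in> I" "\<And>i. i \<in> I \<Longrightarrow> \<exists>c\<in>OE. i = g * c" by blast
  obtain x y where xy: "x \<in> OE" "y \<in> OE" "g = x * a + y * b" using g(1) unfolding I_def by blast
  have "g \<in> OE" unfolding xy(3) by (intro O(3) O(5) xy assms)
  then show ?thesis using g(2)[OF aI] g(2)[OF bI] xy by blast
qed

text \<open>Rational numbers are fixed, so \<open>\<delta>\<close> goes to a square root of the
  rational number \<open>\<delta>\<^sup>2\<close>, that is, to \<open>\<delta>\<close> or
  \<open>- \<delta>\<close>.\<close>

lemma field_auts_cases:
  assumes "\<sigma> \<in> field_auts E"
  shows "\<sigma> = (\<lambda>x\<in>E. x) \<or> \<sigma> = (\<lambda>x\<in>E. cnj x)"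
proof -
  note s = field_autsD[OF assms]
  have rat: "\<sigma> p = p" if "p \<in> \<rat>" for p
    by (rule ring_hom_fixes_rat[of E]) (use s that Rats_E in auto)
  have "\<sigma> \<delta> * \<sigma> \<delta> = \<sigma> (\<delta> * \<delta>)" using s(2)[OF \<delta>(1) \<delta>(1)] by simp
  also have "\<dots> = \<delta> * \<delta>" using \<delta>(4) rat[of "of_int D"] by (simp add: power2_eq_square)
  finally have "\<sigma> \<delta> = \<delta> \<or> \<sigma> \<delta> = - \<delta>" by (simp add: square_eq_iff)
  moreover have val: "\<sigma> (p + q * \<delta>) = p + q * \<sigma> \<delta>" if "p \<in> \<rat>" "q \<in> \<rat>" for p q
    using s(1)[of p "q * \<delta>"] s(2)[of q \<delta>] rat that Rats_E EI(4) \<delta>(1) by simp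
  ultimately show ?thesis
  proof (elim disjE)
    assume *: "\<sigma> \<delta> = \<delta>"
    have "\<sigma> z = z" if z: "z \<in> E" for z
    proof -
      obtain p q where "p \<in> \<rat>" "q \<in> \<rat>" "z = p + q * \<delta>" using E_eq z by blast
      then show ?thesis using val * by simp
    qed
    then have "\<sigma> = (\<lambda>x\<in>E. x)" by (intro extensionalityI[OF s(4)]) auto
    then show ?thesis ..
  next
    assume *: "\<sigma> \<delta> = - \<delta>"
    have "\<sigma> z = cnj z" if z: "z \<in> E" for z
    proof -
      obtain p q where "p \<in> \<rat>" "q \<in> \<rat>" "z = p + q * \<delta>" using E_eq z by blast
      then show ?thesis using val * \<delta>(3) cnj_Rats by simp
    qed
    then have "\<sigma> = (\<lambda>x\<in>E. cnj x)" by (intro extensionalityI[OF s(4)]) auto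
    then show ?thesis ..
  qed
qed

lemma star_eq: "star E = (\<lambda>x\<in>E. cnj x)"
proof -
  have ne: "(\<lambda>x\<in>E. cnj x) \<noteq> (\<lambda>x\<in>E. x)"
  proof
    assume "(\<lambda>x\<in>E. cnj x) = (\<lambda>x\<in>E. x)"
    then have "cnj \<delta> = \<delta>" using \<delta>(1) by (metis restrict_apply')
    then show False using \<delta>(2) Reals_cnj_iff by blast
  qed
  have "bij_betw (\<lambda>x\<in>E. cnj x) E E"
    by (rule bij_betw_byWitness[where f' = cnj]) (use E_cnj in auto)
  then have mem: "(\<lambda>x\<in>E. cnj x) \<in> field_auts E"
    unfolding field_auts_def ring_iso_def ring_hom_def complex_ring_def using E_cnj EI by auto
  have "\<delta> \<notin> \<rat>" using \<delta>(2) by (auto elim!: Rats_cases')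
  then have "E \<noteq> \<rat>" using \<delta>(1) by blast
  then have "star E = (THE \<sigma>. \<sigma> \<in> field_auts E \<and> \<sigma> \<noteq> (\<lambda>x\<in>E. x))" unfolding star_def by simp
  also have "\<dots> = (\<lambda>x\<in>E. cnj x)"
    by (rule the_equality) (use mem ne field_auts_cases in auto)
  finally show ?thesis .
qed

lemma field_auts_norm: "\<sigma> \<in> field_auts E \<Longrightarrow> x \<in> E \<Longrightarrow> cmod (\<sigma> x) = cmod x"
  using field_auts_cases by fastforce

end

section \<open>The growth bound\<close>

text \<open>A run of \<open>\<lfloor>K * s\<rfloor>\<close> consecutive integers, translated by
  \<open>p\<close>, fits into \<open>K\<close> half-open intervals of length \<open>s\<close>
  starting at 0.\<close>

lemma floor_in_cells:
  fixes p s :: real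
  assumes "s > 0" "x \<in> {\<lceil>- p\<rceil>..<\<lceil>- p\<rceil> + \<lfloor>real K * s\<rfloor>}"
  shows "\<lfloor>(of_int x + p) / s\<rfloor> \<in> {0..<int K}"
proof -
  have "x + 1 \<le> \<lceil>- p\<rceil> + \<lfloor>real K * s\<rfloor>" "\<lceil>- p\<rceil> \<le> x" using assms(2) by auto
  then have "of_int x + p \<ge> 0" "of_int x + p < real K * s" by linarith+
  then have "0 \<le> (of_int x + p) / s" "(of_int x + p) / s < of_int (int K)" using assms(1) by (auto simp: field_simps)
  then show ?thesis by (simp add: floor_less_iff del: of_int_of_nat_eq)
qed

lemma floor_eq_imp_close:
  fixes a b s :: real
  assumes "s > 0" "\<lfloor>a / s\<rfloor> = \<lfloor>b / s\<rfloor>"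
  shows "\<bar>a - b\<bar> \<le> s"
proof -
  have "\<bar>a / s - b / s\<bar> < 1" using assms(2) by linarith
  then have "\<bar>(a - b) / s\<bar> < 1" by (simp add: diff_divide_distrib)
  then show ?thesis using assms(1) by (simp add: abs_divide)
qed

section \<open>The cell structure of the rational integers\<close>

lemma Rats_conj_ring: "conj_ring \<rat>"
  unfolding conj_ring_def by (auto elim!: Rats_cases')

lemma Ints_conj_ring: "conj_ring \<int>"
  unfolding conj_ring_def by (auto elim!: Ints_cases)

text \<open>Rational numbers lie on a line, so one cell coordinate carries the information and the
  other is constantly 0.\<close>

lemma Rats_lattice_order_cells: "lattice_order_cells \<rat> \<int> 1 1 (\<lambda>s z. (\<lfloor>Re z / s\<rfloor>, 0))"
proof
  show "conj_ring \<rat>" "conj_ring \<int>" by (fact Rats_conj_ring Ints_conj_ring)+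
  show "\<exists>d::nat. d > 0 \<and> of_nat d * x \<in> \<int>" if "x \<in> \<rat>" for x :: complex
  proof -
    obtain a b :: int where "b > 0" "x = of_int a / of_int b" using \<open>x \<in> \<rat>\<close> by (cases rule: Rats_cases') auto
    then show ?thesis by (intro exI[of _ "nat b"]) auto
  qed
  show "\<exists>g\<in>\<int>. \<exists>x\<in>\<int>. \<exists>y\<in>\<int>. \<exists>c\<in>\<int>. \<exists>d\<in>\<int>. g = x * a + y * b \<and> a = g * c \<and> b = g * d"
    if "a \<in> \<int>" "b \<in> \<int>" for a b :: complex
  proof -
    obtain i j where ij: "a = of_int i" "b = of_int j" using \<open>a \<in> \<int>\<close> \<open>b \<in> \<int>\<close> by (auto elim!: Ints_cases)
    obtain u v where uv: "u * i + v * j = gcd i j" using bezout_int by blast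
    obtain c where c: "i = gcd i j * c" using gcd_dvd1 by blast
    obtain d where d: "j = gcd i j * d" using gcd_dvd2 by blast
    have "of_int (gcd i j) = of_int u * a + of_int v * b" unfolding ij uv[symmetric] by simp
    moreover have "a = of_int (gcd i j) * of_int c" "b = of_int (gcd i j) * of_int d"
      unfolding ij of_int_mult[symmetric] c[symmetric] d[symmetric] by auto
    ultimately show ?thesis
      by - (rule bexI[of _ "of_int (gcd i j)"], rule bexI[of _ "of_int u"], rule bexI[of _ "of_int v"],
        rule bexI[of _ "of_int c"], rule bexI[of _ "of_int d"], blast, simp_all)
  qed
  show "\<exists>c\<in>\<int>. cmod (z - c) \<le> 1" if "z \<in> \<rat>" for z
  proof -
    have "Im z = 0" using \<open>z \<in> \<rat>\<close> by (auto elim!: Rats_cases')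
    then have "cmod (z - of_int \<lfloor>Re z\<rfloor>) = \<bar>Re z - of_int \<lfloor>Re z\<rfloor>\<bar>" by (simp add: cmod_def)
    also have "\<dots> \<le> 1" by linarith
    finally show ?thesis using Ints_of_int by blast
  qed
  show "\<exists>(n::nat \<Rightarrow> nat) \<eta>. (\<forall>t<3. \<eta> t \<in> \<int> \<and> cmod (\<eta> t) \<le> 1) \<and>
      a = (\<Sum>t<3. of_nat (n t) * \<eta> t) \<and> real (\<Sum>t<3. n t) \<le> 1 * (cmod a + 1)" if "a \<in> \<int>" for a :: complex
  proof -
    obtain i where i: "a = of_int i" using \<open>a \<in> \<int>\<close> by (auto elim!: Ints_cases)
    define n where "n t = (if t = (0::nat) then nat \<bar>i\<bar> else 0)" for t
    define \<eta> where "\<eta> t = (of_int (sgn i) :: complex)" for t :: nat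
    have "cmod (of_int (sgn i)) \<le> 1" by (auto simp: sgn_if)
    moreover have "a = (\<Sum>t<3. of_nat (n t) * \<eta> t)"
      unfolding i n_def \<eta>_def by (simp add: eval_nat_numeral sgn_if)
    moreover have "real (\<Sum>t<3. n t) \<le> 1 * (cmod a + 1)" unfolding i n_def by (simp add: eval_nat_numeral)
    ultimately show ?thesis unfolding \<eta>_def by (intro exI[of _ n] exI[of _ "\<lambda>_. of_int (sgn i)"]) auto
  qed
  show "\<exists>Z. finite Z \<and> card Z = K ^ 1 \<and> (\<forall>t\<in>\<rat>. \<exists>X\<subseteq>\<int>. finite X \<and> nat \<lfloor>real K * s\<rfloor> ^ 1 \<le> card X \<and>
      (\<forall>x\<in>X. (\<lfloor>Re (x + t) / s\<rfloor>, 0::int) \<in> Z))" if "s > 0" for s :: real and K :: nat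
  proof (rule exI[of _ "{0..<int K} \<times> {0::int}"], intro conjI ballI)
    let ?Z = "{0..<int K} \<times> {0::int}"
    show "finite ?Z" "card ?Z = K ^ 1" by auto
    fix t :: complex
    define I where "I = {\<lceil>- Re t\<rceil>..<\<lceil>- Re t\<rceil> + \<lfloor>real K * s\<rfloor>}"
    have "card ((of_int :: int \<Rightarrow> complex) ` I) = nat \<lfloor>real K * s\<rfloor>"
      unfolding I_def by (subst card_image) (auto simp: inj_on_def)
    moreover have "(\<lfloor>Re (x + t) / s\<rfloor>, 0) \<in> ?Z" if "x \<in> of_int ` I" for x :: complex
      using floor_in_cells[OF \<open>s > 0\<close>, of _ "Re t" K] that unfolding I_def by auto
    ultimately show "\<exists>X\<subseteq>\<int>. finite X \<and> nat \<lfloor>real K * s\<rfloor> ^ 1 \<le> card X \<and> (\<forall>x\<in>X. (\<lfloor>Re (x + t) / s\<rfloor>, 0) \<in> ?Z)"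
      by (intro exI[of _ "of_int ` I"]) (auto simp: I_def)
  qed
  show "cmod (a - b) \<le> 1 * s" if "s > 0" "a \<in> \<rat>" "b \<in> \<rat>" "(\<lfloor>Re a / s\<rfloor>, 0::int) = (\<lfloor>Re b / s\<rfloor>, 0)" for s a b
  proof -
    have "Im a = 0" "Im b = 0" using \<open>a \<in> \<rat>\<close> \<open>b \<in> \<rat>\<close> by (auto elim!: Rats_cases')
    then have "cmod (a - b) = \<bar>Re a - Re b\<bar>" by (simp add: cmod_def)
    then show ?thesis using floor_eq_imp_close[OF \<open>s > 0\<close>, of "Re a" "Re b"] that(4) by simp
  qed
qed (auto elim!: Ints_cases Rats_cases' simp: Ints_subset_Rats)

section \<open>The cell structure of imaginary quadratic integers\<close>

context imaginary_quadratic
begin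

text \<open>Large enough for all uses of \<open>B\<close>: rounding in both coordinates costs
  \<open>1 + cmod \<delta>\<close>, \<open>coord\<close> can exceed \<open>cmod\<close> by the
  factor \<open>1 / \<bar>Im \<delta>\<bar>\<close>, and 3 covers the additive losses.\<close>

definition cell_const :: real where "cell_const = 3 + cmod \<delta> + 1 / \<bar>Im \<delta>\<bar>"

lemma cell_const_ge: "cell_const \<ge> 3 + cmod \<delta>" "cell_const \<ge> 1 + 1 / \<bar>Im \<delta>\<bar>" "cell_const \<ge> 3"
proof -
  have "0 \<le> 1 / \<bar>Im \<delta>\<bar>" "0 \<le> cmod \<delta>" by auto
  then show "cell_const \<ge> 3 + cmod \<delta>" "cell_const \<ge> 1 + 1 / \<bar>Im \<delta>\<bar>" "cell_const \<ge> 3" unfolding cell_const_def by linarith+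
qed

definition coord :: "complex \<Rightarrow> real" where "coord z = Im z / Im \<delta>"

lemma coord_eq: "z = of_real (Re z) + of_real (coord z) * \<delta>"
  using Im_\<delta> by (simp add: complex_eq_iff coord_def)

lemma coord_diff: "coord (a - b) = coord a - coord b"
  by (simp add: coord_def diff_divide_distrib)

lemma norm_coord_le: "cmod z \<le> \<bar>Re z\<bar> + \<bar>coord z\<bar> * cmod \<delta>"
  by (subst coord_eq) (metis norm_mult norm_of_real norm_triangle_ineq)

lemma coord_int: "coord (of_int a + of_int b * \<delta>) = of_int b" "Re (of_int a + of_int b * \<delta>) = of_int a"
  using Im_\<delta> by (auto simp: coord_def)

lemma int_comb_OE: "of_int a + of_int b * \<delta> \<in> OE"
  unfolding OE_iff by (intro alm_int_M M_I) auto

lemma floor_remainder: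
  "cmod (z - (of_int \<lfloor>Re z\<rfloor> + of_int \<lfloor>coord z\<rfloor> * \<delta>)) \<le> 1 + cmod \<delta>"
proof -
  let ?w = "of_int \<lfloor>Re z\<rfloor> + of_int \<lfloor>coord z\<rfloor> * \<delta>"
  have "cmod (z - ?w) \<le> \<bar>Re z - of_int \<lfloor>Re z\<rfloor>\<bar> + \<bar>coord z - of_int \<lfloor>coord z\<rfloor>\<bar> * cmod \<delta>"
    using norm_coord_le[of "z - ?w"] unfolding coord_diff coord_int minus_complex.sel .
  also have "\<dots> \<le> 1 + 1 * cmod \<delta>" by (intro add_mono mult_right_mono) (linarith | simp)+
  finally show ?thesis by simp
qed

text \<open>Three pieces: the integral parts along 1 and \<open>\<delta>\<close>, as signs with
  multiplicities, and the remainder with multiplicity 1. The remainder is needed because integers of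
  the field need not have integral coordinates.\<close>

lemma decomposition:
  assumes a: "a \<in> OE"
  shows "\<exists>(n::nat \<Rightarrow> nat) \<eta>. (\<forall>t<3. \<eta> t \<in> OE \<and> cmod (\<eta> t) \<le> cell_const) \<and>
      a = (\<Sum>t<3. of_nat (n t) * \<eta> t) \<and> real (\<Sum>t<3. n t) \<le> cell_const * (cmod a + 1)"
proof -
  let ?p = "\<lfloor>Re a\<rfloor>" and ?q = "\<lfloor>coord a\<rfloor>"
  define \<rho> where "\<rho> = a - (of_int ?p + of_int ?q * \<delta>)"
  have \<rho>: "\<rho> \<in> OE" unfolding \<rho>_def by (rule conj_ringD(4)[OF OE_conj_ring a int_comb_OE])
  define n :: "nat \<Rightarrow> nat" where "n = (\<lambda>_. 1)(0 := nat \<bar>?p\<bar>, 1 := nat \<bar>?q\<bar>)"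
  define \<eta> :: "nat \<Rightarrow> complex" where "\<eta> = (\<lambda>_. \<rho>)(0 := of_int (sgn ?p), 1 := of_int (sgn ?q) * \<delta>)"
  have "cmod (of_int (sgn ?p)) \<le> cell_const" using cell_const_ge(3) by (auto simp: sgn_if)
  moreover have "cmod (of_int (sgn ?q) * \<delta>) \<le> cell_const" using cell_const_ge(1,3) by (auto simp: sgn_if norm_mult)
  moreover have "cmod \<rho> \<le> cell_const" using floor_remainder[of a] cell_const_ge(1) unfolding \<rho>_def by linarith
  moreover have "of_int (sgn ?p) \<in> OE" "of_int (sgn ?q) * \<delta> \<in> OE" using int_comb_OE[of "sgn ?p" 0] int_comb_OE[of 0 "sgn ?q"] by simp_all
  ultimately have "\<forall>t<3. \<eta> t \<in> OE \<and> cmod (\<eta> t) \<le> cell_const" unfolding \<eta>_def using \<rho> by auto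
  moreover have "a = (\<Sum>t<3. of_nat (n t) * \<eta> t)"
  proof -
    have abs_sgn: "of_nat (nat \<bar>i\<bar>) * of_int (sgn i) = (of_int i :: complex)" for i by (simp add: sgn_if)
    have "(\<Sum>t<3. of_nat (n t) * \<eta> t) = of_nat (nat \<bar>?p\<bar>) * of_int (sgn ?p) + of_nat (nat \<bar>?q\<bar>) * of_int (sgn ?q) * \<delta> + \<rho>"
      by (simp add: eval_nat_numeral n_def \<eta>_def)
    then show ?thesis unfolding abs_sgn \<rho>_def by simp
  qed
  moreover have "real (\<Sum>t<3. n t) \<le> cell_const * (cmod a + 1)"
  proof -
    have "real (\<Sum>t<3. n t) = \<bar>of_int ?p\<bar> + \<bar>of_int ?q\<bar> + 1" by (simp add: eval_nat_numeral n_def)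
    then have "real (\<Sum>t<3. n t) \<le> \<bar>Re a\<bar> + \<bar>coord a\<bar> + 3" by linarith
    moreover have "\<bar>coord a\<bar> \<le> (1 / \<bar>Im \<delta>\<bar>) * cmod a"
      using divide_right_mono[OF abs_Im_le_cmod[of a], of "\<bar>Im \<delta>\<bar>"] by (simp add: coord_def abs_divide)
    moreover have "(1 + 1 / \<bar>Im \<delta>\<bar>) * cmod a \<le> cell_const * cmod a" by (intro mult_right_mono cell_const_ge(2)) simp
    ultimately show ?thesis using abs_Re_le_cmod[of a] cell_const_ge(3) unfolding distrib_left distrib_right by linarith
  qed
  ultimately show ?thesis by blast
qed

text \<open>The points \<open>a + b * \<delta>\<close> with integers \<open>a\<close> and
  \<open>b\<close> already suffice for the lower bound, and both of their coordinates are translated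
  independently.\<close>

lemma points_in_cells:
  assumes s: "s > 0"
  shows "\<exists>X\<subseteq>OE. finite X \<and> nat \<lfloor>real K * s\<rfloor> ^ 2 \<le> card X \<and>
      (\<forall>x\<in>X. (\<lfloor>Re (x + t) / s\<rfloor>, \<lfloor>coord (x + t) / s\<rfloor>) \<in> {0..<int K} \<times> {0..<int K})"
proof -
  define I where "I p = {\<lceil>- p\<rceil>..<\<lceil>- p\<rceil> + \<lfloor>real K * s\<rfloor>}" for p :: real
  define G where "G = (\<lambda>(a, b). of_int a + of_int b * \<delta>)"
  define X where "X = G ` (I (Re t) \<times> I (coord t))"
  have "inj G"
  proof (rule injI)
    fix u v assume *: "G u = G v"
    show "u = v" using arg_cong[OF *, of coord] arg_cong[OF *, of Re]
      unfolding G_def by (cases u; cases v) (simp only: prod.case coord_int of_int_eq_iff)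
  qed
  then have "card X = card (I (Re t) \<times> I (coord t))" unfolding X_def by (intro card_image) (auto intro: inj_on_subset)
  then have "card X = nat \<lfloor>real K * s\<rfloor> ^ 2" by (simp add: I_def power2_eq_square)
  moreover have "X \<subseteq> OE" unfolding X_def G_def using int_comb_OE by auto
  moreover have "finite X" unfolding X_def I_def by auto
  moreover have "(\<lfloor>Re (x + t) / s\<rfloor>, \<lfloor>coord (x + t) / s\<rfloor>) \<in> {0..<int K} \<times> {0..<int K}" if "x \<in> X" for x
  proof -
    obtain a b where ab: "a \<in> I (Re t)" "b \<in> I (coord t)" "x = of_int a + of_int b * \<delta>" using \<open>x \<in> X\<close> unfolding X_def G_def by auto
    have "Re (x + t) = of_int a + Re t" using coord_int(2)[of a b] unfolding ab(3) by simp
    moreover have "coord (x + t) = of_int b + coord t" using coord_int(1)[of a b] unfolding ab(3) coord_def by (simp add: add_divide_distrib)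
    ultimately show ?thesis using floor_in_cells[OF s ab(1)[unfolded I_def]] floor_in_cells[OF s ab(2)[unfolded I_def]] by simp
  qed
  ultimately show ?thesis by (intro exI[of _ X]) auto
qed

lemma cells_order:
  assumes "class_number E = 1"
  shows "lattice_order_cells E OE cell_const 2 (\<lambda>s z. (\<lfloor>Re z / s\<rfloor>, \<lfloor>coord z / s\<rfloor>))"
proof
  show "conj_ring E" "conj_ring OE" by (fact E_conj_ring OE_conj_ring)+
  show "inverse x \<in> E" if "x \<in> E" for x by (rule EI(7)[OF that])
  show "OE \<subseteq> E" unfolding ring_of_integers_def by auto
  show "x \<in> \<int>" if "x \<in> OE" "x \<in> \<real>" for x using alm_int_real that unfolding OE_iff by blast
  show "\<exists>d::nat. d > 0 \<and> of_nat d * x \<in> OE" if "x \<in> E" for x using M_denominator[OF that] alm_int_M unfolding OE_iff by blast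
  show "\<exists>g\<in>OE. \<exists>x\<in>OE. \<exists>y\<in>OE. \<exists>c\<in>OE. \<exists>d\<in>OE. g = x * a + y * b \<and> a = g * c \<and> b = g * d"
    if "a \<in> OE" "b \<in> OE" for a b by (rule OE_bezout[OF assms that])
  show "cell_const \<ge> 1" using cell_const_ge(3) by simp
  show "\<exists>c\<in>OE. cmod (z - c) \<le> cell_const" for z
    using floor_remainder[of z] int_comb_OE cell_const_ge(1) by (meson add_increasing norm_ge_zero order_trans add_right_mono one_le_numeral)
  show "\<exists>(n::nat \<Rightarrow> nat) \<eta>. (\<forall>t<3. \<eta> t \<in> OE \<and> cmod (\<eta> t) \<le> cell_const) \<and>
      a = (\<Sum>t<3. of_nat (n t) * \<eta> t) \<and> real (\<Sum>t<3. n t) \<le> cell_const * (cmod a + 1)" if "a \<in> OE" for a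
    by (rule decomposition[OF that])
  show "(2::nat) > 0" by simp
  show "\<exists>Z. finite Z \<and> card Z = K ^ 2 \<and> (\<forall>t\<in>E. \<exists>X\<subseteq>OE. finite X \<and> nat \<lfloor>real K * s\<rfloor> ^ 2 \<le> card X \<and>
      (\<forall>x\<in>X. (\<lfloor>Re (x + t) / s\<rfloor>, \<lfloor>coord (x + t) / s\<rfloor>) \<in> Z))" if "s > 0" for s and K :: nat
    using points_in_cells[OF that, of K] by (intro exI[of _ "{0..<int K} \<times> {0..<int K}"]) (auto simp: power2_eq_square)
  show "cmod (a - b) \<le> cell_const * s"
    if "s > 0" "(\<lfloor>Re a / s\<rfloor>, \<lfloor>coord a / s\<rfloor>) = (\<lfloor>Re b / s\<rfloor>, \<lfloor>coord b / s\<rfloor>)" for s a b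
  proof -
    have "\<bar>Re a - Re b\<bar> \<le> s" "\<bar>coord a - coord b\<bar> \<le> s" using that by (auto intro: floor_eq_imp_close)
    then have "cmod (a - b) \<le> s + s * cmod \<delta>"
      using norm_coord_le[of "a - b"] mult_right_mono[of "\<bar>coord a - coord b\<bar>" s "cmod \<delta>"] unfolding coord_diff by simp
    also have "\<dots> = (1 + cmod \<delta>) * s" by (simp add: algebra_simps)
    also have "\<dots> \<le> cell_const * s" using cell_const_ge(1) that(1) by (intro mult_right_mono) auto
    finally show ?thesis .
  qed
qed

end

text \<open>A nonreal \<open>\<alpha>\<close> and 1 span the field by dimension. Completing the
  square in the quadratic equation of \<open>\<alpha>\<close> yields a generator with rational
  square; being nonreal with real square, it is purely imaginary after scaling as well.\<close>

lemma imaginary_quadratic_of_field: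
  assumes "imaginary_quadratic_field E"
  shows "\<exists>\<delta> D. imaginary_quadratic E \<delta> D"
proof -
  let ?sc = "\<lambda>(q::rat) (z::complex). of_rat q * z"
  interpret V: vector_space ?sc by standard (auto simp: algebra_simps of_rat_add of_rat_mult)
  have sub: "subfield E complex_ring" and dim: "V.dim E = 2" and nr: "\<not> E \<subseteq> \<real>"
    using assms unfolding imaginary_quadratic_field_def rat_degree_def by auto
  note EI = subfield_complex_ring[OF sub]
  obtain \<alpha> where \<alpha>: "\<alpha> \<in> E" "\<alpha> \<notin> \<real>" using nr by blast
  have span1: "z \<in> \<real>" if "z \<in> V.span {1}" for z
  proof -
    obtain k where "z = of_rat k" using \<open>z \<in> V.span {1}\<close> by (auto simp: V.span_insert V.span_empty)
    then have "z \<in> \<rat>" by simp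
    then show ?thesis by (auto elim!: Rats_cases')
  qed
  have ind: "V.independent {\<alpha>, 1}"
    by (rule V.independent_insertI) (use span1 \<alpha>(2) V.independent_insertI[of 1 "{}"] in auto)
  have ne: "\<alpha> \<noteq> 1" using \<alpha>(2) by auto
  obtain B where B: "B \<subseteq> E" "V.independent B" "E \<subseteq> V.span B" "card B = 2" using V.basis_exists[of E] dim by auto
  have finB: "finite B" using B(4) card.infinite by force
  have span: "z \<in> V.span {\<alpha>, 1}" if z: "z \<in> E" for z
  proof (rule ccontr)
    assume n: "z \<notin> V.span {\<alpha>, 1}"
    then have "V.independent {z, \<alpha>, 1}" using V.independent_insertI[OF n ind] by simp
    moreover have "{z, \<alpha>, 1} \<subseteq> V.span B" using z \<alpha>(1) EI(2) B(3) by auto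
    ultimately have "card {z, \<alpha>, 1} \<le> 2" using V.independent_span_bound[OF finB] B(4) by metis
    moreover have "z \<notin> {\<alpha>, 1}" using n V.span_superset by blast
    ultimately show False using ne by auto
  qed
  have comb: "\<exists>p\<in>\<rat>. \<exists>q\<in>\<rat>. z = p + q * \<alpha>" if z: "z \<in> E" for z
  proof -
    obtain k where "z - of_rat k * \<alpha> \<in> V.span {1}" using span[OF z] unfolding V.span_insert[of \<alpha>] by auto
    then obtain j where "z - of_rat k * \<alpha> = of_rat j" by (auto simp: V.span_insert V.span_empty)
    then have "z = of_rat j + of_rat k * \<alpha>" by (simp add: algebra_simps)
    then show ?thesis using Rats_of_rat by blast
  qed
  obtain p q where pq: "p \<in> \<rat>" "q \<in> \<rat>" "\<alpha> * \<alpha> = p + q * \<alpha>" using comb[OF EI(4)[OF \<alpha>(1) \<alpha>(1)]] by blast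
  \<comment> \<open>Completes the square in
    \<open>\<alpha> * \<alpha> = p + q * \<alpha>\<close>.\<close>
  define d where "d = 2 * \<alpha> - q"
  have d2: "d * d = 4 * p + q * q"
  proof -
    have "d * d = 4 * (\<alpha> * \<alpha>) - 4 * q * \<alpha> + q * q" unfolding d_def by (simp add: algebra_simps)
    then show ?thesis unfolding pq(3) by (simp add: algebra_simps)
  qed
  have "4 * p + q * q \<in> \<rat>" using pq by simp
  then obtain a b :: int where ab: "b > 0" "4 * p + q * q = of_int a / of_int b" by (cases rule: Rats_cases') auto
  \<comment> \<open>Multiplying by the denominator \<open>b\<close> of \<open>d * d\<close> makes
    the square the integer \<open>b * a\<close>.\<close>
  define \<delta> where "\<delta> = of_int b * d"
  have \<delta>2: "\<delta>\<^sup>2 = of_int (b * a)"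
    unfolding \<delta>_def power_mult_distrib using ab d2 by (simp add: power2_eq_square field_simps)
  have Imq: "Im q = 0" using pq(2) by (auto elim!: Rats_cases')
  have Im\<delta>: "Im \<delta> \<noteq> 0" using \<alpha>(2) ab(1) Imq unfolding \<delta>_def d_def by (simp add: complex_is_Real_iff)
  have "Im (\<delta>\<^sup>2) = 0" unfolding \<delta>2 by simp
  then have Re\<delta>: "Re \<delta> = 0" using Im\<delta> by (simp add: power2_eq_square)
  have \<alpha>eq: "\<alpha> = q / 2 + (1 / (2 * of_int b)) * \<delta>" unfolding \<delta>_def d_def using ab(1) by (simp add: field_simps)
  have r: "x \<in> E" if "x \<in> \<rat>" for x by (rule subfield_Rats[OF sub that])
  have "\<exists>p'\<in>\<rat>. \<exists>q'\<in>\<rat>. z = p' + q' * \<delta>" if z: "z \<in> E" for z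
  proof -
    obtain u v where uv: "u \<in> \<rat>" "v \<in> \<rat>" "z = u + v * \<alpha>" using comb[OF z] by blast
    have "z = (u + v * (q / 2)) + (v * (1 / (2 * of_int b))) * \<delta>" unfolding uv(3) by (subst \<alpha>eq) (simp add: algebra_simps)
    moreover have "u + v * (q / 2) \<in> \<rat>" "v * (1 / (2 * of_int b)) \<in> \<rat>" using uv pq(2) by auto
    ultimately show ?thesis by blast
  qed
  moreover have "\<delta> \<in> E" unfolding \<delta>_def d_def using \<alpha>(1) r pq(2) by (intro EI(4) EI(6)) auto
  moreover have "cnj \<delta> = - \<delta>" using Re\<delta> by (simp add: complex_eq_iff)
  ultimately have "imaginary_quadratic E \<delta> (b * a)"
    using sub \<delta>2 Im\<delta> by (intro imaginary_quadratic.intro) (auto simp: complex_is_Real_iff)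
  then show ?thesis by blast
qed

section \<open>Translation into the definitions of the statement\<close>

lemma norm_sum_iff:
  "norm_sum S m r \<phi> \<longleftrightarrow> (\<exists>l. (\<forall>k<r. \<forall>i<m. l k i \<in> S) \<and> \<phi> = (\<lambda>x. \<Sum>k<r. (cmod (\<Sum>i<m. l k i * x i))\<^sup>2))"
proof
  assume "norm_sum S m r \<phi>"
  then show "\<exists>l. (\<forall>k<r. \<forall>i<m. l k i \<in> S) \<and> \<phi> = (\<lambda>x. \<Sum>k<r. (cmod (\<Sum>i<m. l k i * x i))\<^sup>2)"
  proof (induction rule: norm_sum.induct)
    case (step l r \<phi>)
    then obtain L where L: "\<forall>k<r. \<forall>i<m. L k i \<in> S" "\<phi> = (\<lambda>x. \<Sum>k<r. (cmod (\<Sum>i<m. L k i * x i))\<^sup>2)" by blast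
    obtain c where c: "\<forall>j<m. c j \<in> S" "l = (\<lambda>x. \<Sum>j<m. c j * x j)" using step(1) unfolding linform_def by blast
    have "\<forall>k<Suc r. \<forall>i<m. (L(r := c)) k i \<in> S" using L(1) c(1) by (auto simp: less_Suc_eq)
    moreover have "(\<lambda>x. \<phi> x + (cmod (l x))\<^sup>2) = (\<lambda>x. \<Sum>k<Suc r. (cmod (\<Sum>i<m. (L(r := c)) k i * x i))\<^sup>2)"
      unfolding L(2) c(2) by auto
    ultimately show ?case by blast
  qed auto
next
  assume "\<exists>l. (\<forall>k<r. \<forall>i<m. l k i \<in> S) \<and> \<phi> = (\<lambda>x. \<Sum>k<r. (cmod (\<Sum>i<m. l k i * x i))\<^sup>2)"
  then obtain l where l: "\<forall>k<r. \<forall>i<m. l k i \<in> S" "\<phi> = (\<lambda>x. \<Sum>k<r. (cmod (\<Sum>i<m. l k i * x i))\<^sup>2)" by blast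
  have "norm_sum S m (card {..<r} * 1) (\<lambda>x. \<Sum>k<r. (cmod (\<Sum>i<m. l k i * x i))\<^sup>2)"
    by (intro norm_sum_sum norm_sum_single linformI) (use l(1) in auto)
  then show "norm_sum S m r \<phi>" unfolding l(2) by simp
qed

lemma represented_by_I_iff:
  assumes star: "star E = (\<lambda>x\<in>E. cnj x)"
  shows "represented_by_I E n r f \<longleftrightarrow>
    (\<exists>\<phi>. norm_sum (ring_of_integers E) n r \<phi> \<and> f = (\<lambda>x\<in>coord_space E n. complex_of_real (\<phi> x)))"
proof -
  have eq: "(\<lambda>x\<in>coord_space E n. \<Sum>k<r. norm_of_linear_form E n (l k) x) =
      (\<lambda>x\<in>coord_space E n. complex_of_real (\<Sum>k<r. (cmod (\<Sum>i<n. l k i * x i))\<^sup>2))"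
    if l: "\<forall>k<r. \<forall>i<n. l k i \<in> ring_of_integers E" for l
  proof (rule restrict_ext)
    fix x assume x: "x \<in> coord_space E n"
    have "norm_of_linear_form E n (l k) x = complex_of_real ((cmod (\<Sum>i<n. l k i * x i))\<^sup>2)" if k: "k < r" for k
    proof -
      have "(\<Sum>i<n. star E (l k i) * star E (x i)) = (\<Sum>i<n. cnj (l k i) * cnj (x i))"
        using x l k unfolding coord_space_def star ring_of_integers_def by (intro sum.cong) auto
      then show ?thesis using x unfolding norm_of_linear_form_def by (simp add: complex_norm_square flip: of_real_power)
    qed
    then show "(\<Sum>k<r. norm_of_linear_form E n (l k) x) = complex_of_real (\<Sum>k<r. (cmod (\<Sum>i<n. l k i * x i))\<^sup>2)"
      by simp
  qed
  show ?thesis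
  proof
    assume "represented_by_I E n r f"
    then obtain l where l: "\<forall>k<r. \<forall>i<n. l k i \<in> ring_of_integers E"
      "f = (\<lambda>x\<in>coord_space E n. \<Sum>k<r. norm_of_linear_form E n (l k) x)" unfolding represented_by_I_def by blast
    have "norm_sum (ring_of_integers E) n r (\<lambda>x. \<Sum>k<r. (cmod (\<Sum>i<n. l k i * x i))\<^sup>2)"
      unfolding norm_sum_iff using l(1) by (intro exI[of _ l]) simp
    then show "\<exists>\<phi>. norm_sum (ring_of_integers E) n r \<phi> \<and> f = (\<lambda>x\<in>coord_space E n. complex_of_real (\<phi> x))"
      using l(2)[unfolded eq[OF l(1)]] by (intro exI[of _ "\<lambda>x. \<Sum>k<r. (cmod (\<Sum>i<n. l k i * x i))\<^sup>2"]) simp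
  next
    assume "\<exists>\<phi>. norm_sum (ring_of_integers E) n r \<phi> \<and> f = (\<lambda>x\<in>coord_space E n. complex_of_real (\<phi> x))"
    then obtain l where l: "\<forall>k<r. \<forall>i<n. l k i \<in> ring_of_integers E"
      "f = (\<lambda>x\<in>coord_space E n. complex_of_real (\<Sum>k<r. (cmod (\<Sum>i<n. l k i * x i))\<^sup>2))"
      unfolding norm_sum_iff by blast
    then show "represented_by_I E n r f" unfolding represented_by_I_def
      by (intro exI[of _ l] conjI) (simp_all only: eq[OF l(1)])
  qed
qed

lemma g_star_le:
  assumes "lattice_order_cells E (ring_of_integers E) B d cell" "star E = (\<lambda>x\<in>E. cnj x)"
  shows "g_star E n \<le> enat (n * lattice_order_cells.bound_const B n)"
proof -
  have "represented_by_I E n (n * lattice_order_cells.bound_const B n) f" if "f \<in> Sigma_star E n" for f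
    using that lattice_order_cells.norm_sum_bounded[OF assms(1) le_refl]
    unfolding Sigma_star_def represented_by_I_iff[OF assms(2)] by blast
  then show ?thesis unfolding g_star_def by (intro Inf_lower) auto
qed

text \<open>The supremum exceeds the infimum at 0 only if the family is bounded above, so
  boundedness comes first: a point within \<open>B\<close> of \<open>x\<close> bounds the norm by a
  power of \<open>B\<close>, as automorphisms preserve absolute values.\<close>

lemma beta_nonneg:
  assumes "conj_ring E" "0 \<in> ring_of_integers E" "\<And>z. z \<in> E \<Longrightarrow> \<exists>c\<in>ring_of_integers E. cmod (z - c) \<le> B"
    and auts: "\<And>\<sigma> x. \<sigma> \<in> field_auts E \<Longrightarrow> x \<in> E \<Longrightarrow> cmod (\<sigma> x) = cmod x"
  shows "beta E \<ge> 0"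
proof -
  define f where "f x c = cmod (field_norm E (x - c)) powr (1 / real (rat_degree E))" for x c
  define k where "k = card (field_auts E)"
  have f0: "f x c \<ge> 0" for x c unfolding f_def by simp
  have nonempty: "ring_of_integers E \<noteq> {}" using assms(2) by blast
  have up: "(INF c\<in>ring_of_integers E. f x c) \<le> (B ^ k) powr (1 / real (rat_degree E))" if x: "x \<in> E" for x
  proof -
    obtain c where c: "c \<in> ring_of_integers E" "cmod (x - c) \<le> B" using assms(3)[OF x] by blast
    then have "c \<in> E" unfolding ring_of_integers_def by blast
    then have "x - c \<in> E" using conj_ringD(4)[OF assms(1) x] by blast
    then have "cmod (field_norm E (x - c)) = cmod (x - c) ^ k"
      unfolding field_norm_def prod_norm[symmetric] k_def by (simp add: auts)
    also have "\<dots> \<le> B ^ k" using c(2) by (intro power_mono) auto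
    finally have "f x c \<le> (B ^ k) powr (1 / real (rat_degree E))" unfolding f_def by (intro powr_mono2) auto
    moreover have "(INF c\<in>ring_of_integers E. f x c) \<le> f x c"
      by (rule cINF_lower[OF _ c(1)]) (auto intro!: bdd_belowI2[of _ 0] f0)
    ultimately show ?thesis by simp
  qed
  have "0 \<le> (INF c\<in>ring_of_integers E. f 0 c)" by (rule cINF_greatest[OF nonempty f0])
  also have "\<dots> \<le> (SUP x\<in>E. INF c\<in>ring_of_integers E. f x c)"
    by (rule cSUP_upper[OF conj_ringD(1)[OF assms(1)]]) (auto intro!: bdd_aboveI2 up)
  finally show ?thesis unfolding beta_def f_def .
qed

text \<open>The exponent is quadratic in \<open>ln n\<close>, which is negligible against
  \<open>sqrt n\<close>.\<close>

lemma exp_sqrt_dominates: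
  fixes K c \<epsilon> :: real
  assumes "K > 0" "\<epsilon> > 0"
  shows "(\<lambda>n. real n * (K * real n ^ 10 * exp ((c + ln (real n)) * (ln (real n) + 3)) ^ 3 + 12 * real n + 6) / exp (\<epsilon> * sqrt (real n))) \<longlonglongrightarrow> 0"
  using assms by real_asymp

lemma bound_const_asymptotics:
  assumes "lattice_order_cells E R B d cell" and \<epsilon>: "\<epsilon> > 0"
  shows "\<exists>C>0. \<forall>n\<ge>1. real (n * lattice_order_cells.bound_const B n) \<le> C * exp (\<epsilon> * sqrt (real n))"
proof -
  interpret lattice_order_cells E R B d cell by fact
  \<comment> \<open>\<open>K * n ^ 10\<close> is the square of \<open>gap n\<close>.\<close>
  define K where "K = 624\<^sup>2 * B ^ 12"
  define c where "c = ln (8 * B\<^sup>2)"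
  define f where "f n = real n * (K * real n ^ 10 * exp ((c + ln (real n)) * (ln (real n) + 3)) ^ 3 + 12 * real n + 6)" for n :: nat
  have B: "B > 0" using B_ge_1 by simp
  have K: "K > 0" unfolding K_def using B by simp
  have "(\<lambda>n. f n / exp (\<epsilon> * sqrt (real n))) \<longlonglongrightarrow> 0"
    unfolding f_def by (rule exp_sqrt_dominates[OF K \<epsilon>])
  then have "Bseq (\<lambda>n. f n / exp (\<epsilon> * sqrt (real n)))" by (intro convergent_imp_Bseq convergentI)
  then obtain C where C: "C > 0" "\<And>n. norm (f n / exp (\<epsilon> * sqrt (real n))) \<le> C" by (auto elim: BseqE)
  have "real (n * bound_const n) \<le> C * exp (\<epsilon> * sqrt (real n))" if n: "n \<ge> 1" for n
  proof -
    have "ln (8 * B\<^sup>2 * real n) = c + ln (real n)" unfolding c_def using n B by (subst ln_mult_pos) auto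
    then have mb: "min_bound n = K * real n ^ 10 * exp ((c + ln (real n)) * (ln (real n) + 3)) ^ 3"
      unfolding min_bound_def gap_def hkz_const_def K_def by (simp add: power_mult_distrib flip: power_mult)
    have "min_bound n \<ge> 1" using min_bound_ge_1 n by simp
    \<comment> \<open>The 6 instead of 5 allows for rounding up \<open>min_bound n\<close>.\<close>
    then have "real (bound_const n) \<le> min_bound n + 12 * real n + 6" unfolding bound_const_def by simp linarith
    then have "real (n * bound_const n) \<le> f n" unfolding f_def mb by (simp add: mult_left_mono)
    also have "f n \<le> C * exp (\<epsilon> * sqrt (real n))" using C(2)[of n] by (simp add: field_simps abs_le_iff)
    finally show ?thesis .
  qed
  then show ?thesis using C(1) by blast
qed

lemma ring_of_integers_Rats: "ring_of_integers \<rat> = \<int>"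
  unfolding ring_of_integers_def using rational_algebraic_int_is_int int_imp_algebraic_int Ints_subset_Rats by blast

lemma star_Rats: "star \<rat> = (\<lambda>x\<in>\<rat>. cnj x)"
  unfolding star_def by (auto elim!: Rats_cases' intro!: restrict_ext)

lemma field_auts_Rats: "\<sigma> \<in> field_auts \<rat> \<Longrightarrow> x \<in> \<rat> \<Longrightarrow> \<sigma> x = x"
  by (rule ring_hom_fixes_rat[of \<rat>]) (auto dest: field_autsD)

lemma class_number_one_cells:
  assumes "E = \<rat> \<or> (imaginary_quadratic_field E \<and> class_number E = 1)"
  shows "\<exists>B d cell. lattice_order_cells E (ring_of_integers E) B d cell" "star E = (\<lambda>x\<in>E. cnj x)"
    "\<sigma> \<in> field_auts E \<Longrightarrow> x \<in> E \<Longrightarrow> cmod (\<sigma> x) = cmod x"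
proof -
  have *: "(\<exists>B d cell. lattice_order_cells E (ring_of_integers E) B d cell) \<and> star E = (\<lambda>x\<in>E. cnj x) \<and>
    (\<sigma> \<in> field_auts E \<longrightarrow> x \<in> E \<longrightarrow> cmod (\<sigma> x) = cmod x)"
    using assms
  proof
    assume E: "E = \<rat>"
    show ?thesis unfolding E ring_of_integers_Rats
      using Rats_lattice_order_cells star_Rats field_auts_Rats[of \<sigma> x] by auto
  next
    assume E: "imaginary_quadratic_field E \<and> class_number E = 1"
    then obtain \<delta> D where "imaginary_quadratic E \<delta> D" using imaginary_quadratic_of_field by blast
    then interpret imaginary_quadratic E \<delta> D .
    show ?thesis using cells_order E star_eq field_auts_norm by blast
  qed
  show "\<exists>B d cell. lattice_order_cells E (ring_of_integers E) B d cell" "star E = (\<lambda>x\<in>E. cnj x)"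
    "\<sigma> \<in> field_auts E \<Longrightarrow> x \<in> E \<Longrightarrow> cmod (\<sigma> x) = cmod x" using * by auto
qed

theorem theorem1p1:
  fixes E :: "complex set" and \<epsilon> :: real
  assumes "E = \<rat> \<or> (imaginary_quadratic_field E \<and> class_number E = 1)"
    and "\<epsilon> > 0"
  shows "\<exists>C::real. C > 0 \<and> (\<forall>n\<ge>1. ereal_of_enat (g_star E n)
           \<le> ereal (C * exp ((k_const E + \<epsilon>) * sqrt (real n))))"
proof -
  obtain B d cell where order: "lattice_order_cells E (ring_of_integers E) B d cell"
    using class_number_one_cells(1)[OF assms(1)] by blast
  interpret lattice_order_cells E "ring_of_integers E" B d cell by fact
  \<comment> \<open>This makes \<open>k_const E\<close> nonnegative, so the bound with exponent
    \<open>\<epsilon> * sqrt n\<close> implies the one with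
    \<open>k_const E + \<epsilon>\<close>.\<close>
  have "beta E \<ge> 0"
  proof (rule beta_nonneg[OF E_ring conj_ringD(1)[OF R_ring]])
    show "\<exists>c\<in>ring_of_integers E. cmod (z - c) \<le> B" if "z \<in> E" for z by (rule cover[OF that])
    show "cmod (\<sigma> x) = cmod x" if "\<sigma> \<in> field_auts E" "x \<in> E" for \<sigma> x
      by (rule class_number_one_cells(3)[OF assms(1) that])
  qed
  then have k: "k_const E \<ge> 0" unfolding k_const_def by simp
  obtain C where C: "C > 0" "\<And>n. n \<ge> 1 \<Longrightarrow> real (n * bound_const n) \<le> C * exp (\<epsilon> * sqrt (real n))"
    using bound_const_asymptotics[OF order assms(2)] by blast
  have "ereal_of_enat (g_star E n) \<le> ereal (C * exp ((k_const E + \<epsilon>) * sqrt (real n)))" if n: "n \<ge> 1" for n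
  proof -
    have "ereal_of_enat (g_star E n) \<le> ereal_of_enat (enat (n * bound_const n))"
      unfolding ereal_of_enat_le_iff by (rule g_star_le[OF order class_number_one_cells(2)[OF assms(1)]])
    also have "\<dots> = ereal (real (n * bound_const n))" by simp
    also have "\<dots> \<le> ereal (C * exp (\<epsilon> * sqrt (real n)))" using C(2)[OF n] by (simp only: ereal_less_eq)
    also have "\<dots> \<le> ereal (C * exp ((k_const E + \<epsilon>) * sqrt (real n)))"
      using C(1) k by (simp add: mult_right_mono)
    finally show ?thesis .
  qed
  then show ?thesis using C(1) by blast
qed

end
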